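(* There is a well-defined rational map $$\Phi_2:(W_4\otimes\textstyle\bigwedge^2V_6)^{sm}/GL(V_6)\dashrightarrow\mathcal{H},\qquad \alpha\mapsto (S,\{H_0,\dots,H_4\}),$$ where $S$ is the pfaffian cubic surface defined by $\alpha$ and the planes $H_i$ are defined as follows: for general $\alpha$, let $\pi_3=\mathbb{P}(W_4^\vee)\subset\mathbb{P}(\bigwedge^2V_6)$ be embedded by $\alpha$, let $u_0,\dots,u_4$ be the five points of $G(2,V_6)$ attached to it, i.e. such that $\pi_3$ is contained in the linear span $\langle u_0,\dots,u_4\rangle$ (a $\mathbb{P}^4$ meeting $G(2,V_6)$ exactly in these $5$ linearly independent points), and set $$H_i=\pi_3\cap\langle u_j\;|\;0\le j\le 4,\ j\ne i\rangle .$$ In particular $\{H_0,\dots,H_4\}$ is a complete pentahedron inscribed in $S$.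
   Context: Everything is over $\mathbb{C}$. $V_6$ is a $6$-dimensional vector space; $\pi_3$ is a $3$-dimensional projective space, $W_4=H^0(\mathcal{O}_{\pi_3}(1))$, so $\pi_3=\mathbb{P}(W_4^\vee)$ (lines in $W_4^\vee$). An element $\alpha\in W_4\otimes\bigwedge^2V_6$ is a skew-symmetric $6\times6$ matrix of linear forms on $\pi_3$, equivalently a linear map $W_4^\vee\to\bigwedge^2V_6$; when injective it embeds $\pi_3$ in $\mathbb{P}(\bigwedge^2V_6)$. $(W_4\otimes\bigwedge^2V_6)^{sm}$ is the open subset where the pfaffian of $\alpha$ defines a smooth cubic surface $S\subset\pi_3$. $GL(V_6)$ acts by $(P,M)\mapsto{}^tPMP$. $G(2,V_6)\subset\mathbb{P}(\bigwedge^2V_6)$ is the Plücker-embedded Grassmannian. Fact used in the definition: for a general $4$-dimensional subspace $W_4^\vee\subset\bigwedge^2V_6$ there is a unique $5$-dimensional subspace $W_5^\vee\supset W_4^\vee$ of $\bigwedge^2V_6$ such that $\mathbb{P}(W_5^\vee)\cap G(2,V_6)$ consists of $5$ distinct linearly independent points; these points are $u_0,\dots,u_4$. A complete pentahedron inscribed in a cubic surface $S\subset\pi_3$ is a set $\{H_0,\dots,H_4\}$ of $5$ planes of $\pi_3$ such that (i) $(H_0,\dots,H_4)$ is a projective basis of $\pi_3^\vee$, and (ii) the $10$ points $H_i\cap H_j\cap H_k$ $(0\le i<j<k\le4)$ lie on $S$. $\mathcal{H}\subset|\mathcal{O}_{\pi_3}(3)|\times|\mathcal{O}_{\pi_3}(5)|$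 is the set of pairs $(S,\Pi)$ with $S$ a smooth cubic surface and $\Pi$ a complete pentahedron inscribed in $S$. *)

theory Defs
  imports "HOL-Analysis.Analysis"
begin

text \<open>Bases are fixed: \<open>V\<^sub>6 = complex ^ 6\<close>, and \<open>complex ^ 4\<close> is the dual of \<open>W\<^sub>4\<close>, so that points of
  \<open>\<pi>\<^sub>3\<close> are lines in \<open>complex ^ 4\<close> and linear subspaces of \<open>\<pi>\<^sub>3\<close> are linear subspaces of
  \<open>complex ^ 4\<close>.\<close>

text \<open>On \<open>complex ^ 6 ^ 6\<close> the library operation \<open>*s\<close> has scalars in \<open>complex ^ 6\<close>; complex
  linear algebra on matrices needs its own scaling.\<close>

definition mscale :: "complex \<Rightarrow> complex ^ 6 ^ 6 \<Rightarrow> complex ^ 6 ^ 6" where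
  "mscale c M = (\<chi> i j. c * M $ i $ j)"

interpretation mat: vector_space mscale
  by unfold_locales (simp_all add: mscale_def vec_eq_iff algebra_simps)

definition wedge2 :: "(complex ^ 6 ^ 6) set" where
  "wedge2 = {M. transpose M = - M}"

definition wedge :: "complex ^ 6 \<Rightarrow> complex ^ 6 \<Rightarrow> complex ^ 6 ^ 6" where
  "wedge a b = (\<chi> i j. a $ i * b $ j - a $ j * b $ i)"

text \<open>Points of a projective space are one-dimensional linear subspaces.\<close>

definition proj_mat :: "(complex ^ 6 ^ 6) set \<Rightarrow> (complex ^ 6 ^ 6) set set" where
  "proj_mat W = {mat.span {w} | w. w \<in> W \<and> w \<noteq> 0}"

definition grassmannian :: "(complex ^ 6 ^ 6) set set" where
  "grassmannian = {mat.span {wedge a b} | a b. wedge a b \<noteq> 0}"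

definition pfaffian :: "complex ^ 6 ^ 6 \<Rightarrow> complex" where
  "pfaffian M = (\<Sum>p | p permutes (UNIV :: 6 set).
     of_int (sign p) * (M $ p 0 $ p 1 * M $ p 2 $ p 3 * M $ p 4 $ p 5)) / (2 ^ 3 * fact 3)"

definition form :: "nat \<Rightarrow> ((4 \<Rightarrow> nat) \<Rightarrow> complex) \<Rightarrow> complex ^ 4 \<Rightarrow> complex" where
  "form d c x = (\<Sum>m | (\<Sum>i\<in>UNIV. m i) = d. c m * (\<Prod>i\<in>UNIV. x $ i ^ m i))"

definition forms :: "nat \<Rightarrow> (complex ^ 4 \<Rightarrow> complex) set" where
  "forms d = range (form d)"

text \<open>The point of \<open>|O(d)|\<close> given by a nonzero form is its class modulo nonzero scalars.\<close>

definition divisor_of :: "(complex ^ 4 \<Rightarrow> complex) \<Rightarrow> (complex ^ 4 \<Rightarrow> complex) set" where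
  "divisor_of F = {\<lambda>x. c * F x | c. c \<noteq> 0}"

definition smooth_cubic :: "(complex ^ 4 \<Rightarrow> complex) \<Rightarrow> bool" where
  "smooth_cubic F \<longleftrightarrow> F \<in> forms 3 \<and> F \<noteq> (\<lambda>x. 0) \<and>
     (\<forall>x. x \<noteq> 0 \<and> F x = 0 \<longrightarrow> (\<exists>i. deriv (\<lambda>t. F (x + t *s axis i 1)) 0 \<noteq> 0))"

definition linear_form :: "complex ^ 4 \<Rightarrow> complex ^ 4 \<Rightarrow> complex" where
  "linear_form l x = (\<Sum>i\<in>UNIV. l $ i * x $ i)"

definition is_plane :: "(complex ^ 4) set \<Rightarrow> bool" where
  "is_plane H \<longleftrightarrow> vec.subspace H \<and> vec.dim H = 3"

text \<open>The point of the dual projective space corresponding to a plane.\<close>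

definition dual_point :: "(complex ^ 4) set \<Rightarrow> (complex ^ 4) set" where
  "dual_point H = {l. \<forall>x\<in>H. linear_form l x = 0}"

text \<open>A projective basis of a projective space of dimension \<open>n - 1\<close>: \<open>n + 1\<close> points, any \<open>n\<close> of
  which are linearly independent.\<close>

definition projective_basis :: "(complex ^ 'n) set set \<Rightarrow> bool" where
  "projective_basis B \<longleftrightarrow> (\<forall>p\<in>B. vec.subspace p \<and> vec.dim p = 1) \<and> card B = CARD('n) + 1 \<and>
     (\<forall>T\<subseteq>B. card T = CARD('n) \<longrightarrow> vec.dim (\<Union>T) = CARD('n))"

definition complete_pentahedron :: "(complex ^ 4) set set \<Rightarrow> bool" where
  "complete_pentahedron Hs \<longleftrightarrow>
     card Hs = 5 \<and> (\<forall>H\<in>Hs. is_plane H) \<and> projective_basis (dual_point ` Hs)"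

definition inscribed :: "(complex ^ 4) set set \<Rightarrow> (complex ^ 4 \<Rightarrow> complex) \<Rightarrow> bool" where
  "inscribed Hs F \<longleftrightarrow> (\<forall>T\<subseteq>Hs. card T = 3 \<longrightarrow> (\<forall>x\<in>\<Inter>T. F x = 0))"

text \<open>The set of all products of equations of the planes in \<open>Hs\<close>, i.e. the divisor \<open>\<Sum>H\<in>Hs. H\<close> as a
  class of forms modulo nonzero scalars.\<close>

definition planes_divisor :: "(complex ^ 4) set set \<Rightarrow> (complex ^ 4 \<Rightarrow> complex) set" where
  "planes_divisor Hs = {\<lambda>x. \<Prod>H\<in>Hs. linear_form (l H) x | l. \<forall>H\<in>Hs. H = {x. linear_form (l H) x = 0}}"

definition \<H> :: "((complex ^ 4 \<Rightarrow> complex) set \<times> (complex ^ 4 \<Rightarrow> complex) set) set" where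
  "\<H> = {(divisor_of F, planes_divisor Hs) | F Hs.
     smooth_cubic F \<and> complete_pentahedron Hs \<and> inscribed Hs F}"

text \<open>An element of \<open>W\<^sub>4 \<otimes> wedge2\<close> is given by its four coefficient matrices.\<close>

type_synonym tensor = "complex ^ 6 ^ 6 ^ 4"

definition lin_map :: "tensor \<Rightarrow> complex ^ 4 \<Rightarrow> complex ^ 6 ^ 6" where
  "lin_map A x = (\<Sum>k\<in>UNIV. mscale (x $ k) (A $ k))"

definition pf_cubic :: "tensor \<Rightarrow> complex ^ 4 \<Rightarrow> complex" where
  "pf_cubic A x = pfaffian (lin_map A x)"

definition tensors_sm :: "tensor set" where
  "tensors_sm = {A. (\<forall>k. A $ k \<in> wedge2) \<and> smooth_cubic (pf_cubic A)}"

definition gl_action :: "complex ^ 6 ^ 6 \<Rightarrow> tensor \<Rightarrow> tensor" where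
  "gl_action P A = (\<chi> k. transpose P ** A $ k ** P)"

definition gl_rel :: "(tensor \<times> tensor) set" where
  "gl_rel = {(A, B). A \<in> tensors_sm \<and> B \<in> tensors_sm \<and> (\<exists>P. invertible P \<and> B = gl_action P A)}"

inductive polynomial :: "(tensor \<Rightarrow> complex) \<Rightarrow> bool" where
  const: "polynomial (\<lambda>A. c)"
| coord: "polynomial (\<lambda>A. A $ k $ i $ j)"
| add: "polynomial f \<Longrightarrow> polynomial g \<Longrightarrow> polynomial (\<lambda>A. f A + g A)"
| mult: "polynomial f \<Longrightarrow> polynomial g \<Longrightarrow> polynomial (\<lambda>A. f A * g A)"

definition zariski_open :: "tensor set \<Rightarrow> bool" where
  "zariski_open U \<longleftrightarrow>
     (\<exists>E. (\<forall>f\<in>E. polynomial f) \<and> U = {A \<in> tensors_sm. \<exists>f\<in>E. f A \<noteq> 0})"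

definition zariski_dense :: "tensor set \<Rightarrow> bool" where
  "zariski_dense U \<longleftrightarrow> (\<forall>N. zariski_open N \<and> N \<noteq> {} \<longrightarrow> N \<inter> U \<noteq> {})"

text \<open>Regular maps to the projective space \<open>|O(d)|\<close>, whose homogeneous coordinates are the
  coefficients of a form: locally given by polynomials without common zero (denominators can be
  cleared).\<close>

definition regular_map :: "nat \<Rightarrow> tensor set \<Rightarrow> (tensor \<Rightarrow> (complex ^ 4 \<Rightarrow> complex) set) \<Rightarrow> bool" where
  "regular_map d U \<phi> \<longleftrightarrow> (\<forall>A\<in>U. \<exists>N c. zariski_open N \<and> A \<in> N \<and> N \<subseteq> U \<and> (\<forall>m. polynomial (c m)) \<and>
     (\<forall>B\<in>N. form d (\<lambda>m. c m B) \<noteq> (\<lambda>x. 0) \<and> \<phi> B = divisor_of (form d (\<lambda>m. c m B))))"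

text \<open>The quotient \<open>tensors_sm // gl_rel\<close> carries the quotient topology and the sheaf of invariant
  functions: openness, density and regularity are those of the preimage in \<open>tensors_sm\<close>, which for
  a set \<open>D\<close> of orbits is \<open>\<Union>D\<close>. A map to \<open>\<H>\<close> is regular iff its two components are, as maps to
  \<open>|O(3)|\<close> and \<open>|O(5)|\<close>.\<close>

definition rational_map_to_\<H> ::
  "tensor set set \<Rightarrow> (tensor set \<Rightarrow> (complex ^ 4 \<Rightarrow> complex) set \<times> (complex ^ 4 \<Rightarrow> complex) set) \<Rightarrow> bool"
where
  "rational_map_to_\<H> D \<Phi> \<longleftrightarrow>
     D \<subseteq> tensors_sm // gl_rel \<and> D \<noteq> {} \<and> zariski_open (\<Union>D) \<and> zariski_dense (\<Union>D) \<and>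
     \<Phi> ` D \<subseteq> \<H> \<and>
     regular_map 3 (\<Union>D) (\<lambda>A. fst (\<Phi> (gl_rel `` {A}))) \<and>
     regular_map 5 (\<Union>D) (\<lambda>A. snd (\<Phi> (gl_rel `` {A})))"

definition grassmann_points :: "(complex ^ 6 ^ 6) set \<Rightarrow> (complex ^ 6 ^ 6) set set" where
  "grassmann_points W = proj_mat W \<inter> grassmannian"

text \<open>\<open>W\<close> is a 5-dimensional subspace containing the image of the tensor and \<open>P(W)\<close> meets the
  Grassmannian in exactly five points; these are linearly independent as they span a space of
  (vector space) dimension 5.\<close>

definition five_point_space :: "tensor \<Rightarrow> (complex ^ 6 ^ 6) set \<Rightarrow> bool" where
  "five_point_space A W \<longleftrightarrow>
     mat.subspace W \<and> W \<subseteq> wedge2 \<and> mat.dim W = 5 \<and> range (lin_map A) \<subseteq> W \<and>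
     card (grassmann_points W) = 5 \<and> mat.dim (\<Union>(grassmann_points W)) = 5"

text \<open>The plane of \<open>\<pi>\<^sub>3\<close> cut out, via the embedding by the tensor, by the span of the points other
  than \<open>u\<close>.\<close>

definition face :: "tensor \<Rightarrow> (complex ^ 6 ^ 6) set \<Rightarrow> (complex ^ 6 ^ 6) set \<Rightarrow> (complex ^ 4) set" where
  "face A W u = {x. lin_map A x \<in> mat.span (\<Union>(grassmann_points W - {u}))}"

definition faces :: "tensor \<Rightarrow> (complex ^ 6 ^ 6) set \<Rightarrow> (complex ^ 4) set set" where
  "faces A W = face A W ` grassmann_points W"

end

(* Write u_0, ..., u_4 for the five points, scaled such that the image W4 of the tensor consists of
   the sums of the t_i u_i with t_0 + ... + t_4 = 0. From u_i u_j = -1/2 (u_i - u_j)^2 in the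
   exterior algebra one sees that every element of the span W5 of the u_i satisfies the linear
   condition X W4 <= W4 W4 (products in the fourth exterior power). A general tensor is of this
   form: at five special lines the parametrization by five lines has surjective derivative, so its
   image contains an open set and polynomial identities can be checked on it. Hence for general A
   the linear condition has a five-dimensional solution space W5, which depends rationally on A and
   contains every candidate, and W5 is spanned by W4 and one further vector beta.

   The condition that beta + x_1 w_1 + ... + x_4 w_4 be decomposable reads x_j x_r = (affine linear
   function of x), so multiplication by x_r is a matrix T_r on W5. The T_r commute because they do
   so on the image of the parametrization, and the five points are their common eigenvectors as
   soon as a combination M of the T_r has distinct eigenvalues. The product of the equations of the
   five faces is then x |-> det (x, M x, ..., M^4 x), up to a factor, which is polynomial in A.
   All genericity conditions are that some polynomial F does not vanish; F is nonzero at the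
   special tensor, smoothness is an open condition, and the domain of the map is the union of the
   GL-translates of the locus where F does not vanish.

   The cubic of t_0 u_0 + ... + t_4 u_4 is a combination of the monomials t_i t_j t_k with distinct
   i, j, k, so it vanishes where three of the t_i do: the pentahedron is inscribed. *)

theory Submission
  imports Defs "HOL-Computational_Algebra.Fundamental_Theorem_Algebra"
begin

subsection \<open>Families of polynomials\<close>

text \<open>Therefore \<beta>, the T_r and the Krylov determinant are built without choosing roots;
  eigenvectors occur only pointwise, to recognize what the polynomials compute. Denominators are
  carried along as Cramer determinants instead of being divided out, because
  \<open>regular_map\<close> asks for polynomials.

  The dimensions fit: five cones over G(2,6) of dimension 9 and the 16 entries of \<open>G\<close>,
  less one common scaling, make 60 = 4 * 15 parameters. The condition X W4 <= W4 W4 is restrictive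
  because W4 W4 has dimension at most 10 inside the 15-dimensional fourth exterior power.

  Independence of the ten products spanning W4 W4 (\<open>quad_inj\<close>) carries most arguments:
  it makes quadratic expressions in A unique and keeps decomposable bivectors out of W4. The latter
  permits normalizing any other five decomposable bivectors whose span contains W4 in the same way,
  so that their span again consists of solutions of the linear condition; this gives uniqueness of
  W5.\<close>

lemma polynomial_sum:
  "(\<And>i. i \<in> S \<Longrightarrow> polynomial (f i)) \<Longrightarrow> polynomial (\<lambda>A. \<Sum>i\<in>S. f i A)"
  by (induction S rule: infinite_finite_induct) (auto intro: polynomial.intros)

lemma polynomial_prod:
  "(\<And>i. i \<in> S \<Longrightarrow> polynomial (f i)) \<Longrightarrow> polynomial (\<lambda>A. \<Prod>i\<in>S. f i A)"
  by (induction S rule: infinite_finite_induct) (auto intro: polynomial.intros)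

lemma polynomial_uminus: "polynomial f \<Longrightarrow> polynomial (\<lambda>A. - f A)"
  using polynomial.mult[OF polynomial.const[of "-1"], of f] by simp

lemma polynomial_diff: "polynomial f \<Longrightarrow> polynomial g \<Longrightarrow> polynomial (\<lambda>A. f A - g A)"
  using polynomial.add[OF _ polynomial_uminus, of f g] by simp

lemma polynomial_if: "polynomial f \<Longrightarrow> polynomial g \<Longrightarrow> polynomial (\<lambda>A. if c then f A else g A)"
  by (cases c) simp_all

lemmas polynomial_intros = polynomial.const polynomial.coord polynomial.add polynomial.mult
  polynomial_sum polynomial_prod polynomial_uminus polynomial_diff polynomial_if

lemma polynomial_det:
  fixes M :: "tensor \<Rightarrow> complex ^ 'n ^ 'n"
  assumes "\<And>i j. polynomial (\<lambda>A. M A $ i $ j)"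
  shows "polynomial (\<lambda>A. det (M A))"
  unfolding det_def by (intro polynomial_intros assms)

lemma polynomial_matrix_mult:
  fixes M :: "tensor \<Rightarrow> complex ^ 'n ^ 'm" and N :: "tensor \<Rightarrow> complex ^ 'k ^ 'n"
  assumes "\<And>i j. polynomial (\<lambda>A. M A $ i $ j)" "\<And>i j. polynomial (\<lambda>A. N A $ i $ j)"
  shows "polynomial (\<lambda>A. (M A ** N A) $ i $ j)"
  unfolding matrix_matrix_mult_def by (simp, intro polynomial_intros assms)

lemma polynomial_matrix_vector_mult:
  fixes M :: "tensor \<Rightarrow> complex ^ 'n ^ 'm" and v :: "tensor \<Rightarrow> complex ^ 'n"
  assumes "\<And>i j. polynomial (\<lambda>A. M A $ i $ j)" "\<And>i. polynomial (\<lambda>A. v A $ i)"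
  shows "polynomial (\<lambda>A. (M A *v v A) $ i)"
  unfolding matrix_vector_mult_def by (simp, intro polynomial_intros assms)

text \<open>A left inverse at \<open>A\<^sub>0\<close> turns the overdetermined system into a square one, so that Cramer's
  rule applies wherever the determinant of the latter does not vanish.\<close>

lemma cramer_family:
  fixes e :: "tensor \<Rightarrow> complex ^ 'n \<Rightarrow> complex ^ 'm" and b :: "tensor \<Rightarrow> complex ^ 'm"
  assumes lin: "\<And>A. Vector_Spaces.linear (*s) (*s) (e A)"
    and pe: "\<And>x i. polynomial (\<lambda>A. e A x $ i)" and pb: "\<And>i. polynomial (\<lambda>A. b A $ i)"
    and inj: "inj (e A0)"
  obtains d z where "polynomial d" "\<And>i. polynomial (\<lambda>A. z A $ i)" "d A0 \<noteq> 0"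
    "\<And>A. d A \<noteq> 0 \<Longrightarrow> inj (e A)" "\<And>A x. e A x = b A \<Longrightarrow> d A *s x = z A"
proof -
  define E where "E A = matrix (e A)" for A
  have E: "E A *v x = e A x" for A x
    unfolding E_def by (rule matrix_works[OF lin])
  have pE: "polynomial (\<lambda>A. E A $ i $ j)" for i j
    unfolding E_def matrix_def by (simp add: pe)
  have "inj ((*v) (E A0))" using inj by (simp add: E fun_eq_iff inj_def)
  then obtain L where L: "L ** E A0 = mat 1"
    by (auto simp: matrix_left_invertible_injective[symmetric])
  define d where "d A = det (L ** E A)" for A
  define z where
    "z A = (\<chi> k. det ((\<chi> i j. if j = k then (L *v b A) $ i else (L ** E A) $ i $ j) :: complex ^ 'n ^ 'n))" for A
  have pLE: "polynomial (\<lambda>A. (L ** E A) $ i $ j)" for i j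
    by (intro polynomial_matrix_mult pE polynomial.const)
  have pLb: "polynomial (\<lambda>A. (L *v b A) $ i)" for i
    by (intro polynomial_matrix_vector_mult pb polynomial.const)
  show ?thesis
  proof
    show "polynomial d" unfolding d_def by (intro polynomial_det pLE)
    show "polynomial (\<lambda>A. z A $ i)" for i
      unfolding z_def by (simp, intro polynomial_det, simp, intro polynomial_if pLb pLE)
    show "d A0 \<noteq> 0" by (simp add: d_def L)
    show "inj (e A)" if "d A \<noteq> 0" for A
    proof (rule injI)
      fix x y assume "e A x = e A y"
      then have "(L ** E A) *v x = (L ** E A) *v y" by (metis E matrix_vector_mul_assoc)
      moreover have "inj ((*v) (L ** E A))"
        using that unfolding d_def by (simp add: inj_matrix_vector_mult invertible_det_nz)
      ultimately show "x = y" by (auto dest: injD)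
    qed
    show "d A *s x = z A" if "e A x = b A" for A x
    proof -
      have Lb: "L *v b A = (L ** E A) *v x" by (metis E matrix_vector_mul_assoc that)
      then have "z A $ k = x $ k * d A" for k
        using cramer_lemma[of k "L ** E A" x] unfolding z_def d_def by (simp only: vec_lambda_beta Lb)
      then show ?thesis by (simp add: vec_eq_iff mult.commute)
    qed
  qed
qed

section \<open>Forms whose coefficients are polynomials in the tensor\<close>

definition form_family :: "nat \<Rightarrow> (tensor \<Rightarrow> complex ^ 4 \<Rightarrow> complex) \<Rightarrow> bool" where
  "form_family d F \<longleftrightarrow> (\<exists>c. (\<forall>m. polynomial (c m)) \<and> (\<forall>A. F A = form d (\<lambda>m. c m A)))"

lemma finite_exponents: "finite {m :: 4 \<Rightarrow> nat. (\<Sum>i\<in>UNIV. m i) = d}"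
proof (rule finite_subset)
  show "{m :: 4 \<Rightarrow> nat. (\<Sum>i\<in>UNIV. m i) = d} \<subseteq> PiE UNIV (\<lambda>_. {..d})"
    by (auto simp: PiE_def extensional_def intro: member_le_sum)
  show "finite (PiE (UNIV :: 4 set) (\<lambda>_. {..d}))" by (intro finite_PiE) auto
qed

lemma form_family_add:
  assumes "form_family d F" "form_family d G"
  shows "form_family d (\<lambda>A x. F A x + G A x)"
proof -
  obtain c where c: "\<And>m. polynomial (c m)" "\<And>A. F A = form d (\<lambda>m. c m A)"
    using assms(1) unfolding form_family_def by blast
  obtain c' where c': "\<And>m. polynomial (c' m)" "\<And>A. G A = form d (\<lambda>m. c' m A)"
    using assms(2) unfolding form_family_def by blast
  show ?thesis unfolding form_family_def
    by (intro exI[of _ "\<lambda>m A. c m A + c' m A"])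
      (auto simp: c c' form_def fun_eq_iff sum.distrib algebra_simps intro!: polynomial_intros)
qed

text \<open>Products of monomials are grouped by the sum of their exponents, so each new coefficient
  is a finite sum of products of old ones.\<close>

lemma form_family_mult:
  assumes "form_family d F" "form_family e G"
  shows "form_family (d + e) (\<lambda>A x. F A x * G A x)"
proof -
  obtain c where c: "\<And>m. polynomial (c m)" "\<And>A. F A = form d (\<lambda>m. c m A)"
    using assms(1) unfolding form_family_def by blast
  obtain c' where c': "\<And>m. polynomial (c' m)" "\<And>A. G A = form e (\<lambda>m. c' m A)"
    using assms(2) unfolding form_family_def by blast
  define M where "M d = {m :: 4 \<Rightarrow> nat. (\<Sum>i\<in>UNIV. m i) = d}" for d
  have fin: "finite (M d)" for d unfolding M_def by (rule finite_exponents)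
  define c'' where "c'' m A = (\<Sum>(p, q) \<in> {pq \<in> M d \<times> M e. (\<lambda>i. fst pq i + snd pq i) = m}. c p A * c' q A)" for m A
  have "F A x * G A x = form (d + e) (\<lambda>m. c'' m A) x" for A x
  proof -
    define h where "h pq = c (fst pq) A * c' (snd pq) A * (\<Prod>i\<in>UNIV. x $ i ^ (fst pq i + snd pq i))" for pq
    have "F A x * G A x = (\<Sum>pq \<in> M d \<times> M e. h pq)"
      unfolding c c' form_def M_def[symmetric] sum_product sum.cartesian_product h_def
      by (intro sum.cong refl) (auto simp: power_add prod.distrib)
    also have "\<dots> = (\<Sum>m\<in>M (d + e). \<Sum>pq\<in>{pq \<in> M d \<times> M e. (\<lambda>i. fst pq i + snd pq i) = m}. h pq)"
      by (rule sum.group[symmetric]) (auto simp: fin, auto simp: M_def sum.distrib)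
    also have "\<dots> = form (d + e) (\<lambda>m. c'' m A) x"
      unfolding form_def M_def[symmetric] c''_def sum_distrib_right
      by (intro sum.cong refl) (auto simp: h_def)
    finally show ?thesis .
  qed
  moreover have "polynomial (c'' m)" for m
    unfolding c''_def split_def by (intro polynomial_intros c c')
  ultimately show ?thesis unfolding form_family_def by blast
qed

lemma form_family_polynomial:
  assumes "polynomial f" shows "form_family 0 (\<lambda>A x. f A)"
proof -
  have "{m :: 4 \<Rightarrow> nat. (\<Sum>i\<in>UNIV. m i) = 0} = {\<lambda>_. 0}" by (auto simp: fun_eq_iff)
  then have "f A = form 0 (\<lambda>m. f A) x" for A x
    unfolding form_def by (simp only:) simp
  then show ?thesis unfolding form_family_def
    by (intro exI[of _ "\<lambda>_. f"]) (auto simp: assms fun_eq_iff)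
qed

lemma form_family_coord: "form_family 1 (\<lambda>A x. x $ k)"
proof -
  let ?e = "\<lambda>i::4. if i = k then 1 else (0::nat)"
  have "form 1 (\<lambda>m. if m = ?e then 1 else 0) x = x $ k" for x
  proof -
    have "form 1 (\<lambda>m. if m = ?e then 1 else 0) x =
      (\<Sum>m\<in>{m. (\<Sum>i\<in>UNIV. m i) = 1}. if m = ?e then (\<Prod>i\<in>UNIV. x $ i ^ m i) else 0)"
      unfolding form_def by (intro sum.cong) auto
    also have "\<dots> = (\<Prod>i\<in>UNIV. x $ i ^ ?e i)"
      using finite_exponents[of 1] by (subst sum.delta) auto
    also have "\<dots> = (\<Prod>i\<in>UNIV. if i = k then x $ i else 1)"
      by (intro prod.cong) auto
    finally show ?thesis by simp
  qed
  then show ?thesis unfolding form_family_def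
    by (intro exI[of _ "\<lambda>m A. if m = ?e then 1 else 0"]) (auto simp: fun_eq_iff intro: polynomial_intros)
qed

lemma form_family_smult: "polynomial f \<Longrightarrow> form_family d F \<Longrightarrow> form_family d (\<lambda>A x. f A * F A x)"
  using form_family_mult[OF form_family_polynomial, of f d F] by simp

lemma form_family_zero: "form_family d (\<lambda>A x. 0)"
  unfolding form_family_def
  by (intro exI[of _ "\<lambda>m A. 0"]) (auto simp: form_def fun_eq_iff intro: polynomial_intros)

lemma form_family_sum:
  "(\<And>i. i \<in> S \<Longrightarrow> form_family d (F i)) \<Longrightarrow> form_family d (\<lambda>A x. \<Sum>i\<in>S. F i A x)"
  by (induction S rule: infinite_finite_induct) (auto intro: form_family_zero form_family_add)

lemma form_family_prod:
  "finite S \<Longrightarrow> (\<And>i. i \<in> S \<Longrightarrow> form_family 1 (F i)) \<Longrightarrow> form_family (card S) (\<lambda>A x. \<Prod>i\<in>S. F i A x)"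
proof (induction S rule: finite_induct)
  case empty
  show ?case using form_family_polynomial[OF polynomial.const[of 1]] by simp
next
  case (insert i S)
  show ?case using form_family_mult[OF insert.prems[of i] insert.IH] insert by simp
qed

lemma form_family_det:
  fixes M :: "tensor \<Rightarrow> complex ^ 4 \<Rightarrow> complex ^ 'n ^ 'n"
  assumes "\<And>i j. form_family 1 (\<lambda>A x. M A x $ i $ j)"
  shows "form_family CARD('n) (\<lambda>A x. det (M A x))"
  unfolding det_def
  by (intro form_family_sum form_family_smult[OF polynomial.const] form_family_prod assms) simp

lemma form_family_pf_cubic: "form_family 3 pf_cubic"
proof -
  have lin: "form_family 1 (\<lambda>A x. lin_map A x $ i $ j)" for i j
  proof -
    have "lin_map A x $ i $ j = (\<Sum>k\<in>UNIV. A $ k $ i $ j * x $ k)" for A x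
      by (simp add: lin_map_def mscale_def mult.commute)
    then show ?thesis
      by (simp only:) (intro form_family_sum form_family_smult polynomial_intros form_family_coord)
  qed
  have "form_family (1 + 1 + 1) (\<lambda>A x. of_int (sign p) * (lin_map A x $ p 0 $ p 1 *
      lin_map A x $ p 2 $ p 3 * lin_map A x $ p 4 $ p 5))" for p
    by (intro form_family_smult polynomial_intros form_family_mult lin)
  then have deg3: "form_family 3 (\<lambda>A x. of_int (sign p) * (lin_map A x $ p 0 $ p 1 *
      lin_map A x $ p 2 $ p 3 * lin_map A x $ p 4 $ p 5))" for p
    by (simp add: numeral_3_eq_3)
  have "form_family 3 (\<lambda>A x. (1 / (2 ^ 3 * fact 3)) * (\<Sum>p | p permutes UNIV. of_int (sign p) *
      (lin_map A x $ p 0 $ p 1 * lin_map A x $ p 2 $ p 3 * lin_map A x $ p 4 $ p 5)))"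
    by (rule form_family_smult[OF polynomial.const form_family_sum], rule deg3)
  moreover have "pf_cubic = (\<lambda>A x. (1 / (2 ^ 3 * fact 3)) * (\<Sum>p | p permutes UNIV. of_int (sign p) *
      (lin_map A x $ p 0 $ p 1 * lin_map A x $ p 2 $ p 3 * lin_map A x $ p 4 $ p 5)))"
    by (simp add: fun_eq_iff pf_cubic_def pfaffian_def)
  ultimately show ?thesis by simp
qed

subsection \<open>Decomposable bivectors\<close>

text \<open>The coordinates of the exterior product of two bivectors.\<close>

definition star :: "complex ^ 6 ^ 6 \<Rightarrow> complex ^ 6 ^ 6 \<Rightarrow> 6 \<Rightarrow> 6 \<Rightarrow> 6 \<Rightarrow> 6 \<Rightarrow> complex" where
  "star X Y i j k l = X$i$j * Y$k$l + Y$i$j * X$k$l - X$i$k * Y$j$l - Y$i$k * X$j$l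
     + X$i$l * Y$j$k + Y$i$l * X$j$k"

lemma star_commute: "star X Y = star Y X"
  by (simp add: star_def fun_eq_iff)

lemma star_add_left: "star (X + Y) Z i j k l = star X Z i j k l + star Y Z i j k l"
  by (simp add: star_def algebra_simps)

lemma star_diff_left: "star (X - Y) Z i j k l = star X Z i j k l - star Y Z i j k l"
  by (simp add: star_def algebra_simps)

lemma star_scale_left: "star (mscale c X) Z i j k l = c * star X Z i j k l"
  by (simp add: star_def mscale_def algebra_simps)

lemma star_zero_left: "star 0 Z i j k l = 0"
  by (simp add: star_def)

lemma star_sum_left: "star (\<Sum>a\<in>S. X a) Z i j k l = (\<Sum>a\<in>S. star (X a) Z i j k l)"
  by (induction S rule: infinite_finite_induct) (auto simp: star_zero_left star_add_left)

lemma star_add_right: "star Z (X + Y) i j k l = star Z X i j k l + star Z Y i j k l"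
  by (simp add: star_def algebra_simps)

lemma star_diff_right: "star Z (X - Y) i j k l = star Z X i j k l - star Z Y i j k l"
  by (simp add: star_def algebra_simps)

lemma star_scale_right: "star Z (mscale c X) i j k l = c * star Z X i j k l"
  by (simp add: star_def mscale_def algebra_simps)

lemma star_sum_right: "star Z (\<Sum>a\<in>S. X a) i j k l = (\<Sum>a\<in>S. star Z (X a) i j k l)"
  by (metis (no_types, lifting) star_commute star_sum_left sum.cong)

lemma star_wedge: "star (wedge a b) (wedge a b) i j k l = 0"
  by (simp add: star_def wedge_def algebra_simps)

lemma wedge_in_wedge2: "wedge a b \<in> wedge2"
  by (simp add: wedge2_def wedge_def transpose_def vec_eq_iff)

lemma wedge2_iff: "X \<in> wedge2 \<longleftrightarrow> (\<forall>i j. X $ i $ j = - X $ j $ i)"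
  unfolding wedge2_def transpose_def vec_eq_iff by auto

lemma subspace_wedge2: "mat.subspace wedge2"
proof -
  have "mscale c X \<in> wedge2" if "X \<in> wedge2" for c X
    unfolding wedge2_iff
  proof (intro allI)
    fix i j
    have "X $ i $ j = - X $ j $ i" using that wedge2_iff by blast
    then show "mscale c X $ i $ j = - mscale c X $ j $ i" unfolding mscale_def by simp
  qed
  moreover have "X + Y \<in> wedge2" if "X \<in> wedge2" "Y \<in> wedge2" for X Y
    unfolding wedge2_iff
  proof (intro allI)
    fix i j
    have "X $ i $ j = - X $ j $ i" "Y $ i $ j = - Y $ j $ i" using that wedge2_iff by blast+
    then show "(X + Y) $ i $ j = - (X + Y) $ j $ i" by simp
  qed
  moreover have "0 \<in> wedge2" by (simp add: wedge2_iff)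
  ultimately show ?thesis unfolding mat.subspace_def by blast
qed

text \<open>If \<open>X $ i $ j\<close> is nonzero, the Pluecker relations express \<open>X\<close> as the wedge of its
  rows \<open>i\<close> and \<open>j\<close>, up to a factor.\<close>

lemma decomposable:
  assumes X: "X \<in> wedge2" and star: "\<And>i j k l. star X X i j k l = 0"
  obtains a b where "X = wedge a b"
proof (cases "X = 0")
  case True
  then have "X = wedge 0 0" by (simp add: wedge_def vec_eq_iff)
  then show ?thesis using that by blast
next
  case False
  then obtain i j where ij: "X $ i $ j \<noteq> 0" by (auto simp: vec_eq_iff)
  have skew: "X $ k $ l = - X $ l $ k" for k l using X wedge2_iff by blast
  have "X = wedge (X $ i) (\<chi> k. X $ j $ k / X $ i $ j)"
  proof (simp add: vec_eq_iff wedge_def, intro allI)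
    fix k l
    have "2 * (X$i$j * X$k$l - X$i$k * X$j$l + X$i$l * X$j$k) = 0"
      using star[of i j k l] by (simp add: star_def algebra_simps)
    then have "X$i$j * X$k$l - X$i$k * X$j$l + X$i$l * X$j$k = 0" by (simp only: mult_eq_0_iff) simp
    then have "X$i$j * X$k$l = X$i$k * X$j$l - X$i$l * X$j$k" by (simp add: algebra_simps)
    then show "X $ k $ l = X $ i $ k * X $ j $ l / X $ i $ j - X $ i $ l * X $ j $ k / X $ i $ j"
      using ij by (simp add: divide_simps mult.commute)
  qed
  then show ?thesis using that by blast
qed

subsection \<open>The pfaffian\<close>

lemma UNIV_6: "(UNIV :: 6 set) = {0, 1, 2, 3, 4, 5}"
proof -
  have "card {0, 1, 2, 3, 4, 5 :: 6} = card (UNIV :: 6 set)" by simp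
  then show ?thesis by (metis card_subset_eq finite subset_UNIV)
qed

lemma exhaust_6: "x = 0 \<or> x = 1 \<or> x = 2 \<or> x = 3 \<or> x = 4 \<or> x = 5" for x :: 6
  using UNIV_6 by auto

lemma forall_6: "(\<forall>i::6. P i) \<longleftrightarrow> P 0 \<and> P 1 \<and> P 2 \<and> P 3 \<and> P 4 \<and> P 5"
  by (metis exhaust_6)

lemma prod_6: "prod f (UNIV :: 6 set) = f 0 * f 1 * f 2 * f 3 * f 4 * f 5"
  unfolding UNIV_6 by (simp add: mult.assoc)

text \<open>The polarization of the pfaffian, up to the factor \<open>48\<close>.\<close>

definition pol3 :: "complex ^ 6 ^ 6 \<Rightarrow> complex ^ 6 ^ 6 \<Rightarrow> complex ^ 6 ^ 6 \<Rightarrow> complex" where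
  "pol3 X Y Z = (\<Sum>p | p permutes UNIV. of_int (sign p) * (X $ p 0 $ p 1 * Y $ p 2 $ p 3 * Z $ p 4 $ p 5))"

lemma pfaffian_pol3: "pfaffian M = pol3 M M M / 48"
  by (simp add: pfaffian_def pol3_def fact_numeral)

lemma pol3_reindex:
  assumes "q permutes UNIV"
  shows "pol3 X Y Z = of_int (sign q) * (\<Sum>p | p permutes UNIV. of_int (sign p) *
    (X $ p (q 0) $ p (q 1) * Y $ p (q 2) $ p (q 3) * Z $ p (q 4) $ p (q 5)))"
proof -
  have "sign (p \<circ> q) = sign p * sign q" if "p permutes UNIV" for p
    using that assms by (intro sign_compose) (metis finite permutation_permutes)+
  then have "pol3 X Y Z = (\<Sum>p | p permutes UNIV. of_int (sign p * sign q) *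
    (X $ p (q 0) $ p (q 1) * Y $ p (q 2) $ p (q 3) * Z $ p (q 4) $ p (q 5)))"
    unfolding pol3_def by (subst sum_permutations_compose_right[OF assms]) (auto intro!: sum.cong)
  then show ?thesis
    by (simp add: sum_distrib_left mult_ac)
qed

lemma pol3_swap12: "pol3 X Y Z = pol3 Y X Z"
proof -
  \<comment> \<open>Exchanging two arguments exchanges two pairs of positions. This is a product of
    two transpositions, hence even, and no sign appears.\<close>
  let ?q = "Transposition.transpose (0::6) 2 \<circ> Transposition.transpose 1 3"
  have q: "?q permutes UNIV"
    by (intro permutes_compose permutes_swap_id) auto
  have "sign ?q = 1"
    by (subst sign_compose) (auto simp: permutation_swap_id sign_swap_id)
  then show ?thesis
    using pol3_reindex[OF q, of X Y Z]
    by (simp add: Transposition.transpose_def pol3_def mult_ac)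
qed

lemma pol3_swap23: "pol3 X Y Z = pol3 X Z Y"
proof -
  let ?q = "Transposition.transpose (2::6) 4 \<circ> Transposition.transpose 3 5"
  have q: "?q permutes UNIV"
    by (intro permutes_compose permutes_swap_id) auto
  have "sign ?q = 1"
    by (subst sign_compose) (auto simp: permutation_swap_id sign_swap_id)
  then show ?thesis
    using pol3_reindex[OF q, of X Y Z]
    by (simp add: Transposition.transpose_def pol3_def mult_ac)
qed

lemma pol3_add1: "pol3 (X + X') Y Z = pol3 X Y Z + pol3 X' Y Z"
  by (simp add: pol3_def algebra_simps sum.distrib)

lemma pol3_diff1: "pol3 (X - X') Y Z = pol3 X Y Z - pol3 X' Y Z"
  by (simp add: pol3_def algebra_simps sum_subtractf)

lemma pol3_scale1: "pol3 (mscale c X) Y Z = c * pol3 X Y Z"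
  by (simp add: pol3_def mscale_def sum_distrib_left mult_ac)

lemma pol3_zero1: "pol3 0 Y Z = 0"
  by (simp add: pol3_def)

lemma pol3_sum1: "pol3 (\<Sum>a\<in>S. X a) Y Z = (\<Sum>a\<in>S. pol3 (X a) Y Z)"
  by (induction S rule: infinite_finite_induct) (auto simp: pol3_zero1 pol3_add1)

lemma pol3_add2: "pol3 Y (X + X') Z = pol3 Y X Z + pol3 Y X' Z"
  by (metis pol3_add1 pol3_swap12)

lemma pol3_scale2: "pol3 Y (mscale c X) Z = c * pol3 Y X Z"
  by (metis pol3_scale1 pol3_swap12)

lemma pol3_sum2: "pol3 Y (\<Sum>a\<in>S. X a) Z = (\<Sum>a\<in>S. pol3 Y (X a) Z)"
  by (simp add: pol3_swap12[of Y] pol3_sum1)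

lemma pol3_add3: "pol3 Y Z (X + X') = pol3 Y Z X + pol3 Y Z X'"
  by (metis pol3_add2 pol3_swap23)

lemma pol3_scale3: "pol3 Y Z (mscale c X) = c * pol3 Y Z X"
  by (metis pol3_scale2 pol3_swap23)

lemma pol3_sum3: "pol3 Y Z (\<Sum>a\<in>S. X a) = (\<Sum>a\<in>S. pol3 Y Z (X a))"
  by (simp add: pol3_swap23[of Y Z] pol3_sum2)

definition outer :: "complex ^ 6 \<Rightarrow> complex ^ 6 \<Rightarrow> complex ^ 6 ^ 6" where
  "outer a b = (\<chi> i j. a $ i * b $ j)"

lemma wedge_outer: "wedge a b = outer a b - outer b a"
  by (simp add: wedge_def outer_def vec_eq_iff mult.commute)

lemma pol3_outer_swap: "pol3 (outer b a) Y Z = - pol3 (outer a b) Y Z"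
proof -
  let ?q = "Transposition.transpose (0::6) 1"
  have q: "?q permutes UNIV" by (intro permutes_swap_id) auto
  show ?thesis
    using pol3_reindex[OF q, of "outer b a" Y Z]
    by (simp add: Transposition.transpose_def pol3_def sign_swap_id outer_def mult_ac)
qed

text \<open>Swapping the positions 0 and 2 exchanges two entries of \<open>a\<close>: every product
  stays the same while its sign is reversed.\<close>

lemma pol3_outer_same: "pol3 (outer a b) (outer a b) Z = 0"
proof -
  let ?q = "Transposition.transpose (0::6) 2"
  have q: "?q permutes UNIV" by (intro permutes_swap_id) auto
  have "pol3 (outer a b) (outer a b) Z = - pol3 (outer a b) (outer a b) Z"
    using pol3_reindex[OF q, of "outer a b" "outer a b" Z]
    by (simp add: Transposition.transpose_def pol3_def sign_swap_id outer_def mult_ac)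
  then show ?thesis by simp
qed

lemma pol3_wedge1: "pol3 (wedge a b) Y Z = 2 * pol3 (outer a b) Y Z"
  by (simp add: wedge_outer pol3_diff1 pol3_outer_swap[of a b])

lemma pol3_wedge2: "pol3 Y (wedge a b) Z = 2 * pol3 Y (outer a b) Z"
  by (metis pol3_wedge1 pol3_swap12)

lemma pol3_wedge3: "pol3 Y Z (wedge a b) = 2 * pol3 Y Z (outer a b)"
  by (metis pol3_wedge2 pol3_swap23)

lemma pol3_wedge_same12: "pol3 (wedge a b) (wedge a b) Z = 0"
  by (simp add: pol3_wedge1 pol3_wedge2 pol3_outer_same)

lemma pol3_wedge_same13: "pol3 (wedge a b) Z (wedge a b) = 0"
  by (metis pol3_wedge_same12 pol3_swap23)

lemma pol3_wedge_same23: "pol3 Z (wedge a b) (wedge a b) = 0"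
  by (metis pol3_wedge_same13 pol3_swap12)

lemmas pol3_wedge_same = pol3_wedge_same12 pol3_wedge_same13 pol3_wedge_same23

lemmas pol3_linear = pol3_add1 pol3_add2 pol3_add3 pol3_scale1 pol3_scale2 pol3_scale3

text \<open>Three arguments filled with two decomposable bivectors always repeat one of
  them.\<close>

lemma pfaffian_rank4: "pfaffian (mscale s (wedge a b) + mscale t (wedge c d)) = 0"
  by (simp add: pfaffian_pol3 pol3_linear pol3_wedge_same)

definition sel :: "'a \<Rightarrow> 'a \<Rightarrow> 'a \<Rightarrow> 'a \<Rightarrow> 'a \<Rightarrow> 'a \<Rightarrow> 6 \<Rightarrow> 'a" where
  "sel k l m n p q i = (if i = 0 then k else if i = 1 then l else if i = 2 then m else if i = 3 then n
     else if i = 4 then p else q)"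

text \<open>Leibniz' formula with the six vectors as rows; it lets multiplicativity of the
  determinant take care of congruence.\<close>

lemma pol3_outer_det:
  "pol3 (outer a b) (outer c d) (outer e f) = det (\<chi> i. sel a b c d e f i)"
  unfolding pol3_def det_def prod_6
  by (intro sum.cong) (auto simp: outer_def sel_def)

text \<open>Expanding in outer products of rows of \<open>P\<close> turns each coefficient into a
  determinant with rows taken from \<open>P\<close>, which is \<open>det P\<close> times the same
  determinant for the identity matrix.\<close>

lemma pol3_congruence:
  "pol3 (transpose P ** X ** P) (transpose P ** Y ** P) (transpose P ** Z ** P) = det P * pol3 X Y Z"
proof -
  have exp: "transpose Q ** M ** Q = (\<Sum>k\<in>UNIV. \<Sum>l\<in>UNIV. mscale (M $ k $ l) (outer (Q $ k) (Q $ l)))"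
    for Q M :: "complex ^ 6 ^ 6"
    by (simp add: vec_eq_iff matrix_matrix_mult_def transpose_def mscale_def outer_def
        sum_distrib_left mult_ac)
      (intro allI, subst sum.swap, simp add: mult_ac)
  have det: "det (\<chi> i. sel (Q $ a) (Q $ b) (Q $ c) (Q $ d) (Q $ e) (Q $ f) i) =
    det (\<chi> i. axis (sel a b c d e f i) (1 :: complex)) * det Q" for Q :: "complex ^ 6 ^ 6" and a b c d e f
  proof -
    have "(\<chi> i. sel (Q $ a) (Q $ b) (Q $ c) (Q $ d) (Q $ e) (Q $ f) i) =
        (\<chi> i. axis (sel a b c d e f i) (1 :: complex)) ** Q"
      by (simp add: vec_eq_iff matrix_matrix_mult_def axis_def if_distrib[of "\<lambda>x. x * _"] sel_def
          cong: if_cong)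
    then show ?thesis by (simp add: det_mul)
  qed
  have gen: "pol3 (transpose Q ** X ** Q) (transpose Q ** Y ** Q) (transpose Q ** Z ** Q) =
    det Q * (\<Sum>a\<in>UNIV. \<Sum>b\<in>UNIV. \<Sum>c\<in>UNIV. \<Sum>d\<in>UNIV. \<Sum>e\<in>UNIV. \<Sum>f\<in>UNIV.
      X $ a $ b * (Y $ c $ d * (Z $ e $ f * det (\<chi> i. axis (sel a b c d e f i) (1 :: complex)))))"
    for Q :: "complex ^ 6 ^ 6"
    unfolding exp
    unfolding pol3_sum1 pol3_scale1
    unfolding pol3_sum2 pol3_scale2
    unfolding pol3_sum3 pol3_scale3 pol3_outer_det det sum_distrib_left
    by (intro sum.cong refl) (simp only: mult_ac)
  \<comment> \<open>For the identity matrix the remaining sum is \<open>pol3 X Y Z\<close>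
    itself.\<close>
  have "pol3 X Y Z = (\<Sum>a\<in>UNIV. \<Sum>b\<in>UNIV. \<Sum>c\<in>UNIV. \<Sum>d\<in>UNIV. \<Sum>e\<in>UNIV. \<Sum>f\<in>UNIV.
      X $ a $ b * (Y $ c $ d * (Z $ e $ f * det (\<chi> i. axis (sel a b c d e f i) (1 :: complex)))))"
    using gen[of "mat 1"] by (simp add: transpose_mat)
  then show ?thesis using gen[of P] by simp
qed

lemma pfaffian_congruence: "pfaffian (transpose P ** M ** P) = det P * pfaffian M"
  by (simp add: pfaffian_pol3 pol3_congruence)

lemma lin_map_add: "lin_map A (x + y) = lin_map A x + lin_map A y"
  by (simp add: lin_map_def vec_eq_iff mscale_def algebra_simps sum.distrib)

lemma lin_map_scale: "lin_map A (c *s x) = mscale c (lin_map A x)"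
  by (simp add: lin_map_def vec_eq_iff mscale_def sum_distrib_left mult_ac)

lemma lin_map_axis: "lin_map A (axis i 1) = A $ i"
proof -
  have "mscale (axis i 1 $ k) (A $ k) = (if k = i then A $ k else 0)" for k
    by (simp add: axis_def vec_eq_iff mscale_def)
  then show ?thesis by (simp add: lin_map_def)
qed

lemma lin_map_congruence: "lin_map (gl_action P A) x = transpose P ** lin_map A x ** P"
proof -
  have sum: "(\<Sum>k\<in>S. M k) ** P = (\<Sum>k\<in>S. M k ** P)" "transpose P ** (\<Sum>k\<in>S. M k) = (\<Sum>k\<in>S. transpose P ** M k)"
    for M :: "4 \<Rightarrow> complex ^ 6 ^ 6" and S
    by (induction S rule: infinite_finite_induct) (auto simp: matrix_add_ldistrib vec_eq_iff matrix_matrix_mult_def sum.distrib algebra_simps)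
  have sc: "transpose P ** mscale c M ** P = mscale c (transpose P ** M ** P)" for c M
    by (simp add: vec_eq_iff matrix_matrix_mult_def mscale_def sum_distrib_left sum_distrib_right mult_ac)
  show ?thesis unfolding lin_map_def gl_action_def by (simp add: sum sc)
qed

lemma pf_cubic_gl_action: "pf_cubic (gl_action P A) x = det P * pf_cubic A x"
  by (simp add: pf_cubic_def lin_map_congruence pfaffian_congruence)

subsection \<open>Smooth pfaffian cubics\<close>

lemma deriv_pf_cubic:
  "deriv (\<lambda>t. pf_cubic A (x + t *s axis i 1)) 0 = pol3 (A $ i) (lin_map A x) (lin_map A x) / 16"
proof -
  let ?M = "lin_map A x" and ?N = "A $ i"
  \<comment> \<open>By symmetry of \<open>pol3\<close> the linear coefficient carries a factor 3;
    divided by 48 it becomes the 1/16 of the statement.\<close>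
  have "pf_cubic A (x + t *s axis i 1) =
    (pol3 ?M ?M ?M + t * (3 * pol3 ?N ?M ?M) + t\<^sup>2 * (3 * pol3 ?N ?N ?M) + t ^ 3 * pol3 ?N ?N ?N) / 48" for t
    unfolding pf_cubic_def pfaffian_pol3 lin_map_add lin_map_scale lin_map_axis pol3_linear
    by (simp add: pol3_swap12[of ?M ?N] pol3_swap23[of ?M ?M ?N] pol3_swap23[of ?N ?M ?N]
        algebra_simps power2_eq_square power3_eq_cube)
  then show ?thesis
    by (simp only:) (rule DERIV_imp_deriv, auto intro!: derivative_eq_intros)
qed

lemma smooth_pf_cubic_iff:
  "smooth_cubic (pf_cubic A) \<longleftrightarrow> (\<forall>x. x \<noteq> 0 \<longrightarrow> (\<exists>i. pol3 (A $ i) (lin_map A x) (lin_map A x) \<noteq> 0))"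
    (is "?l = ?r")
proof
  assume l: ?l
  show ?r
  proof (intro allI impI, rule ccontr)
    fix x :: "complex ^ 4"
    assume x: "x \<noteq> 0" "\<nexists>i. pol3 (A $ i) (lin_map A x) (lin_map A x) \<noteq> 0"
    have "pol3 (lin_map A x) (lin_map A x) (lin_map A x) =
        (\<Sum>k\<in>UNIV. x $ k * pol3 (A $ k) (lin_map A x) (lin_map A x))"
      by (subst lin_map_def) (simp only: pol3_sum1 pol3_scale1)
    then have "pf_cubic A x = 0" using x by (simp add: pf_cubic_def pfaffian_pol3)
    then show False using l x unfolding smooth_cubic_def deriv_pf_cubic by auto
  qed
next
  assume r: ?r
  have "pf_cubic A \<in> forms 3"
    using form_family_pf_cubic by (auto simp: form_family_def forms_def)
  moreover have "pf_cubic A \<noteq> (\<lambda>x. 0)"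
  proof
    assume z: "pf_cubic A = (\<lambda>x. 0)"
    obtain i where "pol3 (A $ i) (lin_map A (axis 1 1)) (lin_map A (axis 1 1)) \<noteq> 0"
      using r by (metis axis_eq_0_iff zero_neq_one)
    then show False using deriv_pf_cubic[of A "axis 1 1" i] by (simp add: z)
  qed
  ultimately show ?l using r unfolding smooth_cubic_def deriv_pf_cubic by auto
qed

section \<open>Lines in the space of tensors and density of nonvanishing loci\<close>

definition line :: "tensor \<Rightarrow> tensor \<Rightarrow> complex \<Rightarrow> tensor" where
  "line A B t = (\<chi> k i j. A $ k $ i $ j + t * (B $ k $ i $ j - A $ k $ i $ j))"

lemma line_0 [simp]: "line A B 0 = A" and line_1 [simp]: "line A B 1 = B"
  by (simp_all add: line_def vec_eq_iff)

lemma polynomial_line: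
  assumes "polynomial f"
  obtains p where "\<And>t. f (line A B t) = poly p t"
proof -
  have "\<exists>p. \<forall>t. f (line A B t) = poly p t"
    using assms
  proof induction
    case (const c) show ?case by (intro exI[of _ "[:c:]"]) simp
  next
    case (coord k i j)
    show ?case
      by (intro exI[of _ "[:A $ k $ i $ j, B $ k $ i $ j - A $ k $ i $ j:]"]) (simp add: line_def)
  next
    case (add f g) then show ?case by (metis poly_add)
  next
    case (mult f g) then show ?case by (metis poly_mult)
  qed
  then show ?thesis using that by blast
qed

text \<open>A polynomial in \<open>t\<close> that is nonzero at 1 has finitely many roots. One of
  them may be 0, hence the punctured filter.\<close>

lemma eventually_polynomial_line:
  assumes "polynomial f" "f B \<noteq> 0"
  shows "\<forall>\<^sub>F t in at 0. f (line A B t) \<noteq> 0"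
proof -
  obtain p where p: "\<And>t. f (line A B t) = poly p t" using polynomial_line[OF assms(1)] by blast
  have "p \<noteq> 0" using p[of 1] assms(2) by auto
  then have "finite {t. poly p t = 0}" by (rule poly_roots_finite)
  then have "open (- ({t. poly p t = 0} - {0}))" by (intro open_Compl finite_imp_closed) simp
  then have "\<forall>\<^sub>F t in nhds 0. t \<in> - ({t. poly p t = 0} - {0})"
    by (intro eventually_nhds_in_open) simp_all
  then show ?thesis unfolding eventually_at_filter by eventually_elim (auto simp: p)
qed

text \<open>Singular points can be scaled to the unit sphere, so the pairs of a parameter and a
  singular point form a compact set. Its projection to the parameters is closed and misses
  0.\<close>

lemma eventually_smooth_line:
  assumes "smooth_cubic (pf_cubic A)"
  shows "\<forall>\<^sub>F t in at 0. smooth_cubic (pf_cubic (line A B t))"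
proof -
  define g where "g t x i = pol3 (line A B t $ i) (lin_map (line A B t) x) (lin_map (line A B t) x)" for t x i
  define K where "K = {tx \<in> cball 0 1 \<times> sphere 0 1. \<forall>i. g (fst tx) (snd tx) i = 0}"
  have cont: "continuous_on UNIV (\<lambda>tx. g (fst tx) (snd tx) i)" for i
    unfolding g_def pol3_def lin_map_def mscale_def line_def
    by (simp, intro continuous_intros)
  have "K = (cball 0 1 \<times> sphere 0 1) \<inter> (\<Inter>i. {tx. g (fst tx) (snd tx) i = 0})"
    unfolding K_def by auto
  moreover have "closed {tx. g (fst tx) (snd tx) i = 0}" for i
    using continuous_closed_preimage_constant[OF cont[of i] closed_UNIV, of 0] by simp
  ultimately have "compact K"
    by (auto intro!: compact_Int_closed compact_Times)
  then have "compact (fst ` K)" by (intro compact_continuous_image continuous_intros)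
  then have "open (- (fst ` K))" by (intro open_Compl compact_imp_closed)
  moreover have "0 \<in> - (fst ` K)"
  proof
    assume "0 \<in> fst ` K"
    then obtain x where "norm x = 1" "\<And>i. g 0 x i = 0" by (auto simp: K_def)
    moreover from this have "x \<noteq> 0" by auto
    ultimately show False
      using assms unfolding smooth_pf_cubic_iff by (auto simp: g_def)
  qed
  ultimately have "\<forall>\<^sub>F t in at 0. t \<in> - (fst ` K)"
    using eventually_nhds_in_open eventually_at_filter by (metis (mono_tags, lifting) eventually_mono)
  moreover have "\<forall>\<^sub>F t in at (0::complex). t \<in> cball 0 1"
    using eventually_at_ball[of 1 "0::complex" UNIV] by (rule eventually_mono) auto
  ultimately show ?thesis
  proof eventually_elim
    case (elim t)
    show ?case unfolding smooth_pf_cubic_iff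
    proof (intro allI impI, rule ccontr)
      fix x :: "complex ^ 4"
      assume x: "x \<noteq> 0" "\<nexists>i. pol3 (line A B t $ i) (lin_map (line A B t) x) (lin_map (line A B t) x) \<noteq> 0"
      define c where "c = complex_of_real (inverse (norm x))"
      have "c *s x = inverse (norm x) *\<^sub>R x"
        unfolding c_def vec_eq_iff vector_smult_component vector_scaleR_component by (simp add: scaleR_conv_of_real)
      then have "norm (c *s x) = 1" using x by simp
      moreover have "g t (c *s x) i = 0" for i
        using x unfolding g_def by (simp add: lin_map_scale pol3_linear)
      ultimately have "(t, c *s x) \<in> K" using elim by (auto simp: K_def)
      then show False using elim by (force simp: image_iff)
    qed
  qed
qed

lemma line_wedge2:
  assumes "\<And>k. A $ k \<in> wedge2" "\<And>k. B $ k \<in> wedge2"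
  shows "line A B t $ k \<in> wedge2"
  unfolding wedge2_iff
proof (intro allI)
  fix i j
  have "A $ k $ i $ j = - A $ k $ j $ i" "B $ k $ i $ j = - B $ k $ j $ i"
    using assms wedge2_iff by blast+
  then show "line A B t $ k $ i $ j = - line A B t $ k $ j $ i"
    unfolding line_def by (simp add: algebra_simps)
qed

text \<open>Near \<open>A\<close> on the line to \<open>B\<close>, smoothness and \<open>f\<close>
  persist by continuity, and \<open>g\<close> has only finitely many zeros there. Nothing is asked
  of the cubic of \<open>B\<close>, which is what allows \<open>B = base\<close> in the density
  proof.\<close>

lemma tensors_sm_irreducible:
  assumes "A \<in> tensors_sm" "polynomial f" "f A \<noteq> 0" "\<And>k. B $ k \<in> wedge2" "polynomial g" "g B \<noteq> 0"
  obtains C where "C \<in> tensors_sm" "f C \<noteq> 0" "g C \<noteq> 0"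
proof -
  have f: "\<forall>\<^sub>F t in at 0. f (line A B t) \<noteq> 0"
  proof -
    obtain p where p: "\<And>t. f (line A B t) = poly p t" using polynomial_line[OF assms(2)] by blast
    have "poly p 0 \<noteq> 0" using p[of 0] assms(3) by simp
    moreover have "(poly p \<longlongrightarrow> poly p 0) (at 0)" by (intro tendsto_intros)
    ultimately have "\<forall>\<^sub>F t in at 0. poly p t \<noteq> 0"
      by (metis tendsto_imp_eventually_ne)
    then show ?thesis by (simp add: p)
  qed
  have "\<forall>\<^sub>F t in at 0. smooth_cubic (pf_cubic (line A B t))"
    using assms(1) by (intro eventually_smooth_line) (simp add: tensors_sm_def)
  then have "\<forall>\<^sub>F t in at 0. smooth_cubic (pf_cubic (line A B t)) \<and> f (line A B t) \<noteq> 0 \<and> g (line A B t) \<noteq> 0"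
    using f eventually_polynomial_line[OF assms(5,6)] by eventually_elim auto
  then obtain t where "smooth_cubic (pf_cubic (line A B t))" "f (line A B t) \<noteq> 0" "g (line A B t) \<noteq> 0"
    by (auto dest: eventually_happens'[rotated])
  moreover have "line A B t $ k \<in> wedge2" for k
    using assms(1,4) by (intro line_wedge2) (auto simp: tensors_sm_def)
  ultimately show ?thesis using that by (auto simp: tensors_sm_def)
qed

lemma mscale_wedge: "mscale c (wedge a b) = wedge a (c *s b)"
  by (simp add: vec_eq_iff mscale_def wedge_def algebra_simps)

lemma wedge_add_right: "wedge a (b + c) = wedge a b + wedge a c"
  by (simp add: vec_eq_iff wedge_def algebra_simps)

lemma det_axis_nonzero:
  fixes r :: "'n::finite \<Rightarrow> 'n"
  assumes "inj r"
  shows "det (\<chi> i. axis (r i) (1::complex)) \<noteq> 0"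
proof -
  let ?Q = "\<chi> i. axis (r i) 1 :: complex ^ 'n ^ 'n"
  have "?Q ** transpose ?Q = mat 1"
    using assms by (simp add: vec_eq_iff matrix_matrix_mult_def transpose_def axis_def mat_def
        if_distrib[of "\<lambda>x. x * _"] inj_eq cong: if_cong)
  then show ?thesis by (metis det_I det_mul mult_zero_left zero_neq_one)
qed

text \<open>The surface \<open>x y (x + y) + z w (z + w) = 0\<close>, a sum of two products of three linear forms,
  is smooth and has an evident determinantal representation.\<close>

lemma tensors_sm_nonempty: "tensors_sm \<noteq> {}"
proof -
  define e where "e i = (axis i 1 :: complex ^ 6)" for i
  \<comment> \<open>Pairing \<open>e 0\<close>, \<open>e 1\<close>, \<open>e 2\<close> with the rows
    of a 3 x 3 matrix in the coordinates 3, 4, 5 makes the pfaffian its determinant up to a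
    constant. The rows (x1, x3, 0), (0, x2, x4), (x3 + x4, 0, x1 + x2) produce the desired
    cubic.\<close>
  define M where "M x = wedge (e 0) (x$1 *s e 3 + x$3 *s e 4) + wedge (e 1) (x$2 *s e 4 + x$4 *s e 5)
     + wedge (e 2) ((x$3 + x$4) *s e 3 + (x$1 + x$2) *s e 5)" for x :: "complex ^ 4"
  define A :: tensor where "A = (\<chi> k. M (axis k 1))"
  have lin: "lin_map A x = M x" for x
    unfolding lin_map_def sum_4 A_def M_def mscale_def wedge_def vec_eq_iff
    by (simp add: axis_def algebra_simps)
  define D where "D b c d = pol3 (wedge (e 0) b) (wedge (e 1) c) (wedge (e 2) d)" for b c d
  have D: "D b c d = 8 * det (\<chi> i. sel (e 0) b (e 1) c (e 2) d i)" for b c d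
    unfolding D_def pol3_wedge1 pol3_wedge2 pol3_wedge3 pol3_outer_det by simp
  have D0: "D b b d = 0" "D b d b = 0" "D d b b = 0" for b d
    using det_identical_rows[of 1 3 "\<chi> i. sel (e 0) b (e 1) b (e 2) d i"]
      det_identical_rows[of 1 5 "\<chi> i. sel (e 0) b (e 1) d (e 2) b i"]
      det_identical_rows[of 3 5 "\<chi> i. sel (e 0) d (e 1) b (e 2) b i"]
    by (simp_all add: D row_def sel_def vec_eq_iff)
  have inj: "inj (sel (0::6) 3 1 4 2 5)" "inj (sel (0::6) 4 1 5 2 3)"
    unfolding inj_def forall_6 by (simp_all add: sel_def)
  have ax: "(\<chi> i. sel (e a) (e b) (e c) (e d) (e f) (e g) i) = (\<chi> i. axis (sel a b c d f g i) 1)" for a b c d f g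
    by (simp add: vec_eq_iff sel_def e_def)
  define c1 where "c1 = D (e 3) (e 4) (e 5) / 8"
  define c2 where "c2 = D (e 4) (e 5) (e 3) / 8"
  have c: "c1 \<noteq> 0" "c2 \<noteq> 0"
    unfolding c1_def c2_def D ax using det_axis_nonzero[OF inj(1)] det_axis_nonzero[OF inj(2)] by simp_all
  have F: "pf_cubic A x = c1 * (x$1 * x$2 * (x$1 + x$2)) + c2 * (x$3 * x$4 * (x$3 + x$4))" for x
  proof -
    \<comment> \<open>For arguments of square zero only the six arrangements of three different ones
      survive.\<close>
    have pol6: "pol3 (X + Y + Z) (X + Y + Z) (X + Y + Z) = 6 * pol3 X Y Z"
      if "\<And>W. pol3 X X W = 0" "\<And>W. pol3 Y Y W = 0" "\<And>W. pol3 Z Z W = 0" for X Y Z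
    proof -
      have s: "pol3 Y X Z = pol3 X Y Z" "pol3 X Z Y = pol3 X Y Z" "pol3 Y Z X = pol3 X Y Z"
        "pol3 Z X Y = pol3 X Y Z" "pol3 Z Y X = pol3 X Y Z"
        by (metis pol3_swap12 pol3_swap23)+
      have z: "pol3 X W X = 0" "pol3 W X X = 0" "pol3 Y W Y = 0" "pol3 W Y Y = 0" "pol3 Z W Z = 0" "pol3 W Z Z = 0" for W
        by (metis that pol3_swap12 pol3_swap23)+
      show ?thesis by (simp add: pol3_add1 pol3_add2 pol3_add3 s z that)
    qed
    have "pf_cubic A x = D (x$1 *s e 3 + x$3 *s e 4) (x$2 *s e 4 + x$4 *s e 5)
        ((x$3 + x$4) *s e 3 + (x$1 + x$2) *s e 5) / 8"
      unfolding pf_cubic_def lin pfaffian_pol3 M_def D_def by (subst pol6) (simp_all add: pol3_wedge_same)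
    also have "\<dots> = c1 * (x$1 * x$2 * (x$1 + x$2)) + c2 * (x$3 * x$4 * (x$3 + x$4))"
      unfolding D_def
      unfolding wedge_add_right mscale_wedge[symmetric] pol3_linear
      unfolding D_def[symmetric]
      by (simp add: D0 c1_def c2_def algebra_simps)
    finally show ?thesis .
  qed
  have der: "deriv (\<lambda>t. pf_cubic A (x + t *s axis 1 1)) 0 = c1 * (x$2 * (2 * x$1 + x$2))"
    "deriv (\<lambda>t. pf_cubic A (x + t *s axis 2 1)) 0 = c1 * (x$1 * (x$1 + 2 * x$2))"
    "deriv (\<lambda>t. pf_cubic A (x + t *s axis 3 1)) 0 = c2 * (x$4 * (2 * x$3 + x$4))"
    "deriv (\<lambda>t. pf_cubic A (x + t *s axis 4 1)) 0 = c2 * (x$3 * (x$3 + 2 * x$4))" for x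
    unfolding F by (simp_all add: axis_def, (rule DERIV_imp_deriv, auto intro!: derivative_eq_intros simp: algebra_simps)+)
  have quad: "a = 0 \<and> b = 0" if "b * (2 * a + b) = 0" "a * (a + 2 * b) = 0" for a b :: complex
    using that by (auto simp: add_eq_0_iff)
  have "smooth_cubic (pf_cubic A)"
    unfolding smooth_pf_cubic_iff
  proof (intro allI impI, rule ccontr)
    fix x :: "complex ^ 4"
    assume x: "x \<noteq> 0" "\<nexists>i. pol3 (A $ i) (lin_map A x) (lin_map A x) \<noteq> 0"
    then have d: "deriv (\<lambda>t. pf_cubic A (x + t *s axis i 1)) 0 = 0" for i
      unfolding deriv_pf_cubic by simp
    have "x$1 = 0 \<and> x$2 = 0" "x$3 = 0 \<and> x$4 = 0"
      using d[of 1] d[of 2] d[of 3] d[of 4] c unfolding der by (intro quad; simp)+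
    then show False using x(1) by (auto simp: vec_eq_iff forall_4)
  qed
  moreover have "A $ k \<in> wedge2" for k
    unfolding A_def M_def by (simp add: mat.subspace_add[OF subspace_wedge2] wedge_in_wedge2)
  ultimately show ?thesis unfolding tensors_sm_def by blast
qed

subsection \<open>Tensors in the span of five lines\<close>

lemma sum_option: "(\<Sum>i\<in>UNIV. f i) = f None + (\<Sum>m\<in>UNIV. f (Some m))" for f :: "'a::finite option \<Rightarrow> 'b::comm_monoid_add"
  by (simp add: UNIV_option_conv sum.reindex)

text \<open>The differences to the point of index \<open>None\<close> span the hyperplane of
  coordinate sum zero, and row \<open>m\<close> of \<open>G\<close> places the coefficient matrix
  \<open>m\<close> in it. Indexing the points by \<open>4 option\<close> makes \<open>G\<close> a
  square matrix.\<close>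

definition five_lines ::
  "complex ^ 6 ^ 4 option \<Rightarrow> complex ^ 6 ^ 4 option \<Rightarrow> complex ^ 4 ^ 4 \<Rightarrow> tensor" where
  "five_lines a b G = (\<chi> m. \<Sum>i\<in>UNIV. mscale (G $ m $ i)
     (wedge (a $ Some i) (b $ Some i) - wedge (a $ None) (b $ None)))"

lemma five_lines_wedge2: "five_lines a b G $ m \<in> wedge2"
  unfolding five_lines_def
  by (simp add: mat.subspace_sum[OF subspace_wedge2] mat.subspace_scale[OF subspace_wedge2]
      mat.subspace_diff[OF subspace_wedge2] wedge_in_wedge2)

definition vec6 :: "complex \<Rightarrow> complex \<Rightarrow> complex \<Rightarrow> complex \<Rightarrow> complex \<Rightarrow> complex \<Rightarrow> complex ^ 6" where
  "vec6 a b c d e f = (\<chi> i. sel a b c d e f i)"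

lemma vec6_nth [simp]:
  "vec6 a b c d e f $ 0 = a" "vec6 a b c d e f $ 1 = b" "vec6 a b c d e f $ 2 = c"
  "vec6 a b c d e f $ 3 = d" "vec6 a b c d e f $ 4 = e" "vec6 a b c d e f $ 5 = f"
  by (simp_all add: vec6_def sel_def)

text \<open>Five special lines. With \<open>e\<^sub>0, \<dots>, e\<^sub>5\<close> the standard basis and \<open>e\<^sub>i\<^sub>j\<close> the wedge of \<open>e\<^sub>i\<close> and \<open>e\<^sub>j\<close>,
  their Pluecker coordinates are \<open>e\<^sub>2\<^sub>3\<close> (index \<open>None\<close>), \<open>e\<^sub>0\<^sub>1\<close>, \<open>e\<^sub>4\<^sub>5\<close>, \<open>e\<^sub>1\<^sub>3 + e\<^sub>1\<^sub>5 + e\<^sub>3\<^sub>5\<close> and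
  \<open>e\<^sub>0\<^sub>2 + e\<^sub>0\<^sub>4 + e\<^sub>2\<^sub>4\<close>.\<close>

definition line_a :: "complex ^ 6 ^ 4 option" where
  "line_a = (\<chi> i. case i of None \<Rightarrow> vec6 0 0 1 0 0 0 | Some m \<Rightarrow>
     if m = 1 then vec6 1 0 0 0 0 0 else if m = 2 then vec6 0 0 0 0 1 0
     else if m = 3 then vec6 0 1 0 1 0 0 else vec6 1 0 1 0 0 0)"

definition line_b :: "complex ^ 6 ^ 4 option" where
  "line_b = (\<chi> i. case i of None \<Rightarrow> vec6 0 0 0 1 0 0 | Some m \<Rightarrow>
     if m = 1 then vec6 0 1 0 0 0 0 else if m = 2 then vec6 0 0 0 0 0 1
     else if m = 3 then vec6 0 0 0 1 0 1 else vec6 0 0 1 0 1 0)"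

lemma line_a_nth [simp]:
  "line_a $ None = vec6 0 0 1 0 0 0" "line_a $ Some 1 = vec6 1 0 0 0 0 0"
  "line_a $ Some 2 = vec6 0 0 0 0 1 0" "line_a $ Some 3 = vec6 0 1 0 1 0 0"
  "line_a $ Some 4 = vec6 1 0 1 0 0 0"
  by (simp_all add: line_a_def)

lemma line_b_nth [simp]:
  "line_b $ None = vec6 0 0 0 1 0 0" "line_b $ Some 1 = vec6 0 1 0 0 0 0"
  "line_b $ Some 2 = vec6 0 0 0 0 0 1" "line_b $ Some 3 = vec6 0 0 0 1 0 1"
  "line_b $ Some 4 = vec6 0 0 1 0 1 0"
  by (simp_all add: line_b_def)

definition line_y :: "4 option \<Rightarrow> complex ^ 6 ^ 6" where
  "line_y i = wedge (line_a $ i) (line_b $ i)"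

text \<open>The derivative of (a, b) |-> \<open>wedge a b\<close> in the direction (a', b').\<close>

definition tangent :: "complex ^ 6 \<Rightarrow> complex ^ 6 \<Rightarrow> complex ^ 6 \<Rightarrow> complex ^ 6 \<Rightarrow> complex ^ 6 ^ 6" where
  "tangent a b a' b' = wedge a' b + wedge a b'"

lemma skew_entries:
  fixes Z :: "complex ^ 6 ^ 6"
  assumes "Z \<in> wedge2"
  shows "Z$0$0 = 0" "Z$1$1 = 0" "Z$2$2 = 0" "Z$3$3 = 0" "Z$4$4 = 0" "Z$5$5 = 0"
    "Z$1$0 = - Z$0$1" "Z$2$0 = - Z$0$2" "Z$3$0 = - Z$0$3" "Z$4$0 = - Z$0$4" "Z$5$0 = - Z$0$5"
    "Z$2$1 = - Z$1$2" "Z$3$1 = - Z$1$3" "Z$4$1 = - Z$1$4" "Z$5$1 = - Z$1$5"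
    "Z$3$2 = - Z$2$3" "Z$4$2 = - Z$2$4" "Z$5$2 = - Z$2$5"
    "Z$4$3 = - Z$3$4" "Z$5$3 = - Z$3$5" "Z$5$4 = - Z$4$5"
proof -
  have skew: "Z $ i $ j = - Z $ j $ i" for i j using assms wedge2_iff by blast
  have "Z $ i $ i = 0" for i using skew[of i i] by simp
  then show "Z$0$0 = 0" "Z$1$1 = 0" "Z$2$2 = 0" "Z$3$3 = 0" "Z$4$4 = 0" "Z$5$5 = 0" by auto
qed (use assms wedge2_iff in blast)+

text \<open>Component \<open>m\<close> of the derivative of \<open>five_lines\<close> at the special
  lines, as far as it comes from row \<open>m\<close> of \<open>G\<close> and from moving line
  \<open>Some m\<close>. These variables are independent for different \<open>m\<close>; only line
  \<open>None\<close> moves all four components together.\<close>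

definition tangent_split :: "4 \<Rightarrow> complex ^ 6 ^ 6 \<Rightarrow> bool" where
  "tangent_split m Z \<longleftrightarrow> (\<exists>g a' b'. Z = (\<Sum>i\<in>UNIV. mscale (g $ i) (line_y (Some i) - line_y None))
     + tangent (line_a $ Some m) (line_b $ Some m) a' b')"

lemmas split_simps = vec_eq_iff forall_6 sum_4 tangent_def wedge_def mscale_def line_y_def

definition vec4 :: "complex \<Rightarrow> complex \<Rightarrow> complex \<Rightarrow> complex \<Rightarrow> complex ^ 4" where
  "vec4 a b c d = (\<chi> i. if i = 1 then a else if i = 2 then b else if i = 3 then c else d)"

lemma vec4_nth [simp]:
  "vec4 a b c d $ 1 = a" "vec4 a b c d $ 2 = b" "vec4 a b c d $ 3 = c" "vec4 a b c d $ 4 = d"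
  by (simp_all add: vec4_def)

text \<open>The tangent space at the line has dimension 9 and contains the line itself, so together
  with the four differences it has dimension 13. Hence two linear conditions among 15 entries, here
  and in the next three lemmas.\<close>

lemma tangent_split_1:
  assumes Z: "Z \<in> wedge2" and z: "Z$2$5 = 0" "Z$3$4 = 0"
  shows "tangent_split 1 Z"
proof -
  let ?g = "vec4 (- Z$2$3 - Z$4$5 - Z$3$5 - Z$2$4) (Z$4$5) (Z$3$5) (Z$2$4)"
  let ?Q = "Z - (\<Sum>i\<in>UNIV. mscale (?g $ i) (line_y (Some i) - line_y None))"
  show ?thesis
    unfolding tangent_split_def
    by (intro exI[of _ ?g] exI[of _ "vec6 0 0 (?Q$2$1) (?Q$3$1) (?Q$4$1) (?Q$5$1)"]
        exI[of _ "vec6 0 (?Q$0$1) (?Q$0$2) (?Q$0$3) (?Q$0$4) (?Q$0$5)"])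
      (simp add: split_simps skew_entries[OF Z] z)
qed

lemma tangent_split_2:
  assumes Z: "Z \<in> wedge2" and z: "Z$0$3 = 0" "Z$1$2 = 0"
  shows "tangent_split 2 Z"
proof -
  let ?g = "vec4 (Z$0$1) (- Z$2$3 - Z$0$1 - Z$1$3 - Z$0$2) (Z$1$3) (Z$0$2)"
  let ?Q = "Z - (\<Sum>i\<in>UNIV. mscale (?g $ i) (line_y (Some i) - line_y None))"
  show ?thesis
    unfolding tangent_split_def
    by (intro exI[of _ ?g] exI[of _ "vec6 (?Q$0$5) (?Q$1$5) (?Q$2$5) (?Q$3$5) 0 0"]
        exI[of _ "vec6 (?Q$4$0) (?Q$4$1) (?Q$4$2) (?Q$4$3) 0 (?Q$4$5)"])
      (simp add: split_simps skew_entries[OF Z] z)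
qed

lemma tangent_split_3:
  assumes Z: "Z \<in> wedge2" and z: "Z$0$2 = Z$0$4" "Z$2$4 = Z$0$4"
  shows "tangent_split 3 Z"
proof -
  let ?g1 = "Z$0$1 - Z$0$3 + Z$0$5" and ?g2 = "Z$4$1 - Z$4$3 + Z$4$5"
  let ?g = "vec4 ?g1 ?g2 (Z$2$1 - Z$2$3 + Z$2$5 - ?g1 - ?g2 - Z$0$4) (Z$0$4)"
  let ?Q = "Z - (\<Sum>i\<in>UNIV. mscale (?g $ i) (line_y (Some i) - line_y None))"
  show ?thesis
    unfolding tangent_split_def
    by (intro exI[of _ ?g] exI[of _ "vec6 (?Q$0$5) 0 (?Q$2$5) (?Q$3$5 - ?Q$1$5) (?Q$4$5) 0"]
        exI[of _ "vec6 (- ?Q$0$1) 0 (- ?Q$2$1) (?Q$1$3) (- ?Q$4$1) (?Q$1$5)"])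
      (simp add: split_simps skew_entries[OF Z] z)
qed

lemma tangent_split_4:
  assumes Z: "Z \<in> wedge2" and z: "Z$1$3 = Z$1$5" "Z$3$5 = Z$1$5"
  shows "tangent_split 4 Z"
proof -
  let ?g1 = "- (Z$1$0 - Z$1$2 + Z$1$4)" and ?g2 = "- (Z$5$0 - Z$5$2 + Z$5$4)"
  let ?g = "vec4 ?g1 ?g2 (Z$1$5) (- (Z$3$0 - Z$3$2 + Z$3$4) - ?g1 - ?g2 - Z$1$5)"
  let ?Q = "Z - (\<Sum>i\<in>UNIV. mscale (?g $ i) (line_y (Some i) - line_y None))"
  show ?thesis
    unfolding tangent_split_def
    by (intro exI[of _ ?g] exI[of _ "vec6 0 (?Q$1$4) (?Q$2$4 - ?Q$0$4) (?Q$3$4) 0 (?Q$5$4)"]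
        exI[of _ "vec6 0 (- ?Q$1$0) (?Q$0$2) (- ?Q$3$0) (?Q$0$4) (- ?Q$5$0)"])
      (simp add: split_simps skew_entries[OF Z] z)
qed

lemma tangent_split_all:
  fixes X :: tensor
  assumes X: "\<And>m. X $ m \<in> wedge2"
  obtains a b where "\<And>m. tangent_split m (X $ m + tangent (line_a $ None) (line_b $ None) a b)"
proof -
  \<comment> \<open>Modulo the span of its own two vectors, line \<open>None\<close> has eight
    coordinates of motion. They are solved from the eight conditions of the preceding lemmas, two
    for each \<open>m\<close>.\<close>
  define a where "a = vec6 (- X$2$0$3) (X$4$1$5 - X$4$1$3) 0 0 (X$1$3$4) (X$4$3$5 - X$4$1$5)"
  define b where "b = vec6 (X$3$0$2 - X$3$0$4) (X$2$1$2) 0 0 (X$3$0$4 - X$3$2$4) (- X$1$2$5)"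
  define T where "T = tangent (line_a $ None) (line_b $ None) a b"
  have "X $ m + T \<in> wedge2" for m
    unfolding T_def tangent_def by (intro mat.subspace_add[OF subspace_wedge2] X wedge_in_wedge2)
  then have "tangent_split 1 (X $ 1 + T)" "tangent_split 2 (X $ 2 + T)" "tangent_split 3 (X $ 3 + T)"
    "tangent_split 4 (X $ 4 + T)"
    by (auto intro!: tangent_split_1 tangent_split_2 tangent_split_3 tangent_split_4
        simp: T_def tangent_def wedge_def a_def b_def)
  then have "\<forall>m. tangent_split m (X $ m + T)" unfolding forall_4 by blast
  then show ?thesis using that unfolding T_def by blast
qed

lemma has_derivative_vec:
  fixes f :: "'a::real_normed_vector \<Rightarrow> 'b::euclidean_space ^ 'n"
  assumes "\<And>i. ((\<lambda>x. f x $ i) has_derivative (\<lambda>h. f' h $ i)) (at x)"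
  shows "(f has_derivative f') (at x)"
  unfolding has_derivative_componentwise_within[of f f' x UNIV]
proof
  fix b :: "'b ^ 'n" assume "b \<in> Basis"
  then obtain i u where "b = axis i u" by (auto simp: Basis_vec_def)
  then show "((\<lambda>x. f x \<bullet> b) has_derivative (\<lambda>x. f' x \<bullet> b)) (at x)"
    using has_derivative_inner_left[OF assms[of i], of u] by (simp add: inner_axis)
qed

lemma has_derivative_nth:
  fixes f :: "'a::real_normed_vector \<Rightarrow> 'b::euclidean_space ^ 'n"
  assumes "(f has_derivative f') F"
  shows "((\<lambda>x. f x $ i) has_derivative (\<lambda>h. f' h $ i)) F"
  by (rule bounded_linear.has_derivative[OF bounded_linear_vec_nth assms])

text \<open>The symmetric matrices contributed by the last component of \<open>\<Psi>\<close> fill up the full space of quadruples of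
  matrices, so that the open mapping theorem applies.\<close>

lemma five_lines_dominant:
  assumes f: "polynomial f" and zero: "\<And>a b G. f (five_lines a b G) = 0"
    and B: "\<And>k. B $ k \<in> wedge2"
  shows "f B = 0"
proof (rule ccontr)
  assume nz: "f B \<noteq> 0"
  define \<Psi> where "\<Psi> = (\<lambda>p :: (complex ^ 6 ^ 4 option) \<times> (complex ^ 6 ^ 4 option) \<times> (complex ^ 4 ^ 4) \<times> tensor.
    five_lines (fst p) (fst (snd p)) (fst (snd (snd p))) +
    (\<chi> m i j. snd (snd (snd p)) $ m $ i $ j + snd (snd (snd p)) $ m $ j $ i))"
  define \<Psi>' where "\<Psi>' = (\<lambda>h :: (complex ^ 6 ^ 4 option) \<times> (complex ^ 6 ^ 4 option) \<times> (complex ^ 4 ^ 4) \<times> tensor.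
    (\<chi> m. (\<Sum>i\<in>UNIV. mscale (fst (snd (snd h)) $ m $ i) (line_y (Some i) - line_y None))
      + tangent (line_a $ Some m) (line_b $ Some m) (fst h $ Some m) (fst (snd h) $ Some m)
      - tangent (line_a $ None) (line_b $ None) (fst h $ None) (fst (snd h) $ None)
      + (\<chi> i j. snd (snd (snd h)) $ m $ i $ j + snd (snd (snd h)) $ m $ j $ i)) :: tensor)"
  define p0 :: "(complex ^ 6 ^ 4 option) \<times> (complex ^ 6 ^ 4 option) \<times> (complex ^ 4 ^ 4) \<times> tensor"
    where "p0 = (line_a, line_b, mat 1, 0)"
  have der: "(\<Psi> has_derivative \<Psi>') (at p0)"
  proof (intro has_derivative_vec)
    fix m :: 4 and j k :: 6
    have entry: "\<Psi> p $ m $ j $ k = (\<Sum>i\<in>UNIV. fst (snd (snd p)) $ m $ i *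
        (fst p $ Some i $ j * fst (snd p) $ Some i $ k - fst p $ Some i $ k * fst (snd p) $ Some i $ j
         - (fst p $ None $ j * fst (snd p) $ None $ k - fst p $ None $ k * fst (snd p) $ None $ j)))
        + (snd (snd (snd p)) $ m $ j $ k + snd (snd (snd p)) $ m $ k $ j)" for p
      by (simp add: \<Psi>_def five_lines_def mscale_def wedge_def)
    have delta: "(\<Sum>i\<in>UNIV. mat 1 $ m $ i * u i) = u m" for u :: "4 \<Rightarrow> complex"
      by (simp add: mat_def if_distrib[of "\<lambda>x. x * _"] cong: if_cong)
    show "((\<lambda>p. \<Psi> p $ m $ j $ k) has_derivative (\<lambda>h. \<Psi>' h $ m $ j $ k)) (at p0)"
      unfolding entry
      apply (rule has_derivative_eq_rhs)
       apply (rule has_derivative_add has_derivative_sum has_derivative_mult has_derivative_diff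
          has_derivative_nth has_derivative_fst has_derivative_snd has_derivative_ident)+
      apply (simp add: fun_eq_iff p0_def sum.distrib delta del: line_a_nth line_b_nth)
      apply (simp add: \<Psi>'_def tangent_def wedge_def line_y_def mscale_def algebra_simps
          del: line_a_nth line_b_nth)
      done
  qed
  have surj: "surj \<Psi>'"
  proof -
    have "\<exists>h. \<Psi>' h = Y" for Y :: tensor
    proof -
      \<comment> \<open>The skew part of \<open>Y\<close> is reached by moving the lines and
        \<open>G\<close>, the symmetric part by the last argument of \<open>\<Psi>\<close>.\<close>
      define X :: tensor where "X = (\<chi> m i j. (Y $ m $ i $ j - Y $ m $ j $ i) / 2)"
      have "X $ m \<in> wedge2" for m by (simp add: X_def wedge2_iff) (simp add: field_simps)
      then obtain a b where ab: "\<And>m. tangent_split m (X $ m + tangent (line_a $ None) (line_b $ None) a b)"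
        using tangent_split_all by metis
      then have "\<forall>m. \<exists>g a' b'. X $ m + tangent (line_a $ None) (line_b $ None) a b =
          (\<Sum>i\<in>UNIV. mscale (g $ i) (line_y (Some i) - line_y None))
          + tangent (line_a $ Some m) (line_b $ Some m) a' b'"
        unfolding tangent_split_def by blast
      then obtain g a' b' where *: "\<And>m. X $ m + tangent (line_a $ None) (line_b $ None) a b =
          (\<Sum>i\<in>UNIV. mscale (g m $ i) (line_y (Some i) - line_y None))
          + tangent (line_a $ Some m) (line_b $ Some m) (a' m) (b' m)"
        unfolding choice_iff by blast
      define h where "h = ((\<chi> i. case i of None \<Rightarrow> a | Some m \<Rightarrow> a' m) :: complex ^ 6 ^ 4 option,
         (\<chi> i. case i of None \<Rightarrow> b | Some m \<Rightarrow> b' m) :: complex ^ 6 ^ 4 option,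
         (\<chi> m. g m) :: complex ^ 4 ^ 4, (\<chi> m i j. (Y $ m $ i $ j + Y $ m $ j $ i) / 4) :: tensor)"
      have "\<Psi>' h $ m = X $ m + (\<chi> i j. (Y $ m $ i $ j + Y $ m $ j $ i) / 2)" for m
        using *[of m] unfolding \<Psi>'_def h_def
        by (simp add: eq_diff_eq[symmetric]) (simp add: vec_eq_iff fun_eq_iff field_simps)
      then have "\<Psi>' h = Y" by (simp add: vec_eq_iff X_def) (simp add: field_simps)
      then show ?thesis by blast
    qed
    then show ?thesis unfolding surj_def by metis
  qed
  have lin': "linear \<Psi>'" using der has_derivative_linear by blast
  obtain g where g: "linear g" "\<Psi>' \<circ> g = id"
    using linear_surjective_right_inverse[OF lin' surj] by blast
  have "continuous_on UNIV \<Psi>"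
    unfolding \<Psi>_def five_lines_def wedge_def mscale_def
    by (intro continuous_intros)
  then have "\<Psi> p0 \<in> interior (\<Psi> ` UNIV)"
    using sussmann_open_mapping[OF open_UNIV _ UNIV_I der _ g(2), of UNIV] g(1)
    by (simp add: linear_conv_bounded_linear)
  then obtain U where U: "open U" "\<Psi> p0 \<in> U" "U \<subseteq> range \<Psi>" by (auto simp: interior_def)
  have p0: "\<Psi> p0 = five_lines line_a line_b (mat 1)" by (simp add: \<Psi>_def p0_def vec_eq_iff)
  \<comment> \<open>Points of the line to \<open>B\<close> close to the special tensor lie in the
    image of \<open>\<Psi>\<close>, while \<open>f\<close> vanishes at only finitely many points of
    the line.\<close>
  have "((\<lambda>t. line (\<Psi> p0) B t) \<longlongrightarrow> line (\<Psi> p0) B 0) (at 0)"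
    unfolding line_def by (intro tendsto_intros)
  then have "\<forall>\<^sub>F t in at 0. line (\<Psi> p0) B t \<in> U"
    using U by (intro topological_tendstoD) auto
  then have "\<forall>\<^sub>F t in at 0. line (\<Psi> p0) B t \<in> U \<and> f (line (\<Psi> p0) B t) \<noteq> 0"
    using eventually_polynomial_line[OF f nz] by eventually_elim auto
  then obtain t where t: "line (\<Psi> p0) B t \<in> U" "f (line (\<Psi> p0) B t) \<noteq> 0"
    by (auto dest: eventually_happens'[rotated])
  then obtain a b G S where p: "line (\<Psi> p0) B t = \<Psi> (a, b, G, S)"
    using U(3) by (auto simp: image_iff subset_iff)
  \<comment> \<open>All tensors on this line are skew, so the symmetric contribution vanishes and
    the point found is an honest value of \<open>five_lines\<close>.\<close>
  have "line (\<Psi> p0) B t $ k \<in> wedge2" for k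
    unfolding p0 by (intro line_wedge2 five_lines_wedge2 B)
  then have skew: "\<Psi> (a, b, G, S) $ k $ i $ j = - \<Psi> (a, b, G, S) $ k $ j $ i" for k i j
    unfolding p wedge2_iff by blast
  have "S $ k $ i $ j + S $ k $ j $ i = 0" for k i j
  proof -
    have "u = - v \<Longrightarrow> u + (p + q) = - (v + (q + p)) \<Longrightarrow> p + q = 0" for u v p q :: complex
      by algebra
    moreover have "five_lines a b G $ k $ i $ j = - five_lines a b G $ k $ j $ i"
      using five_lines_wedge2 wedge2_iff by blast
    moreover have "five_lines a b G $ k $ i $ j + (S $ k $ i $ j + S $ k $ j $ i) =
        - (five_lines a b G $ k $ j $ i + (S $ k $ j $ i + S $ k $ i $ j))"
      using skew[of k i j] unfolding \<Psi>_def by simp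
    ultimately show ?thesis by blast
  qed
  then have "\<Psi> (a, b, G, S) = five_lines a b G"
    by (simp add: \<Psi>_def vec_eq_iff)
  then show False using t p zero by simp
qed

text \<open>The product of \<open>f\<close> and \<open>g\<close> vanishes on all values of
  \<open>five_lines\<close>. The factor \<open>f\<close> plays the role of a denominator: the
  identity has to be verified only where it is nonzero.\<close>

lemma five_lines_identity:
  assumes "polynomial f" "polynomial g"
    and "\<And>a b G. f (five_lines a b G) \<noteq> 0 \<Longrightarrow> g (five_lines a b G) = 0"
    and "\<And>k. A $ k \<in> wedge2" "f A \<noteq> 0"
  shows "g A = 0"
  using five_lines_dominant[OF polynomial.mult[OF assms(1,2)], of A] assms(3-5) by auto

subsection \<open>Linear equations for the space spanned by the five points\<close>

definition quad :: "tensor \<Rightarrow> complex ^ 4 ^ 4 \<Rightarrow> 6 \<Rightarrow> 6 \<Rightarrow> 6 \<Rightarrow> 6 \<Rightarrow> complex" where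
  "quad A Q i j k l = (\<Sum>a\<in>UNIV. \<Sum>b\<in>UNIV. Q $ a $ b * star (A $ a) (A $ b) i j k l)"

definition in_quad :: "tensor \<Rightarrow> (6 \<Rightarrow> 6 \<Rightarrow> 6 \<Rightarrow> 6 \<Rightarrow> complex) \<Rightarrow> bool" where
  "in_quad A F \<longleftrightarrow> (\<exists>Q. (\<forall>a b. Q $ a $ b = Q $ b $ a) \<and> (\<forall>i j k l. F i j k l = quad A Q i j k l))"

text \<open>Multiplication from the quadratic forms in the four coefficient matrices, a space of
  dimension 10, to the fourth exterior power is injective.\<close>

definition quad_inj :: "tensor \<Rightarrow> bool" where
  "quad_inj A \<longleftrightarrow> (\<forall>Q. (\<forall>a b. Q $ a $ b = Q $ b $ a) \<longrightarrow> (\<forall>i j k l. quad A Q i j k l = 0) \<longrightarrow> Q = 0)"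

text \<open>Coordinates on the span of the five special lines.\<close>

definition ell :: "complex ^ 6 ^ 6 \<Rightarrow> complex ^ 4 option" where
  "ell X = (\<chi> i. case i of None \<Rightarrow> X $ 2 $ 3 | Some m \<Rightarrow>
     if m = 1 then X $ 0 $ 1 else if m = 2 then X $ 4 $ 5 else if m = 3 then X $ 1 $ 3 else X $ 0 $ 2)"

text \<open>The solutions X of X W4 <= W4 W4 are determined by the five coordinates
  \<open>ell\<close>, so they form a space of dimension at most 5.\<close>

definition sol_inj :: "tensor \<Rightarrow> bool" where
  "sol_inj A \<longleftrightarrow> (\<forall>X\<in>wedge2. (\<forall>m. in_quad A (star X (A $ m))) \<longrightarrow> ell X = 0 \<longrightarrow> X = 0)"

lemma quad_add: "quad A (P + Q) i j k l = quad A P i j k l + quad A Q i j k l"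
  by (simp add: quad_def algebra_simps sum.distrib)

lemma quad_scale: "quad A (\<chi> a b. c * Q $ a $ b) i j k l = c * quad A Q i j k l"
  by (simp add: quad_def sum_distrib_left mult_ac)

lemma in_quad_add:
  assumes "in_quad A F" "in_quad A F'"
  shows "in_quad A (\<lambda>i j k l. F i j k l + F' i j k l)"
proof -
  obtain P Q where P: "\<And>a b. P $ a $ b = P $ b $ a" "\<And>i j k l. F i j k l = quad A P i j k l"
    and Q: "\<And>a b. Q $ a $ b = Q $ b $ a" "\<And>i j k l. F' i j k l = quad A Q i j k l"
    using assms unfolding in_quad_def by blast
  have "(P + Q) $ a $ b = (P + Q) $ b $ a" for a b
    unfolding vector_add_component by (subst P(1), subst Q(1)) simp
  then show ?thesis unfolding in_quad_def using P(2) Q(2) by (intro exI[of _ "P + Q"]) (simp add: quad_add)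
qed

lemma in_quad_scale:
  assumes "in_quad A F"
  shows "in_quad A (\<lambda>i j k l. c * F i j k l)"
proof -
  obtain P where P: "\<And>a b. P $ a $ b = P $ b $ a" "\<And>i j k l. F i j k l = quad A P i j k l"
    using assms unfolding in_quad_def by blast
  have "(\<chi> a b. c * P $ a $ b) $ a $ b = (\<chi> a b. c * P $ a $ b) $ b $ a" for a b
    unfolding vec_lambda_beta by (subst P(1)) simp
  then show ?thesis unfolding in_quad_def using P(2)
    by (intro exI[of _ "\<chi> a b. c * P $ a $ b"]) (simp add: quad_scale)
qed

lemma in_quad_star_diff:
  assumes "in_quad A (star X Z)" "in_quad A (star Y Z)"
  shows "in_quad A (star (X - Y) Z)"
proof -
  have "star (X - Y) Z = (\<lambda>i j k l. star X Z i j k l + (- 1) * star Y Z i j k l)"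
    by (simp add: fun_eq_iff star_diff_left)
  then show ?thesis using in_quad_add[OF assms(1) in_quad_scale[OF assms(2)]] by (simp only:)
qed

lemma in_quad_zero: "in_quad A (\<lambda>i j k l. 0)"
  unfolding in_quad_def by (intro exI[of _ 0]) (simp add: quad_def)

lemma in_quad_sum:
  "(\<And>s. s \<in> S \<Longrightarrow> in_quad A (F s)) \<Longrightarrow> in_quad A (\<lambda>i j k l. \<Sum>s\<in>S. F s i j k l)"
  by (induction S rule: infinite_finite_induct) (auto intro: in_quad_zero in_quad_add)

lemma star_lin_map: "star (lin_map A c) (lin_map A c') i j k l =
    quad A (\<chi> a b. (c $ a * c' $ b + c' $ a * c $ b) / 2) i j k l"
proof -
  have l: "star (lin_map A c) (lin_map A c') i j k l =
      (\<Sum>a\<in>UNIV. \<Sum>b\<in>UNIV. c $ a * c' $ b * star (A $ a) (A $ b) i j k l)" for c c'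
    by (simp add: lin_map_def star_sum_left star_sum_right star_scale_left star_scale_right
        sum_distrib_left mult_ac) (rule sum.swap)
  have "star (lin_map A c) (lin_map A c') i j k l =
     (star (lin_map A c) (lin_map A c') i j k l + star (lin_map A c') (lin_map A c) i j k l) / 2"
    by (simp add: star_commute)
  also have "\<dots> = quad A (\<chi> a b. (c $ a * c' $ b + c' $ a * c $ b) / 2) i j k l"
    unfolding l by (simp add: quad_def sum.distrib[symmetric] sum_divide_distrib algebra_simps add_divide_distrib)
  finally show ?thesis .
qed

lemma in_quad_star_lin_map: "in_quad A (star (lin_map A c) (lin_map A c'))"
  unfolding in_quad_def
  by (rule exI[of _ "\<chi> a b. (c $ a * c' $ b + c' $ a * c $ b) / 2"]) (simp add: star_lin_map mult.commute add.commute)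

lemma quad_inj_star:
  assumes "quad_inj A" "\<And>i j k l. star (lin_map A c) (lin_map A c') i j k l = 0"
  shows "c $ a * c' $ b + c' $ a * c $ b = 0"
proof -
  have "(\<chi> a b. (c $ a * c' $ b + c' $ a * c $ b) / 2) = (0 :: complex ^ 4 ^ 4)"
    using assms unfolding quad_inj_def star_lin_map by (simp add: mult.commute add.commute)
  then have "(\<chi> a b. (c $ a * c' $ b + c' $ a * c $ b) / 2) $ a $ b = (0 :: complex)" by simp
  then show ?thesis by simp
qed

text \<open>The square of an element of the image is a quadratic form of rank one. Hence the image
  of the tensor contains no decomposable bivector except 0.\<close>

lemma quad_inj_star_self:
  assumes "quad_inj A" "\<And>i j k l. star (lin_map A c) (lin_map A c) i j k l = 0"
  shows "c = 0"
proof -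
  have "c $ a = 0" for a using quad_inj_star[OF assms, of a a] by simp
  then show ?thesis by (simp add: vec_eq_iff)
qed

lemma quad_inj_lin_map:
  assumes "quad_inj A" "lin_map A c = 0"
  shows "c = 0"
  using assms(2) by (intro quad_inj_star_self[OF assms(1)]) (simp add: star_zero_left)

lemma lin_map_zero: "lin_map A 0 = 0"
  by (simp add: lin_map_def mscale_def vec_eq_iff)

lemma lin_map_diff: "lin_map A (x - y) = lin_map A x - lin_map A y"
  by (simp add: lin_map_def vec_eq_iff mscale_def algebra_simps sum_subtractf)

lemma quad_inj_inj:
  assumes "quad_inj A" shows "inj (lin_map A)"
proof (rule injI)
  fix x y assume "lin_map A x = lin_map A y"
  then have "lin_map A (x - y) = 0" by (simp add: lin_map_diff)
  then have "x - y = 0" by (rule quad_inj_lin_map[OF assms])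
  then show "x = y" by simp
qed

definition span5 :: "(4 option \<Rightarrow> complex ^ 6 ^ 6) \<Rightarrow> complex ^ 4 option \<Rightarrow> complex ^ 6 ^ 6" where
  "span5 y t = (\<Sum>i\<in>UNIV. mscale (t $ i) (y i))"

lemma span5_add: "span5 y (s + t) = span5 y s + span5 y t"
  by (simp add: span5_def vec_eq_iff mscale_def algebra_simps sum.distrib)

lemma span5_scale: "span5 y (c *s t) = mscale c (span5 y t)"
  by (simp add: span5_def vec_eq_iff mscale_def sum_distrib_left mult_ac)

lemma span5_diff: "span5 y (s - t) = span5 y s - span5 y t"
  by (simp add: span5_def vec_eq_iff mscale_def algebra_simps sum_subtractf)

lemma span5_axis: "span5 y (axis i 1) = y i"
proof -
  have "mscale (axis i 1 $ k) (y k) = (if k = i then y k else 0)" for k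
    by (simp add: axis_def vec_eq_iff mscale_def)
  then show ?thesis by (simp add: span5_def)
qed

lemma ell_add: "ell (X + Y) = ell X + ell Y"
  by (simp add: ell_def vec_eq_iff split: option.splits)

lemma ell_diff: "ell (X - Y) = ell X - ell Y"
  by (simp add: ell_def vec_eq_iff split: option.splits)

lemma ell_scale: "ell (mscale c X) = c *s ell X"
  by (simp add: ell_def vec_eq_iff mscale_def split: option.splits)

lemma span5_wedge2: "(\<And>i. y i \<in> wedge2) \<Longrightarrow> span5 y t \<in> wedge2"
  unfolding span5_def
  by (intro mat.subspace_sum[OF subspace_wedge2] mat.subspace_scale[OF subspace_wedge2]) auto

locale pentad =
  fixes A :: tensor and y :: "4 option \<Rightarrow> complex ^ 6 ^ 6" and G :: "complex ^ 4 ^ 4"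
  assumes quad_inj: "quad_inj A"
    and y_wedge2: "\<And>i. y i \<in> wedge2"
    and star_y: "\<And>i a b c d. star (y i) (y i) a b c d = 0"
    and A_eq: "\<And>m. A $ m = (\<Sum>i\<in>UNIV. mscale (G $ m $ i) (y (Some i) - y None))"
begin

lemma lin_map_y: "lin_map A c = (\<Sum>i\<in>UNIV. mscale ((c v* G) $ i) (y (Some i) - y None))"
proof -
  have "lin_map A c = (\<Sum>m\<in>UNIV. \<Sum>i\<in>UNIV. mscale (c $ m * G $ m $ i) (y (Some i) - y None))"
    unfolding lin_map_def A_eq by (simp add: mat.scale_sum_right)
  also have "\<dots> = (\<Sum>i\<in>UNIV. \<Sum>m\<in>UNIV. mscale (c $ m * G $ m $ i) (y (Some i) - y None))"
    by (rule sum.swap)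
  also have "\<dots> = (\<Sum>i\<in>UNIV. mscale ((c v* G) $ i) (y (Some i) - y None))"
    by (simp add: vector_matrix_mult_def mat.scale_sum_left mult.commute)
  finally show ?thesis .
qed

lemma invertible_G: "invertible G"
proof -
  have "c = 0" if "transpose G *v c = 0" for c
  proof (rule quad_inj_lin_map[OF quad_inj])
    have "c v* G = 0" using that by simp
    then show "lin_map A c = 0" by (simp add: lin_map_y)
  qed
  then have "inj ((*v) (transpose G))"
    by (metis matrix_left_invertible_ker matrix_left_invertible_injective)
  then have "invertible (transpose G)"
    by (simp add: invertible_left_inverse matrix_left_invertible_injective)
  then show ?thesis by (simp add: invertible_det_nz)
qed

lemma difference_in_image:
  obtains c where "y i - y j = lin_map A c"
proof -
  obtain H where H: "H ** G = mat 1" using invertible_G unfolding invertible_def by blast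
  have some: "lin_map A (axis m 1 v* H) = y (Some m) - y None" for m
  proof -
    have "(axis m 1 v* H) v* G = axis m 1"
      by (simp add: vector_matrix_mul_assoc H)
    moreover have "mscale (axis m 1 $ i) (y (Some i) - y None) = (if i = m then y (Some i) - y None else 0)" for i
      by (simp add: axis_def vec_eq_iff mscale_def)
    ultimately show ?thesis by (simp add: lin_map_y)
  qed
  have none: "\<exists>c. y i - y None = lin_map A c" for i
    by (cases i) (metis diff_self lin_map_scale mat.scale_zero_left, metis some)
  obtain c c' where "y i - y None = lin_map A c" "y j - y None = lin_map A c'" using none by metis
  then have "y i - y j = lin_map A (c - c')"
    by (simp add: lin_map_diff algebra_simps)
  then show ?thesis using that by blast
qed

lemma in_quad_y: "in_quad A (star (y i) (y j))"
proof -
  obtain c where c: "y i - y j = lin_map A c" by (rule difference_in_image)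
  have "star (y i) (y j) a b k l = - (1 / 2) * star (y i - y j) (y i - y j) a b k l" for a b k l
    by (simp add: star_diff_left star_diff_right star_y star_commute[of "y j" "y i"])
  then have "star (y i) (y j) = (\<lambda>a b k l. - (1 / 2) * star (y i - y j) (y i - y j) a b k l)"
    by (simp add: fun_eq_iff)
  then show ?thesis unfolding c using in_quad_scale[OF in_quad_star_lin_map, of A "- (1 / 2)" c c] by simp
qed

lemma in_quad_span5: "in_quad A (star (span5 y s) (span5 y t))"
proof -
  have "star (span5 y s) (span5 y t) = (\<lambda>a b k l. \<Sum>i\<in>UNIV. \<Sum>j\<in>UNIV. s $ i * t $ j * star (y i) (y j) a b k l)"
    by (simp add: fun_eq_iff span5_def star_sum_left star_sum_right star_scale_left star_scale_right
        sum_distrib_left mult_ac) (intro allI, rule sum.swap)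
  then show ?thesis by (simp only:) (intro in_quad_sum in_quad_scale in_quad_y)
qed

lemma lin_map_span5:
  obtains t where "lin_map A c = span5 y t" "(\<Sum>i\<in>UNIV. t $ i) = 0"
proof -
  define t where "t = (\<chi> i. case i of None \<Rightarrow> - (\<Sum>m\<in>UNIV. (c v* G) $ m) | Some m \<Rightarrow> (c v* G) $ m)"
  have "lin_map A c = span5 y t"
    unfolding lin_map_y span5_def sum_option t_def
    by (simp add: mat.scale_right_diff_distrib sum_subtractf mat.scale_sum_left)
  moreover have "(\<Sum>i\<in>UNIV. t $ i) = 0" by (simp add: sum_option t_def)
  ultimately show ?thesis using that by blast
qed

text \<open>Rewrite a relation in terms of the differences and \<open>y None\<close>. If its
  coordinate sum is nonzero, \<open>y None\<close> lies in the image although its square is zero; if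
  the sum is zero, it is a relation between differences, excluded since \<open>G\<close> is
  invertible and \<open>lin_map A\<close> is injective.\<close>

lemma independent_y:
  assumes "span5 y t = 0" shows "t = 0"
proof -
  have decomp: "span5 y t = (\<Sum>m\<in>UNIV. mscale (t $ Some m) (y (Some m) - y None)) + mscale (\<Sum>i\<in>UNIV. t $ i) (y None)"
    by (simp add: span5_def sum_option mat.scale_right_diff_distrib sum_subtractf mat.scale_sum_left
        mat.scale_left_distrib)
  obtain H where H: "H ** G = mat 1" using invertible_G unfolding invertible_def by blast
  define c where "c = (\<chi> m. t $ Some m) v* H"
  have "c v* G = (\<chi> m. t $ Some m)" by (simp add: c_def vector_matrix_mul_assoc H)
  then have c: "lin_map A c = (\<Sum>m\<in>UNIV. mscale (t $ Some m) (y (Some m) - y None))"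
    by (simp add: lin_map_y)
  have "(\<Sum>i\<in>UNIV. t $ i) = 0"
  proof (rule ccontr)
    assume s: "(\<Sum>i\<in>UNIV. t $ i) \<noteq> 0"
    define s where "s = (\<Sum>i\<in>UNIV. t $ i)"
    have "y None = mscale (- 1 / s) (lin_map A c)"
      using assms decomp s unfolding c[symmetric] s_def[symmetric]
      by (simp add: vec_eq_iff mscale_def field_simps add_eq_0_iff)
    then have y0: "y None = lin_map A ((- 1 / s) *s c)" by (simp only: lin_map_scale)
    have "(- 1 / s) *s c = 0"
      using star_y[of None] unfolding y0 by (rule quad_inj_star_self[OF quad_inj])
    \<comment> \<open>With \<open>y None = 0\<close> also \<open>y (Some 1)\<close> is in the image
      and has square zero. So the first difference vanishes, which contradicts injectivity of
      \<open>lin_map A\<close>.\<close>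
    then have "y None = 0" unfolding y0 by (simp only: lin_map_zero)
    moreover obtain c1 where c1: "y (Some 1) - y None = lin_map A c1" by (rule difference_in_image)
    ultimately have "lin_map A c1 = y (Some 1)" by simp
    then have "c1 = 0" using star_y[of "Some 1"] quad_inj_star_self[OF quad_inj] by metis
    then have "y (Some 1) = y None" using c1 unfolding lin_map_def by (simp add: mat.scale_zero_left)
    define e where "e = axis 1 1 v* H"
    have eG: "e v* G = axis 1 1" by (simp add: e_def vector_matrix_mul_assoc H)
    have z: "mscale (axis 1 1 $ i) (y (Some i) - y None) = 0" for i :: 4
      using \<open>y (Some 1) = y None\<close> by (simp add: axis_def mscale_def vec_eq_iff)
    then have "lin_map A e = 0" unfolding lin_map_y eG z by simp
    then have "e = 0" by (rule quad_inj_lin_map[OF quad_inj])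
    then show False using eG by (metis axis_eq_0_iff vector_matrix_mult_0 zero_neq_one)
  qed
  then have "lin_map A c = 0" using assms decomp c by (simp add: mat.scale_zero_left)
  then have "c = 0" by (rule quad_inj_lin_map[OF quad_inj])
  then have "(\<chi> m. t $ Some m) = 0" using \<open>c v* G = (\<chi> m. t $ Some m)\<close> by simp
  then have some: "t $ Some m = 0" for m by (simp add: vec_eq_iff)
  then have "t $ None = 0" using \<open>(\<Sum>i\<in>UNIV. t $ i) = 0\<close> by (simp add: sum_option)
  then show ?thesis using some by (simp add: vec_eq_iff) (metis option.exhaust)
qed

lemma in_quad_star_A: "in_quad A (star (span5 y t) (A $ m))"
proof -
  obtain s where "lin_map A (axis m 1) = span5 y s" by (rule lin_map_span5)
  then show ?thesis using in_quad_span5[of t s] by (simp add: lin_map_axis)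
qed

text \<open>All elements of the span are solutions, so \<open>sol_inj\<close> makes
  \<open>ell\<close> injective on a space of the same dimension as its target.\<close>

lemma ell_span5_surj:
  assumes sol: "sol_inj A"
  shows "\<exists>t. ell (span5 y t) = c"
proof -
  have lin: "Vector_Spaces.linear (*s) (*s) (\<lambda>t. ell (span5 y t))"
    by (simp add: Vector_Spaces.linear_iff ell_add ell_scale span5_add span5_scale vec.vector_space_axioms)
  have "t = 0" if "ell (span5 y t) = 0" for t
  proof -
    have "span5 y t = 0"
      using sol that span5_wedge2[of y t] y_wedge2 in_quad_star_A unfolding sol_inj_def by blast
    then show ?thesis by (rule independent_y)
  qed
  then have "inj (\<lambda>t. ell (span5 y t))" using vec.linear_inj_iff_eq_0[OF lin] by blast
  then have "surj (\<lambda>t. ell (span5 y t))" using vec.linear_injective_imp_surjective[OF lin] by blast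
  then show ?thesis by (metis surjD)
qed

text \<open>Subtracting the element of the span with the same \<open>ell\<close> leaves a solution
  that \<open>sol_inj\<close> forces to be zero.\<close>

lemma solution_in_span5:
  assumes sol: "sol_inj A" and X: "X \<in> wedge2" "\<And>m. in_quad A (star X (A $ m))"
  obtains t where "X = span5 y t"
proof -
  obtain t where t: "ell (span5 y t) = ell X" using ell_span5_surj[OF sol] by blast
  have "X - span5 y t \<in> wedge2"
    using X(1) span5_wedge2[of y t] y_wedge2 by (intro mat.subspace_diff[OF subspace_wedge2]) auto
  moreover have "in_quad A (star (X - span5 y t) (A $ m))" for m
    by (intro in_quad_star_diff X in_quad_star_A)
  moreover have "ell (X - span5 y t) = 0" using t by (simp add: ell_diff)
  ultimately have "X - span5 y t = 0" using sol unfolding sol_inj_def by blast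
  then show ?thesis using that by simp
qed

end

section \<open>The special tensor\<close>

definition base :: tensor where
  "base = five_lines line_a line_b (mat 1)"

lemma base_nth: "base $ m = line_y (Some m) - line_y None"
proof -
  have "mscale (mat 1 $ m $ i) X = (if i = m then X else 0)" for i X
    by (simp add: mat_def mscale_def vec_eq_iff)
  then show ?thesis by (simp add: base_def five_lines_def line_y_def)
qed

lemma quad_base:
  "quad base Q 0 1 3 4 = Q $ 3 $ 4 + Q $ 4 $ 3" "quad base Q 1 2 3 4 = - (Q $ 3 $ 4 + Q $ 4 $ 3)"
  "quad base Q 0 1 2 5 = - (Q $ 3 $ 4 + Q $ 4 $ 3)" "quad base Q 1 2 4 5 = Q $ 3 $ 4 + Q $ 4 $ 3"
  "quad base Q 0 2 3 5 = Q $ 3 $ 4 + Q $ 4 $ 3" "quad base Q 0 3 4 5 = - (Q $ 3 $ 4 + Q $ 4 $ 3)"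
  by (simp_all add: quad_def sum_4 star_def base_nth line_y_def wedge_def)

text \<open>Once \<open>Q $ 3 $ 4\<close> is gone, every remaining product of two lines has a
  coordinate of its own. The products with line \<open>None\<close> come last: when the entries off
  the diagonal vanish, their coefficients are \<open>- 2 * Q $ a $ a\<close>.\<close>

lemma quad_inj_base: "quad_inj base"
  unfolding quad_inj_def
proof (intro allI impI)
  fix Q :: "complex ^ 4 ^ 4"
  assume "\<forall>a b. Q $ a $ b = Q $ b $ a"
  then have sym: "Q $ 2 $ 1 = Q $ 1 $ 2" "Q $ 3 $ 1 = Q $ 1 $ 3" "Q $ 4 $ 1 = Q $ 1 $ 4"
    "Q $ 3 $ 2 = Q $ 2 $ 3" "Q $ 4 $ 2 = Q $ 2 $ 4" "Q $ 4 $ 3 = Q $ 3 $ 4"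
    by auto
  assume z: "\<forall>i j k l. quad base Q i j k l = 0"
  note simps = quad_def sum_4 star_def base_nth line_y_def wedge_def sym
  have q34: "Q $ 3 $ 4 = 0" using quad_base(1)[of Q] z sym by simp
  have q12: "Q $ 1 $ 2 = 0" using z[rule_format, of 0 1 4 5] by (simp add: simps q34)
  have q13: "Q $ 1 $ 3 = 0" using z[rule_format, of 0 1 3 5] by (simp add: simps q34)
  have q14: "Q $ 1 $ 4 = 0" using z[rule_format, of 0 1 2 4] by (simp add: simps q34)
  have q23: "Q $ 2 $ 3 = 0" using z[rule_format, of 1 3 4 5] by (simp add: simps q34)
  have q24: "Q $ 2 $ 4 = 0" using z[rule_format, of 0 2 4 5] by (simp add: simps q34)
  note q = q12 q13 q14 q23 q24 q34
  have "Q $ 1 $ 1 = 0" using z[rule_format, of 0 1 2 3] by (simp add: simps q)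
  moreover have "Q $ 2 $ 2 = 0" using z[rule_format, of 2 3 4 5] by (simp add: simps q)
  moreover have "Q $ 3 $ 3 = 0" using z[rule_format, of 1 2 3 5] by (simp add: simps q)
  moreover have "Q $ 4 $ 4 = 0" using z[rule_format, of 0 2 3 4] by (simp add: simps q)
  ultimately show "Q = 0" by (simp add: vec_eq_iff forall_4 q sym)
qed

lemma sol_inj_base: "sol_inj base"
  unfolding sol_inj_def
proof (intro ballI impI)
  fix X assume X: "X \<in> wedge2" and q: "\<forall>m. in_quad base (star X (base $ m))" and l: "ell X = 0"
  \<comment> \<open>Five linear equations on \<open>X\<close> for each \<open>m\<close>, valid for
    every element of W4 W4 by \<open>quad_base\<close>.\<close>
  have rel: "star X (base $ m) 1 2 3 4 = - star X (base $ m) 0 1 3 4"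
    "star X (base $ m) 0 1 2 5 = - star X (base $ m) 0 1 3 4"
    "star X (base $ m) 1 2 4 5 = star X (base $ m) 0 1 3 4"
    "star X (base $ m) 0 2 3 5 = star X (base $ m) 0 1 3 4"
    "star X (base $ m) 0 3 4 5 = - star X (base $ m) 0 1 3 4" for m
  proof -
    obtain Q where "\<forall>i j k l. star X (base $ m) i j k l = quad base Q i j k l"
      using q unfolding in_quad_def by blast
    then show "star X (base $ m) 1 2 3 4 = - star X (base $ m) 0 1 3 4"
      "star X (base $ m) 0 1 2 5 = - star X (base $ m) 0 1 3 4"
      "star X (base $ m) 1 2 4 5 = star X (base $ m) 0 1 3 4"
      "star X (base $ m) 0 2 3 5 = star X (base $ m) 0 1 3 4"
      "star X (base $ m) 0 3 4 5 = - star X (base $ m) 0 1 3 4"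
      by (simp_all add: quad_base)
  qed
  note simps = star_def base_nth line_y_def wedge_def skew_entries[OF X]
  have ell0: "ell X $ i = 0" for i using l by simp
  have l0: "X $ 2 $ 3 = 0" "X $ 0 $ 1 = 0" "X $ 4 $ 5 = 0" "X $ 1 $ 3 = 0" "X $ 0 $ 2 = 0"
    using ell0[of None] ell0[of "Some 1"] ell0[of "Some 2"] ell0[of "Some 3"] ell0[of "Some 4"]
    by (simp_all add: ell_def)
  have "X $ 3 $ 4 = 0" "X $ 2 $ 5 = 0" "X $ 0 $ 5 = 0" "X $ 1 $ 4 = 0"
    using rel[of 1] by (simp_all add: simps)
  note x1 = this
  have x2: "X $ 0 $ 3 = 0" "X $ 1 $ 2 = 0"
    using rel[of 2] by (simp_all add: simps x1)
  have x3: "X $ 0 $ 4 = 0" "X $ 2 $ 4 = 0"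
    using rel[of 3] by (simp_all add: simps x1 x2 l0)
  have x4: "X $ 1 $ 5 = 0" "X $ 3 $ 5 = 0"
    using rel[of 4] by (simp_all add: simps x1 x2 l0)
  show "X = 0"
    by (simp add: vec_eq_iff forall_6 skew_entries[OF X] l0 x1 x2 x3 x4)
qed

lemma ell_line_y: "ell (line_y i) = axis i 1"
proof -
  have "\<forall>m. ell (line_y (Some m)) = axis (Some m) 1"
    unfolding forall_4
    by (simp add: vec_eq_iff split_option_all forall_4 ell_def line_y_def wedge_def axis_def)
  moreover have "ell (line_y None) = axis None 1"
    by (simp add: vec_eq_iff split_option_all forall_4 ell_def line_y_def wedge_def axis_def)
  ultimately show ?thesis by (cases i) auto
qed

lemma det_nonzero_iff:
  fixes M :: "complex ^ 'n ^ 'n"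
  shows "det M \<noteq> 0 \<longleftrightarrow> (\<forall>x. M *v x = 0 \<longrightarrow> x = 0)"
  by (metis invertible_det_nz invertible_left_inverse matrix_left_invertible_ker)

lemma linear_inj_kernel:
  fixes f :: "complex ^ 'n \<Rightarrow> complex ^ 'm"
  assumes "Vector_Spaces.linear (*s) (*s) f" "\<And>x. f x = 0 \<Longrightarrow> x = 0"
  shows "inj f"
  using assms by (simp add: vec.linear_inj_iff_eq_0)

lemma linear_zero_imp:
  fixes f :: "complex ^ 'n \<Rightarrow> complex ^ 'm"
  assumes "inj f" "Vector_Spaces.linear (*s) (*s) f" "f x = 0"
  shows "x = 0"
  using assms by (simp add: vec.linear_inj_iff_eq_0)

lemma linear_scale_vec:
  fixes f :: "complex ^ 'n \<Rightarrow> complex ^ 'm"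
  assumes "Vector_Spaces.linear (*s) (*s) f"
  shows "f (c *s x) = c *s f x"
  using assms by (simp add: Vector_Spaces.linear_iff)

lemma polynomial_star:
  assumes "\<And>i j. polynomial (\<lambda>A. X A $ i $ j)" "\<And>i j. polynomial (\<lambda>A. Y A $ i $ j)"
  shows "polynomial (\<lambda>A. star (X A) (Y A) i j k l)"
  unfolding star_def by (intro polynomial_intros assms)

lemma polynomial_quad:
  assumes "\<And>a b. polynomial (\<lambda>A. Q A $ a $ b)"
  shows "polynomial (\<lambda>A. quad A (Q A) i j k l)"
  unfolding quad_def by (intro polynomial_intros polynomial_star assms)

lemma polynomial_ell:
  assumes "\<And>i j. polynomial (\<lambda>A. X A $ i $ j)"
  shows "polynomial (\<lambda>A. ell (X A) $ s)"
  unfolding ell_def by (cases s) (auto intro!: assms polynomial_if)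

text \<open>The unknowns are a bivector \<open>X\<close> and four symmetric matrices \<open>Q\<^sub>m\<close>; the equations say that
  \<open>star X (A $ m) = quad A Q\<^sub>m\<close> and prescribe \<open>ell X\<close>.\<close>

definition eqs1 :: "tensor \<Rightarrow> complex ^ (6 \<times> 6 + 4 \<times> 4 \<times> 4) \<Rightarrow>
    complex ^ (4 \<times> 6 \<times> 6 \<times> 6 \<times> 6 + 6 \<times> 6 + 4 \<times> 4 \<times> 4 + 4 option)" where
  "eqs1 A x = (\<chi> r. case r of
     Inl (m, i, j, k, l) \<Rightarrow> star (\<chi> i j. x $ Inl (i, j)) (A $ m) i j k l - quad A (\<chi> a b. x $ Inr (m, a, b)) i j k l
   | Inr (Inl (i, j)) \<Rightarrow> x $ Inl (i, j) + x $ Inl (j, i)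
   | Inr (Inr (Inl (m, a, b))) \<Rightarrow> x $ Inr (m, a, b) - x $ Inr (m, b, a)
   | Inr (Inr (Inr s)) \<Rightarrow> ell (\<chi> i j. x $ Inl (i, j)) $ s)"

text \<open>Prescribing equal coordinates selects a solution outside the image of the tensor: at
  \<open>base\<close> it is the sum of the five lines, whose coordinate sum is 5 and not 0.\<close>

definition rhs1 :: "complex ^ (4 \<times> 6 \<times> 6 \<times> 6 \<times> 6 + 6 \<times> 6 + 4 \<times> 4 \<times> 4 + 4 option)" where
  "rhs1 = (\<chi> r. case r of Inr (Inr (Inr s)) \<Rightarrow> 1 | _ \<Rightarrow> 0)"

lemma eqs1_nth:
  "eqs1 A x $ Inl (m, i, j, k, l) = star (\<chi> i j. x $ Inl (i, j)) (A $ m) i j k l - quad A (\<chi> a b. x $ Inr (m, a, b)) i j k l"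
  "eqs1 A x $ Inr (Inl (i, j)) = x $ Inl (i, j) + x $ Inl (j, i)"
  "eqs1 A x $ Inr (Inr (Inl (m, a, b))) = x $ Inr (m, a, b) - x $ Inr (m, b, a)"
  "eqs1 A x $ Inr (Inr (Inr s)) = ell (\<chi> i j. x $ Inl (i, j)) $ s"
  by (simp_all add: eqs1_def)

lemma rhs1_nth: "rhs1 $ Inl u = 0" "rhs1 $ Inr (Inl v) = 0" "rhs1 $ Inr (Inr (Inl w)) = 0"
  "rhs1 $ Inr (Inr (Inr s)) = 1"
  by (simp_all add: rhs1_def)

lemma eqs1_eq_iff:
  "eqs1 A x = y \<longleftrightarrow>
    (\<forall>m i j k l. star (\<chi> i j. x $ Inl (i, j)) (A $ m) i j k l - quad A (\<chi> a b. x $ Inr (m, a, b)) i j k l = y $ Inl (m, i, j, k, l)) \<and>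
    (\<forall>i j. x $ Inl (i, j) + x $ Inl (j, i) = y $ Inr (Inl (i, j))) \<and>
    (\<forall>m a b. x $ Inr (m, a, b) - x $ Inr (m, b, a) = y $ Inr (Inr (Inl (m, a, b)))) \<and>
    (\<forall>s. ell (\<chi> i j. x $ Inl (i, j)) $ s = y $ Inr (Inr (Inr s)))"
  unfolding vec_eq_iff[of "eqs1 A x"] split_sum_all split_paired_All eqs1_nth by simp

lemma linear_eqs1: "Vector_Spaces.linear (*s) (*s) (eqs1 A)"
proof -
  have "eqs1 A (x + y) = eqs1 A x + eqs1 A y" for x y
  proof -
    have "(\<chi> i j. (x + y) $ Inl (i, j)) = (\<chi> i j. x $ Inl (i, j)) + (\<chi> i j. y $ Inl (i, j))"
      "(\<chi> a b. (x + y) $ Inr (m, a, b)) = (\<chi> a b. x $ Inr (m, a, b)) + (\<chi> a b. y $ Inr (m, a, b))" for m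
      by (simp_all add: vec_eq_iff)
    then show ?thesis
      unfolding eqs1_eq_iff by (simp add: eqs1_nth star_add_left quad_add ell_add)
  qed
  moreover have "eqs1 A (c *s x) = c *s eqs1 A x" for c x
  proof -
    have "(\<chi> i j. (c *s x) $ Inl (i, j)) = mscale c (\<chi> i j. x $ Inl (i, j))"
      "(\<chi> a b. (c *s x) $ Inr (m, a, b)) = (\<chi> a b. c * (\<chi> a b. x $ Inr (m, a, b)) $ a $ b)" for m
      by (simp_all add: vec_eq_iff mscale_def)
    then show ?thesis
      unfolding eqs1_eq_iff
      by (simp add: eqs1_nth star_scale_left quad_scale[of A c "\<chi> a b. x $ Inr (_, a, b)", simplified] ell_scale right_diff_distrib distrib_left)
  qed
  ultimately show ?thesis by (simp add: Vector_Spaces.linear_iff vec.vector_space_axioms)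
qed

lemma polynomial_eqs1:
  assumes z: "\<And>i. polynomial (\<lambda>A. z A $ i)"
  shows "polynomial (\<lambda>A. eqs1 A (z A) $ r)"
proof -
  have "\<forall>r. polynomial (\<lambda>A. eqs1 A (z A) $ r)"
    unfolding split_sum_all split_paired_All eqs1_nth
    by (intro conjI allI polynomial_intros polynomial_star polynomial_quad polynomial_ell)
      (simp_all add: z polynomial.coord)
  then show ?thesis by blast
qed

text \<open>In the kernel, \<open>sol_inj\<close> removes the bivector and then
  \<open>quad_inj\<close> the four matrices. The two lemmas below give the converse, so a nonzero
  Cramer determinant yields both conditions.\<close>

lemma inj_eqs1:
  assumes "quad_inj A" "sol_inj A" shows "inj (eqs1 A)"
proof (rule linear_inj_kernel[OF linear_eqs1])
  fix x assume "eqs1 A x = 0"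
  then have *: "\<And>m i j k l. star (\<chi> i j. x $ Inl (i, j)) (A $ m) i j k l = quad A (\<chi> a b. x $ Inr (m, a, b)) i j k l"
    "\<And>i j. x $ Inl (i, j) + x $ Inl (j, i) = 0" "\<And>m a b. x $ Inr (m, a, b) = x $ Inr (m, b, a)"
    "\<And>s. ell (\<chi> i j. x $ Inl (i, j)) $ s = 0"
    unfolding eqs1_eq_iff by simp_all
  define X where "X = (\<chi> i j. x $ Inl (i, j))"
  have "X \<in> wedge2" unfolding wedge2_iff X_def using *(2) by (simp add: eq_neg_iff_add_eq_0)
  moreover have "in_quad A (star X (A $ m))" for m
    unfolding in_quad_def X_def using *(1,3) by (intro exI[of _ "\<chi> a b. x $ Inr (m, a, b)"]) simp
  moreover have "ell X = 0" using *(4) by (simp add: X_def vec_eq_iff)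
  ultimately have X: "X = 0" using assms(2) unfolding sol_inj_def by blast
  have "(\<chi> a b. x $ Inr (m, a, b)) = (0 :: complex ^ 4 ^ 4)" for m
  proof -
    have "quad A (\<chi> a b. x $ Inr (m, a, b)) i j k l = 0" for i j k l
      using *(1)[of m i j k l] X unfolding X_def[symmetric] by (simp add: star_zero_left)
    then show ?thesis using assms(1) *(3) unfolding quad_inj_def by simp
  qed
  then have "x $ Inr (m, a, b) = 0" for m a b by (simp add: vec_eq_iff)
  moreover have "x $ Inl (i, j) = 0" for i j using X by (simp add: X_def vec_eq_iff)
  ultimately show "x = 0" by (simp add: vec_eq_iff split_sum_all)
qed

lemma eqs1_inj_imp_quad_inj:
  assumes "inj (eqs1 A)" shows "quad_inj A"
  unfolding quad_inj_def
proof (intro allI impI)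
  fix Q :: "complex ^ 4 ^ 4"
  assume sym: "\<forall>a b. Q $ a $ b = Q $ b $ a" and z: "\<forall>i j k l. quad A Q i j k l = 0"
  define x :: "complex ^ (6 \<times> 6 + 4 \<times> 4 \<times> 4)" where
    "x = (\<chi> r. case r of Inl u \<Rightarrow> 0 | Inr (m, a, b) \<Rightarrow> Q $ a $ b)"
  have "eqs1 A x = 0"
    unfolding eqs1_eq_iff using sym z
    by (simp add: x_def ell_def star_def split: option.splits)
  then have "x = 0" by (rule linear_zero_imp[OF assms linear_eqs1])
  then have "x $ Inr (1, a, b) = 0" for a b by simp
  then show "Q = 0" by (simp add: x_def vec_eq_iff)
qed

lemma eqs1_inj_imp_sol_inj:
  assumes "inj (eqs1 A)" shows "sol_inj A"
  unfolding sol_inj_def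
proof (intro ballI impI)
  fix X assume X: "X \<in> wedge2" "\<forall>m. in_quad A (star X (A $ m))" "ell X = 0"
  obtain Q where Q: "\<And>m a b. Q m $ a $ b = Q m $ b $ a" "\<And>m i j k l. star X (A $ m) i j k l = quad A (Q m) i j k l"
    using X(2) unfolding in_quad_def by metis
  define x :: "complex ^ (6 \<times> 6 + 4 \<times> 4 \<times> 4)" where
    "x = (\<chi> r. case r of Inl (i, j) \<Rightarrow> X $ i $ j | Inr (m, a, b) \<Rightarrow> Q m $ a $ b)"
  have skew: "X $ i $ j + X $ j $ i = 0" for i j
    using X(1) unfolding wedge2_iff by (simp add: eq_neg_iff_add_eq_0)
  have sym: "Q m $ a $ b - Q m $ b $ a = 0" for m a b using Q(1)[of m a b] by simp
  have "eqs1 A x = 0"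
    unfolding eqs1_eq_iff using X(3) by (simp add: x_def Q(2) skew sym)
  then have "x = 0" by (rule linear_zero_imp[OF assms linear_eqs1])
  then have "x $ Inl (i, j) = 0" for i j by simp
  then show "X = 0" by (simp add: x_def vec_eq_iff)
qed

lemma pentad_five_lines:
  assumes "quad_inj (five_lines a b G)"
  shows "pentad (five_lines a b G) (\<lambda>i. wedge (a $ i) (b $ i)) G"
  using assms by unfold_locales (simp_all add: wedge_in_wedge2 star_wedge five_lines_def)

text \<open>There are more equations than unknowns; a solution exists because the span of the five
  lines consists of solutions of the linear condition and \<open>ell\<close> is onto on it.\<close>

lemma eqs1_solvable:
  fixes a b G
  defines "A \<equiv> five_lines a b G"
  assumes inj: "inj (eqs1 A)"
  obtains x where "eqs1 A x = rhs1"
proof -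
  interpret pentad A "\<lambda>i. wedge (a $ i) (b $ i)" G
    using eqs1_inj_imp_quad_inj[OF inj] unfolding A_def by (rule pentad_five_lines)
  let ?y = "\<lambda>i. wedge (a $ i) (b $ i)"
  obtain t where t: "ell (span5 ?y t) = (\<chi> i. 1)"
    using ell_span5_surj[OF eqs1_inj_imp_sol_inj[OF inj]] by blast
  let ?X = "span5 ?y t"
  have "\<forall>m. in_quad A (star ?X (A $ m))" using in_quad_star_A by blast
  then obtain Q where Q: "\<And>m a b. Q m $ a $ b = Q m $ b $ a" "\<And>m i j k l. star ?X (A $ m) i j k l = quad A (Q m) i j k l"
    unfolding in_quad_def by metis
  define x :: "complex ^ (6 \<times> 6 + 4 \<times> 4 \<times> 4)" where
    "x = (\<chi> r. case r of Inl (i, j) \<Rightarrow> ?X $ i $ j | Inr (m, a, b) \<Rightarrow> Q m $ a $ b)"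
  have "?X \<in> wedge2" by (intro span5_wedge2 wedge_in_wedge2)
  then have skew: "?X $ i $ j + ?X $ j $ i = 0" for i j
    unfolding wedge2_iff by (simp add: eq_neg_iff_add_eq_0)
  have sym: "Q m $ a $ b - Q m $ b $ a = 0" for m a b using Q(1)[of m a b] by simp
  have "eqs1 A x = rhs1"
    unfolding eqs1_eq_iff using t by (simp add: x_def Q(2) skew sym rhs1_nth)
  then show ?thesis using that by blast
qed

text \<open>The second system expresses the square of a bivector, later \<beta>, by the products of
  the coefficient matrices.\<close>

definition eqs2 :: "tensor \<Rightarrow> complex ^ (4 \<times> 4) \<Rightarrow> complex ^ (6 \<times> 6 \<times> 6 \<times> 6 + 4 \<times> 4)" where
  "eqs2 A x = (\<chi> r. case r of Inl (i, j, k, l) \<Rightarrow> quad A (\<chi> a b. x $ (a, b)) i j k l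
     | Inr (a, b) \<Rightarrow> x $ (a, b) - x $ (b, a))"

definition rhs2 :: "complex ^ 6 ^ 6 \<Rightarrow> complex ^ (6 \<times> 6 \<times> 6 \<times> 6 + 4 \<times> 4)" where
  "rhs2 X = (\<chi> r. case r of Inl (i, j, k, l) \<Rightarrow> star X X i j k l | Inr u \<Rightarrow> 0)"

lemma eqs2_nth:
  "eqs2 A x $ Inl (i, j, k, l) = quad A (\<chi> a b. x $ (a, b)) i j k l"
  "eqs2 A x $ Inr (a, b) = x $ (a, b) - x $ (b, a)"
  by (simp_all add: eqs2_def)

lemma rhs2_nth: "rhs2 X $ Inl (i, j, k, l) = star X X i j k l" "rhs2 X $ Inr u = 0"
  by (simp_all add: rhs2_def)

lemma eqs2_eq_iff:
  "eqs2 A x = y \<longleftrightarrow> (\<forall>i j k l. quad A (\<chi> a b. x $ (a, b)) i j k l = y $ Inl (i, j, k, l)) \<and>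
    (\<forall>a b. x $ (a, b) - x $ (b, a) = y $ Inr (a, b))"
  unfolding vec_eq_iff[of "eqs2 A x"] split_sum_all split_paired_All eqs2_nth by simp

lemma linear_eqs2: "Vector_Spaces.linear (*s) (*s) (eqs2 A)"
proof -
  have "eqs2 A (x + y) = eqs2 A x + eqs2 A y" for x y
    unfolding eqs2_eq_iff using quad_add[of A "\<chi> a b. x $ (a, b)" "\<chi> a b. y $ (a, b)"]
    by (simp add: eqs2_nth plus_vec_def)
  moreover have "eqs2 A (c *s x) = c *s eqs2 A x" for c x
    unfolding eqs2_eq_iff using quad_scale[of A c "\<chi> a b. x $ (a, b)"]
    by (simp add: eqs2_nth right_diff_distrib)
  ultimately show ?thesis by (simp add: Vector_Spaces.linear_iff vec.vector_space_axioms)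
qed

lemma polynomial_eqs2:
  assumes z: "\<And>i. polynomial (\<lambda>A. z A $ i)"
  shows "polynomial (\<lambda>A. eqs2 A (z A) $ r)"
proof -
  have "\<forall>r. polynomial (\<lambda>A. eqs2 A (z A) $ r)"
    unfolding split_sum_all split_paired_All eqs2_nth
    by (intro conjI allI polynomial_intros polynomial_quad) (simp_all add: z)
  then show ?thesis by blast
qed

lemma inj_eqs2:
  assumes "quad_inj A" shows "inj (eqs2 A)"
proof (rule linear_inj_kernel[OF linear_eqs2])
  fix x assume "eqs2 A x = 0"
  then have "\<And>i j k l. quad A (\<chi> a b. x $ (a, b)) i j k l = 0" "\<And>a b. x $ (a, b) = x $ (b, a)"
    unfolding eqs2_eq_iff by simp_all
  then have "(\<chi> a b. x $ (a, b)) = (0 :: complex ^ 4 ^ 4)"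
    using assms unfolding quad_inj_def by simp
  then show "x = 0" by (simp add: vec_eq_iff)
qed

text \<open>\<open>\<beta> A\<close> spans the five-dimensional space together with the image of \<open>A\<close>; \<open>q A m\<close> and \<open>q0 A\<close> express
  its products with \<open>A $ m\<close> and, up to the factor \<open>d A\<close>, with itself as quadratic expressions in \<open>A\<close>.\<close>

locale solution =
  fixes d e :: "tensor \<Rightarrow> complex" and \<beta> :: "tensor \<Rightarrow> complex ^ 6 ^ 6"
    and q :: "tensor \<Rightarrow> 4 \<Rightarrow> complex ^ 4 ^ 4" and q0 :: "tensor \<Rightarrow> complex ^ 4 ^ 4"
  assumes polynomial_d: "polynomial d" and polynomial_e: "polynomial e"
    and polynomial_\<beta>: "\<And>i j. polynomial (\<lambda>A. \<beta> A $ i $ j)"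
    and polynomial_q: "\<And>m a b. polynomial (\<lambda>A. q A m $ a $ b)"
    and polynomial_q0: "\<And>a b. polynomial (\<lambda>A. q0 A $ a $ b)"
    and d_base: "d base \<noteq> 0"
    and solved: "\<And>A. (\<And>k. A $ k \<in> wedge2) \<Longrightarrow> d A \<noteq> 0 \<Longrightarrow> quad_inj A \<and> sol_inj A \<and> e A \<noteq> 0 \<and>
        \<beta> A \<in> wedge2 \<and> ell (\<beta> A) = (\<chi> i. e A) \<and> (\<forall>m a b. q A m $ a $ b = q A m $ b $ a) \<and>
        (\<forall>m i j k l. star (\<beta> A) (A $ m) i j k l = quad A (q A m) i j k l) \<and>
        (\<forall>a b. q0 A $ a $ b = q0 A $ b $ a) \<and>
        (\<forall>i j k l. d A * star (\<beta> A) (\<beta> A) i j k l = quad A (q0 A) i j k l)"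

text \<open>Both systems are solvable for tensors given by five lines, hence so are they wherever the
  Cramer determinants do not vanish.\<close>

lemma solution_exists: "\<exists>d e \<beta> q q0. solution d e \<beta> q q0"
proof -
  have pe1: "polynomial (\<lambda>A. eqs1 A x $ r)" for x r
    by (rule polynomial_eqs1[of "\<lambda>_. x"], rule polynomial.const)
  have pe2: "polynomial (\<lambda>A. eqs2 A x $ r)" for x r
    by (rule polynomial_eqs2[of "\<lambda>_. x"], rule polynomial.const)
  obtain d1 z1 where 1: "polynomial d1" "\<And>i. polynomial (\<lambda>A. z1 A $ i)" "d1 base \<noteq> 0"
    "\<And>A. d1 A \<noteq> 0 \<Longrightarrow> inj (eqs1 A)" "\<And>A x. eqs1 A x = rhs1 \<Longrightarrow> d1 A *s x = z1 A"
    using cramer_family[of eqs1 "\<lambda>A. rhs1" base, OF linear_eqs1 pe1 polynomial.const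
        inj_eqs1[OF quad_inj_base sol_inj_base]] by blast
  have z1: "eqs1 A (z1 A) = d1 A *s rhs1" if "\<And>k. A $ k \<in> wedge2" "d1 A \<noteq> 0" for A
  proof -
    have "eqs1 A (z1 A) $ r - d1 A * rhs1 $ r = 0" for r
    proof (rule five_lines_identity[where f = d1 and g = "\<lambda>A. eqs1 A (z1 A) $ r - d1 A * rhs1 $ r"])
      fix a b G
      let ?A = "five_lines a b G"
      assume "d1 ?A \<noteq> 0"
      then obtain x where x: "eqs1 ?A x = rhs1" using eqs1_solvable 1(4) by metis
      show "eqs1 ?A (z1 ?A) $ r - d1 ?A * rhs1 $ r = 0"
        unfolding 1(5)[OF x, symmetric] linear_scale_vec[OF linear_eqs1] x by simp
    qed (intro that 1 polynomial_intros polynomial_eqs1)+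
    then show ?thesis by (simp add: vec_eq_iff)
  qed
  define \<beta> where "\<beta> A = (\<chi> i j. z1 A $ Inl (i, j))" for A
  define q where "q A m = (\<chi> a b. z1 A $ Inr (m, a, b))" for A m
  have p\<beta>: "polynomial (\<lambda>A. \<beta> A $ i $ j)" for i j unfolding \<beta>_def by (simp add: 1)
  have sol1: "\<beta> A \<in> wedge2" "ell (\<beta> A) = (\<chi> i. d1 A)" "q A m $ a $ b = q A m $ b $ a"
    "star (\<beta> A) (A $ m) i j k l = quad A (q A m) i j k l"
    if "\<And>k. A $ k \<in> wedge2" "d1 A \<noteq> 0" for A m a b i j k l
  proof -
    have "\<forall>m i j k l. star (\<beta> A) (A $ m) i j k l - quad A (q A m) i j k l = 0"
      "\<forall>i j. \<beta> A $ i $ j + \<beta> A $ j $ i = 0" "\<forall>m a b. q A m $ a $ b - q A m $ b $ a = 0"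
      "\<forall>s. ell (\<beta> A) $ s = d1 A"
      using z1[OF that] unfolding eqs1_eq_iff by (simp_all add: \<beta>_def q_def rhs1_nth)
    then show "\<beta> A \<in> wedge2" "ell (\<beta> A) = (\<chi> i. d1 A)" "q A m $ a $ b = q A m $ b $ a"
      "star (\<beta> A) (A $ m) i j k l = quad A (q A m) i j k l"
      by (simp_all add: wedge2_iff eq_neg_iff_add_eq_0 vec_eq_iff)
  qed
  have prhs2: "polynomial (\<lambda>A. rhs2 (\<beta> A) $ r)" for r
  proof -
    have "\<forall>r. polynomial (\<lambda>A. rhs2 (\<beta> A) $ r)"
      unfolding split_sum_all split_paired_All rhs2_nth
      by (intro conjI allI polynomial_intros polynomial_star p\<beta>)
    then show ?thesis by blast
  qed
  obtain d2 z2 where 2: "polynomial d2" "\<And>i. polynomial (\<lambda>A. z2 A $ i)" "d2 base \<noteq> 0"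
    "\<And>A. d2 A \<noteq> 0 \<Longrightarrow> inj (eqs2 A)" "\<And>A x. eqs2 A x = rhs2 (\<beta> A) \<Longrightarrow> d2 A *s x = z2 A"
    using cramer_family[of eqs2 "\<lambda>A. rhs2 (\<beta> A)" base, OF linear_eqs2 pe2 prhs2
        inj_eqs2[OF quad_inj_base]] by blast
  have z2: "eqs2 A (z2 A) = d2 A *s rhs2 (\<beta> A)" if "\<And>k. A $ k \<in> wedge2" "d1 A \<noteq> 0" for A
  proof -
    have "eqs2 A (z2 A) $ r - d2 A * rhs2 (\<beta> A) $ r = 0" for r
    proof (rule five_lines_identity[where f = d1 and g = "\<lambda>A. eqs2 A (z2 A) $ r - d2 A * rhs2 (\<beta> A) $ r"])
      fix a b G
      define A where "A = five_lines a b G"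
      assume "d1 (five_lines a b G) \<noteq> 0"
      then have nz: "d1 A \<noteq> 0" by (simp add: A_def)
      note inj = 1(4)[OF nz]
      interpret pentad A "\<lambda>i. wedge (a $ i) (b $ i)" G
        using eqs1_inj_imp_quad_inj[OF inj] unfolding A_def by (rule pentad_five_lines)
      have skew: "\<And>k. A $ k \<in> wedge2" by (simp add: A_def five_lines_wedge2)
      have "in_quad A (star (\<beta> A) (A $ m))" for m
        unfolding in_quad_def using sol1(3,4)[OF skew nz] by blast
      \<comment> \<open>Being a solution, \<beta> is a combination of the five lines, and squares of
        such combinations lie in W4 W4.\<close>
      then obtain t where "\<beta> A = span5 (\<lambda>i. wedge (a $ i) (b $ i)) t"
        using solution_in_span5[OF eqs1_inj_imp_sol_inj[OF inj]] sol1(1)[OF skew nz] by blast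
      then have "in_quad A (star (\<beta> A) (\<beta> A))" by (simp only: in_quad_span5)
      then obtain Q where Q: "\<And>a b. Q $ a $ b = Q $ b $ a" "\<And>i j k l. star (\<beta> A) (\<beta> A) i j k l = quad A Q i j k l"
        unfolding in_quad_def by blast
      have "Q $ a $ b - Q $ b $ a = 0" for a b using Q(1)[of a b] by simp
      then have x: "eqs2 A (\<chi> u. Q $ fst u $ snd u) = rhs2 (\<beta> A)"
        unfolding eqs2_eq_iff by (simp add: rhs2_nth Q(2))
      show "eqs2 (five_lines a b G) (z2 (five_lines a b G)) $ r -
          d2 (five_lines a b G) * rhs2 (\<beta> (five_lines a b G)) $ r = 0"
        unfolding A_def[symmetric] 2(5)[OF x, symmetric] linear_scale_vec[OF linear_eqs2] x by simp
    qed (intro that 1 2 polynomial_intros polynomial_eqs2 prhs2)+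
    then show ?thesis by (simp add: vec_eq_iff)
  qed
  \<comment> \<open>The second Cramer solution carries only the denominator \<open>d2\<close>; the
    extra factor brings it to the common denominator \<open>d1 A * d2 A\<close>.\<close>
  define q0 where "q0 A = (\<chi> a b. d1 A * z2 A $ (a, b))" for A
  have "solution (\<lambda>A. d1 A * d2 A) d1 \<beta> q q0"
  proof
    fix A :: tensor assume skew: "\<And>k. A $ k \<in> wedge2" and "d1 A * d2 A \<noteq> 0"
    then have d1: "d1 A \<noteq> 0" by simp
    have "(\<forall>i j k l. quad A (\<chi> a b. z2 A $ (a, b)) i j k l = d2 A * star (\<beta> A) (\<beta> A) i j k l) \<and>
        (\<forall>a b. z2 A $ (a, b) - z2 A $ (b, a) = 0)"
      using z2[OF skew d1] unfolding eqs2_eq_iff by (simp add: rhs2_nth)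
    moreover have "quad A (q0 A) i j k l = d1 A * quad A (\<chi> a b. z2 A $ (a, b)) i j k l" for i j k l
      unfolding q0_def using quad_scale[of A "d1 A" "\<chi> a b. z2 A $ (a, b)"] by simp
    ultimately have "\<forall>a b. q0 A $ a $ b = q0 A $ b $ a"
      "\<forall>i j k l. d1 A * d2 A * star (\<beta> A) (\<beta> A) i j k l = quad A (q0 A) i j k l"
      by (simp_all add: q0_def)
    then show "quad_inj A \<and> sol_inj A \<and> d1 A \<noteq> 0 \<and>
        \<beta> A \<in> wedge2 \<and> ell (\<beta> A) = (\<chi> i. d1 A) \<and> (\<forall>m a b. q A m $ a $ b = q A m $ b $ a) \<and>
        (\<forall>m i j k l. star (\<beta> A) (A $ m) i j k l = quad A (q A m) i j k l) \<and>
        (\<forall>a b. q0 A $ a $ b = q0 A $ b $ a) \<and>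
        (\<forall>i j k l. d1 A * d2 A * star (\<beta> A) (\<beta> A) i j k l = quad A (q0 A) i j k l)"
      using sol1[OF skew d1] eqs1_inj_imp_quad_inj[OF 1(4)[OF d1]] eqs1_inj_imp_sol_inj[OF 1(4)[OF d1]] d1
      by blast
  qed (use 1 2 p\<beta> in \<open>auto simp: q_def q0_def intro!: polynomial_intros\<close>)
  then show ?thesis by blast
qed

subsection \<open>Cyclic vectors and distinct eigenvalues\<close>

text \<open>Numbers the index type by the exponents 0 to 4, so that Krylov and Vandermonde matrices
  are square matrices over \<open>4 option\<close>.\<close>

definition idx :: "4 option \<Rightarrow> nat" where
  "idx i = (case i of None \<Rightarrow> 0 | Some m \<Rightarrow> if m = 1 then 1 else if m = 2 then 2 else if m = 3 then 3 else 4)"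

lemma sum_idx: "(\<Sum>i\<in>UNIV. f (idx i)) = (\<Sum>k\<le>4. f k)" for f :: "nat \<Rightarrow> 'a::comm_monoid_add"
  by (simp add: sum_option sum_4 idx_def eval_nat_numeral add_ac)

lemma inj_idx: "inj idx"
proof -
  have "\<forall>i j. idx i = idx j \<longrightarrow> i = j"
    unfolding split_option_all forall_4 by (simp add: idx_def)
  then show ?thesis by (simp add: inj_def)
qed

lemma idx_le: "idx i \<le> 4"
  by (simp add: idx_def split: option.split)

lemma idx_surj: "k \<le> 4 \<Longrightarrow> \<exists>i. idx i = k"
proof -
  assume "k \<le> 4"
  then have "k = idx None \<or> k = idx (Some 1) \<or> k = idx (Some 2) \<or> k = idx (Some 3) \<or> k = idx (Some 4)"
    by (auto simp: idx_def)
  then show ?thesis by metis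
qed

lemma sum_le_5: "(\<Sum>k\<le>5. f k) = (\<Sum>k\<le>4. f k) + f 5"
  "(\<Sum>k\<le>5. f k) = f 0 + (\<Sum>k\<le>4. f (Suc k))" for f :: "nat \<Rightarrow> 'a::comm_monoid_add"
  using sum.atMost_Suc[of f 4] sum.atMost_Suc_shift[of f 4] by simp_all

definition mpow :: "complex ^ 'n ^ 'n \<Rightarrow> nat \<Rightarrow> complex ^ 'n \<Rightarrow> complex ^ 'n" where
  "mpow M k = ((*v) M) ^^ k"

lemma mpow_0 [simp]: "mpow M 0 x = x" and mpow_Suc: "mpow M (Suc k) x = M *v mpow M k x"
  by (simp_all add: mpow_def)

lemma mpow_eigen: "M *v w = l *s w \<Longrightarrow> mpow M k w = l ^ k *s w"
  by (induction k) (simp_all add: mpow_Suc vector_scalar_commute vector_smult_assoc mult.commute)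

lemma matrix_vector_mult_sum:
  fixes M :: "complex ^ 'n ^ 'm"
  shows "M *v (\<Sum>j\<in>S. f j) = (\<Sum>j\<in>S. M *v f j)"
  by (induction S rule: infinite_finite_induct) (simp_all add: matrix_vector_right_distrib)

lemma pderiv_sum: "pderiv (\<Sum>j\<in>S. f j) = (\<Sum>j\<in>S. pderiv (f j))"
  by (induction S rule: infinite_finite_induct) (simp_all add: pderiv_add)

definition colsum :: "('k::finite \<Rightarrow> complex ^ 'n) \<Rightarrow> complex ^ 'k \<Rightarrow> complex ^ 'n" where
  "colsum w t = (\<Sum>i\<in>UNIV. t $ i *s w i)"

lemma colsum_matrix: "colsum w t = (\<chi> i j. w j $ i) *v t"
  by (simp add: colsum_def vec_eq_iff matrix_vector_mult_def mult.commute)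

lemma mpow_colsum:
  assumes "\<And>i. M *v w i = l i *s w i"
  shows "mpow M k (colsum w t) = colsum w (\<chi> i. t $ i * l i ^ k)"
proof (induction k)
  case (Suc k)
  have "M *v colsum w s = colsum w (\<chi> i. s $ i * l i)" for s
    by (simp add: colsum_def matrix_vector_mult_sum vector_scalar_commute assms vector_smult_assoc)
  then show ?case by (simp add: mpow_Suc Suc mult.assoc mult.commute[of "l _ ^ k"])
qed simp

definition krylov :: "complex ^ 4 option ^ 4 option \<Rightarrow> complex ^ 4 option \<Rightarrow> complex ^ 4 option ^ 4 option" where
  "krylov M x = (\<chi> i j. mpow M (idx j) x $ i)"

lemma krylov_mult: "krylov M x *v c = (\<Sum>j\<in>UNIV. c $ j *s mpow M (idx j) x)"
  by (simp add: krylov_def vec_eq_iff matrix_vector_mult_def mult.commute)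

text \<open>For \<open>p = X\<^sup>5 - (\<Sum>j. c\<^sub>j X\<^sup>j)\<close>, scaled by \<open>s\<close>, the value of the derivative of \<open>p\<close> at the matrix \<open>M\<close>.\<close>

definition deriv_at :: "complex \<Rightarrow> complex ^ 4 option \<Rightarrow> complex ^ 4 option ^ 4 option \<Rightarrow> complex ^ 4 option ^ 4 option" where
  "deriv_at s c M = (\<chi> i j. (s * 5) * mpow M 4 (axis j 1) $ i
     - (\<Sum>k\<in>UNIV. of_nat (idx k) * c $ k * mpow M (idx k - 1) (axis j 1) $ i))"

text \<open>When \<open>x0\<close> is cyclic and \<open>s *s mpow M 5 x0 = krylov M x0 *v c\<close>,
  this is \<open>s\<close> times the characteristic polynomial of \<open>M\<close>. Keeping
  \<open>s\<close> avoids a division.\<close>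

definition cpoly :: "complex \<Rightarrow> complex ^ 4 option \<Rightarrow> complex poly" where
  "cpoly s c = monom s 5 - (\<Sum>k\<in>UNIV. monom (c $ k) (idx k))"

lemma mpow_linear: "mpow M k (x + y) = mpow M k x + mpow M k y" "mpow M k (a *s x) = a *s mpow M k x"
  by (induction k) (simp_all add: mpow_Suc matrix_vector_right_distrib vector_scalar_commute)

lemma mpow_sum: "mpow M k (\<Sum>j\<in>S. f j) = (\<Sum>j\<in>S. mpow M k (f j))"
proof (induction S rule: infinite_finite_induct)
  have "mpow M k (0 *s 0) = 0 *s mpow M k 0" by (rule mpow_linear)
  then have z: "mpow M k 0 = 0" by simp
  { case (infinite A) then show ?case by (simp add: z) }
  { case empty then show ?case by (simp add: z) }
next
  case (insert x F) then show ?case by (simp add: mpow_linear)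
qed

lemma axis_expand: "(\<Sum>j\<in>UNIV. x $ j *s axis j 1) = (x :: complex ^ 'n)"
  by (simp add: vec_eq_iff axis_def if_distrib[of "\<lambda>y. _ * y"] cong: if_cong)

lemma mpow_axis: "(\<Sum>j\<in>UNIV. mpow M k (axis j 1) $ i * x $ j) = mpow M k x $ i"
proof -
  have "mpow M k x = mpow M k (\<Sum>j\<in>UNIV. x $ j *s axis j 1)" by (simp add: axis_expand)
  also have "\<dots> = (\<Sum>j\<in>UNIV. x $ j *s mpow M k (axis j 1))" by (simp add: mpow_sum mpow_linear)
  finally show ?thesis by (simp add: mult.commute)
qed

lemma deriv_at_mult: "deriv_at s c M *v x = (s * 5) *s mpow M 4 x - (\<Sum>k\<in>UNIV. (of_nat (idx k) * c $ k) *s mpow M (idx k - 1) x)"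
proof -
  have "(deriv_at s c M *v x) $ i = (s * 5) * (\<Sum>j\<in>UNIV. mpow M 4 (axis j 1) $ i * x $ j)
      - (\<Sum>k\<in>UNIV. of_nat (idx k) * c $ k * (\<Sum>j\<in>UNIV. mpow M (idx k - 1) (axis j 1) $ i * x $ j))" for i
    unfolding deriv_at_def matrix_vector_mult_def
    by (simp add: left_diff_distrib sum_subtractf sum_distrib_left sum_distrib_right mult.assoc) (rule sum.swap)
  then show ?thesis by (simp add: vec_eq_iff mpow_axis)
qed

lemma poly_cpoly: "poly (cpoly s c) x = s * x ^ 5 - (\<Sum>k\<in>UNIV. c $ k * x ^ idx k)"
  by (simp add: cpoly_def poly_monom poly_sum)

lemma poly_pderiv_cpoly: "poly (pderiv (cpoly s c)) x = s * 5 * x ^ 4 - (\<Sum>k\<in>UNIV. of_nat (idx k) * c $ k * x ^ (idx k - 1))"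
  by (simp add: cpoly_def pderiv_diff pderiv_monom pderiv_sum poly_monom poly_sum mult.assoc mult.commute[of "of_nat _"])

lemma coeff_cpoly: "coeff (cpoly s c) (idx k) = - c $ k" "coeff (cpoly s c) 5 = s" "n > 5 \<Longrightarrow> coeff (cpoly s c) n = 0"
proof -
  have *: "coeff (cpoly s c) n = (if n = 5 then s else 0) - (\<Sum>k\<in>UNIV. if idx k = n then c $ k else 0)" for n
    by (auto simp: cpoly_def coeff_sum)
  have "(\<Sum>j\<in>UNIV. if idx j = idx k then c $ j else 0) = c $ k"
    using inj_idx by (simp add: inj_eq)
  then show "coeff (cpoly s c) (idx k) = - c $ k" using idx_le[of k] by (simp add: *)
  have "idx k \<noteq> n" if "n > 4" for k n using idx_le[of k] that by auto
  then show "coeff (cpoly s c) 5 = s" "n > 5 \<Longrightarrow> coeff (cpoly s c) n = 0" by (auto simp: *)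
qed

lemma degree_cpoly: "s \<noteq> 0 \<Longrightarrow> degree (cpoly s c) = 5"
  by (intro antisym degree_le le_degree) (auto simp: coeff_cpoly)

lemma deriv_at_eigen:
  assumes "M *v w = l *s w"
  shows "deriv_at s c M *v w = poly (pderiv (cpoly s c)) l *s w"
  unfolding deriv_at_mult mpow_eigen[OF assms] poly_pderiv_cpoly
  by (simp add: vector_ssub_ldistrib vec_eq_iff left_diff_distrib sum_distrib_right mult.assoc)

text \<open>A polynomial \<open>f\<close> in \<open>M\<close> multiplies coordinate \<open>i\<close>
  by the value of \<open>f\<close> at \<open>l i\<close>; an \<open>f\<close> vanishing at all other
  eigenvalues isolates one coordinate.\<close>

lemma distinct_eigenvectors_independent:
  fixes w :: "4 option \<Rightarrow> complex ^ 4 option"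
  assumes eig: "\<And>i. M *v w i = l i *s w i" and l: "inj l" and w: "\<And>i. w i \<noteq> 0"
    and t: "colsum w t = 0"
  shows "t = 0"
proof -
  have pows: "colsum w (\<chi> i. t $ i * l i ^ k) = 0" for k
  proof -
    have "mpow M k (0 *s 0) = 0 *s mpow M k 0" by (rule mpow_linear)
    then show ?thesis using mpow_colsum[of M w l k t, OF eig] t by simp
  qed
  have polys: "colsum w (\<chi> i. t $ i * poly f (l i)) = 0" for f
  proof -
    have "colsum w (\<chi> i. t $ i * poly f (l i)) = (\<Sum>k\<le>degree f. coeff f k *s colsum w (\<chi> i. t $ i * l i ^ k))"
      by (simp add: colsum_def poly_altdef vec_eq_iff sum_distrib_left sum_distrib_right mult_ac)
        (intro allI sum.swap)
    then show ?thesis by (simp add: pows)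
  qed
  have "t $ i = 0" for i
  proof -
    define f where "f = (\<Prod>j\<in>UNIV - {i}. [:- l j, 1:])"
    have f: "poly f (l j) = 0 \<longleftrightarrow> j \<noteq> i" for j
      using l by (auto simp: f_def poly_prod inj_eq)
    have "colsum w (\<chi> j. t $ j * poly f (l j)) = (\<Sum>j\<in>UNIV. if j = i then (t $ i * poly f (l i)) *s w i else 0)"
      unfolding colsum_def using f by (intro sum.cong) auto
    then have "(t $ i * poly f (l i)) *s w i = 0" using polys[of f] by simp
    then show ?thesis using w[of i] f[of i] by simp
  qed
  then show ?thesis by (simp add: vec_eq_iff)
qed

lemma colsum_surj:
  fixes w :: "4 option \<Rightarrow> complex ^ 4 option"
  assumes "\<And>t. colsum w t = 0 \<Longrightarrow> t = 0"
  shows "invertible (\<chi> i j. w j $ i)" "\<exists>t. x = colsum w t"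
proof -
  show inv: "invertible (\<chi> i j. w j $ i)"
    using assms unfolding colsum_matrix
    by (metis invertible_left_inverse matrix_left_invertible_ker)
  then obtain N where "(\<chi> i j. w j $ i) ** N = mat 1" by (auto simp: invertible_def)
  then have "x = colsum w (N *v x)" by (simp add: colsum_matrix matrix_vector_mul_assoc)
  then show "\<exists>t. x = colsum w t" by blast
qed

text \<open>In eigenvector coordinates the equation for \<open>x\<close> reads
  \<open>t $ j * (l j - a) = 0\<close>, so a single coordinate survives.\<close>

lemma eigenvector_multiple:
  fixes w :: "4 option \<Rightarrow> complex ^ 4 option"
  assumes eig: "\<And>i. M *v w i = l i *s w i" and l: "inj l" and w: "\<And>i. w i \<noteq> 0"
    and x: "M *v x = a *s x" "x \<noteq> 0"
  obtains i s where "l i = a" "x = s *s w i"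
proof -
  have ind: "t = 0" if "colsum w t = 0" for t
    by (rule distinct_eigenvectors_independent[OF eig l w that])
  obtain t where t: "x = colsum w t" using colsum_surj(2)[OF ind] by blast
  have "colsum w (\<chi> j. t $ j * (l j - a)) = M *v x - a *s x"
    unfolding t colsum_def
    by (simp add: matrix_vector_mult_sum vector_scalar_commute eig vec_eq_iff sum_distrib_left
        sum_subtractf[symmetric] algebra_simps)
  then have "(\<chi> j. t $ j * (l j - a)) = 0" unfolding x(1) diff_self by (rule ind)
  then have ta: "t $ j = 0 \<or> l j = a" for j by (simp add: vec_eq_iff)
  have "t \<noteq> 0" using x(2) t by (auto simp: colsum_def)
  then obtain i where i: "t $ i \<noteq> 0" by (auto simp: vec_eq_iff)
  have "t $ j = 0" if "j \<noteq> i" for j using ta[of i] ta[of j] i l that by (auto simp: inj_eq)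
  then have "x = (\<Sum>j\<in>UNIV. if j = i then t $ i *s w i else 0)"
    unfolding t colsum_def by (intro sum.cong) auto
  then show ?thesis using that[of i "t $ i"] ta[of i] i by simp
qed

text \<open>For a root \<open>a\<close> write p = (X - a) g. Then g(M) x0 is nonzero, because g has
  degree 4 and x0 is cyclic, and M - a maps it to p(M) x0 = 0. On this eigenvector p'(M) acts as
  p'(a), so invertibility of \<open>deriv_at\<close> makes all roots simple and there are five of
  them.\<close>

lemma cyclic_eigenvectors:
  assumes K: "det (krylov M x0) \<noteq> 0" and s: "s \<noteq> 0"
    and c: "s *s mpow M 5 x0 = krylov M x0 *v c"
    and R: "det (deriv_at s c M) \<noteq> 0"
  obtains l :: "4 option \<Rightarrow> complex" and w :: "4 option \<Rightarrow> complex ^ 4 option"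
  where "inj l" "\<And>i. M *v w i = l i *s w i" "\<And>i. w i \<noteq> 0"
proof -
  define p where "p = cpoly s c"
  have deg: "degree p = 5" unfolding p_def using s by (rule degree_cpoly)
  then have p0: "p \<noteq> 0" by auto
  have Kinj: "x = 0" if "krylov M x0 *v x = 0" for x
    using K that unfolding det_nonzero_iff by blast
  have eigvec: "\<exists>w. w \<noteq> 0 \<and> M *v w = a *s w" if "poly p a = 0" for a
  proof -
    have "[:- a, 1:] dvd p" using that by (simp add: poly_eq_0_iff_dvd)
    then obtain g where g: "p = [:- a, 1:] * g" unfolding dvd_def by blast
    have g0: "g \<noteq> 0" using g p0 by auto
    then have degg: "degree g = 4" using deg unfolding g by (subst (asm) degree_mult_eq) auto
    define op where "op f = (\<Sum>k\<le>5. coeff f k *s mpow M k x0)" for f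
    define w where "w = op g"
    have gc: "coeff g 5 = 0" using degg by (simp add: coeff_eq_0)
    have "w = (\<Sum>k\<le>4. coeff g k *s mpow M k x0)"
      by (simp add: w_def op_def gc sum_le_5(1))
    also have "\<dots> = krylov M x0 *v (\<chi> j. coeff g (idx j))"
      unfolding krylov_mult sum_idx[symmetric] by simp
    finally have wK: "w = krylov M x0 *v (\<chi> j. coeff g (idx j))" .
    have "w \<noteq> 0"
    proof
      assume "w = 0"
      then have "(\<chi> j. coeff g (idx j)) = 0" using wK Kinj by metis
      then have z: "coeff g (idx j) = 0" for j by (simp add: vec_eq_iff)
      obtain j where "idx j = 4" using idx_surj[of 4] by auto
      then have "lead_coeff g = 0" using z[of j] degg by simp
      then show False using g0 by simp
    qed
    moreover have "M *v w - a *s w = op p"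
    proof -
      have "op p = op (pCons 0 g) - a *s op g"
        by (simp add: op_def g vec_eq_iff sum_subtractf[symmetric] sum_distrib_left algebra_simps)
      moreover have "op (pCons 0 g) = M *v w"
      proof -
        have "op (pCons 0 g) = (\<Sum>k\<le>4. coeff g k *s mpow M (Suc k) x0)"
          unfolding op_def by (simp add: sum_le_5(2))
        also have "\<dots> = M *v (\<Sum>k\<le>4. coeff g k *s mpow M k x0)"
          by (simp add: mpow_Suc matrix_vector_mult_sum vector_scalar_commute)
        finally show ?thesis by (simp add: w_def op_def gc sum_le_5(1))
      qed
      ultimately show ?thesis by (simp add: w_def)
    qed
    moreover have "op p = 0"
    proof -
      have "op p = (\<Sum>k\<le>4. coeff p k *s mpow M k x0) + s *s mpow M 5 x0"
        by (simp add: op_def p_def coeff_cpoly sum_le_5(1))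
      also have "(\<Sum>k\<le>4. coeff p k *s mpow M k x0) = - (krylov M x0 *v c)"
        unfolding krylov_mult sum_idx[symmetric] by (simp add: p_def coeff_cpoly sum_negf)
      finally show ?thesis using c by simp
    qed
    ultimately show ?thesis by (intro exI[of _ w]) simp
  qed
  have "rsquarefree p"
    unfolding rsquarefree_roots
  proof (intro allI notI)
    fix a assume a: "poly p a = 0 \<and> poly (pderiv p) a = 0"
    then obtain w where w: "w \<noteq> 0" "M *v w = a *s w" using eigvec by blast
    have "deriv_at s c M *v w = 0" using deriv_at_eigen[OF w(2), of s c] a by (simp add: p_def)
    then show False using w(1) R unfolding det_nonzero_iff by blast
  qed
  then have "p = smult (lead_coeff p) (\<Prod>z | poly p z = 0. [:- z, 1:])"
    using complex_poly_decompose_rsquarefree by metis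
  then have "degree p = degree (\<Prod>z | poly p z = 0. [:- z, 1:])"
    using p0 by (metis degree_smult_eq leading_coeff_0_iff)
  also have "\<dots> = card {z. poly p z = 0}"
    by (subst degree_prod_eq_sum_degree) auto
  finally have "card {z. poly p z = 0} = CARD(4 option)" using deg by simp
  then obtain l where l: "bij_betw l (UNIV :: 4 option set) {z. poly p z = 0}"
    using finite_same_card_bij[of "UNIV :: 4 option set"] poly_roots_finite[OF p0] by auto
  have "\<forall>i. \<exists>w. w \<noteq> 0 \<and> M *v w = l i *s w"
  proof
    fix i
    have "l i \<in> {z. poly p z = 0}" using l by (auto simp: bij_betw_def)
    then show "\<exists>w. w \<noteq> 0 \<and> M *v w = l i *s w" using eigvec by simp
  qed
  then obtain w where "\<And>i. w i \<noteq> 0 \<and> M *v w i = l i *s w i" by metis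
  then show ?thesis using that[of l w] l by (simp add: bij_betw_def)
qed

lemma poly_degree4_zero:
  fixes f :: "complex poly" and l :: "4 option \<Rightarrow> complex"
  assumes "inj l" "\<And>i. poly f (l i) = 0" "degree f < 5"
  shows "f = 0"
proof (rule ccontr)
  assume "f \<noteq> 0"
  then have "card {z. poly f z = 0} \<le> degree f" by (rule card_poly_roots_bound)
  moreover have "card (range l) \<le> card {z. poly f z = 0}"
    using assms \<open>f \<noteq> 0\<close> by (intro card_mono poly_roots_finite) auto
  moreover have "card (range l) = 5" using card_image[OF assms(1)] by simp
  ultimately show False using assms(3) by simp
qed

text \<open>A converse of the preceding construction, used to see that the determinants are nonzero
  at \<open>base\<close>. The Krylov part is a Vandermonde argument; for the derivative,
  \<open>cpoly s c\<close> is identified with \<open>s\<close> times the product of the X -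
  \<open>l i\<close>.\<close>

lemma eigenvectors_cyclic:
  fixes w :: "4 option \<Rightarrow> complex ^ 4 option"
  assumes l: "inj l" and eig: "\<And>i. M *v w i = l i *s w i" and w: "\<And>i. w i \<noteq> 0"
    and x0: "x0 = colsum w t" "\<And>i. t $ i \<noteq> 0"
  shows "det (krylov M x0) \<noteq> 0"
    and "s \<noteq> 0 \<Longrightarrow> s *s mpow M 5 x0 = krylov M x0 *v c \<Longrightarrow> det (deriv_at s c M) \<noteq> 0"
proof -
  have ind: "u = 0" if "colsum w u = 0" for u
    by (rule distinct_eigenvectors_independent[OF eig l w that])
  have kry: "krylov M x0 *v c = colsum w (\<chi> i. t $ i * (\<Sum>k\<in>UNIV. c $ k * l i ^ idx k))" for c
    unfolding krylov_mult x0 mpow_colsum[OF eig]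
    by (simp add: colsum_def vec_eq_iff sum_distrib_left sum_distrib_right mult_ac) (intro allI sum.swap)
  have "c = 0" if "krylov M x0 *v c = 0" for c
  proof -
    define f where "f = (\<Sum>k\<in>UNIV. monom (c $ k) (idx k))"
    have "(\<chi> i. t $ i * (\<Sum>k\<in>UNIV. c $ k * l i ^ idx k)) = 0"
      using that unfolding kry by (rule ind)
    then have "poly f (l i) = 0" for i
      using x0(2) by (simp add: vec_eq_iff f_def poly_sum poly_monom)
    moreover have "degree f < 5"
      unfolding f_def by (rule degree_sum_less) (auto simp: degree_monom_eq idx_le le_imp_less_Suc
          intro!: le_less_trans[OF degree_monom_le] le_less_trans[OF idx_le])
    ultimately have "f = 0" using poly_degree4_zero[OF l] by blast
    moreover have "f = - cpoly 0 c" by (simp add: f_def cpoly_def)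
    ultimately have "cpoly 0 c = 0" by simp
    then show "c = 0" using coeff_cpoly(1)[of 0 c] by (simp add: vec_eq_iff)
  qed
  then show "det (krylov M x0) \<noteq> 0" unfolding det_nonzero_iff by blast
  assume s: "s \<noteq> 0" and c: "s *s mpow M 5 x0 = krylov M x0 *v c"
  define p where "p = cpoly s c"
  have "colsum w (\<chi> i. t $ i * poly p (l i)) = s *s mpow M 5 x0 - krylov M x0 *v c"
    unfolding kry unfolding x0 mpow_colsum[OF eig] p_def poly_cpoly
    by (simp add: colsum_def vec_eq_iff sum_distrib_left sum_subtractf[symmetric] algebra_simps)
  then have "colsum w (\<chi> i. t $ i * poly p (l i)) = 0" unfolding c diff_self .
  then have "(\<chi> i. t $ i * poly p (l i)) = 0" by (rule ind)
  then have root: "poly p (l i) = 0" for i using x0(2) by (simp add: vec_eq_iff)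
  define g where "g = smult s (\<Prod>i\<in>UNIV. [:- l i, 1:])"
  have degg: "degree g = 5" unfolding g_def using s by (simp add: degree_prod_eq_sum_degree)
  have lead: "coeff g 5 = s"
  proof -
    have "lead_coeff g = s" by (simp add: g_def lead_coeff_smult lead_coeff_prod)
    then show ?thesis by (simp add: degg)
  qed
  \<comment> \<open>Both have degree 5 and leading coefficient \<open>s\<close>, so their difference
    is too small for five zeros.\<close>
  have "degree (p - g) < 5"
  proof -
    have "degree (p - g) \<le> 4"
    proof (rule degree_le, intro allI impI)
      fix n :: nat assume "4 < n"
      then show "coeff (p - g) n = 0"
        using degg lead by (cases "n = 5") (auto simp: p_def coeff_cpoly coeff_eq_0)
    qed
    then show ?thesis by simp
  qed
  moreover have "poly (p - g) (l i) = 0" for i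
    by (simp add: root g_def poly_prod) (metis (mono_tags, lifting) add_cancel_right_left finite prod_zero UNIV_I ab_left_minus)
  ultimately have pg: "p = g" using poly_degree4_zero[OF l, of "p - g"] by simp
  have dp: "poly (pderiv p) (l i) \<noteq> 0" for i
  proof -
    have "g = smult s ([:- l i, 1:] * (\<Prod>j\<in>UNIV - {i}. [:- l j, 1:]))"
      unfolding g_def by (subst prod.remove[of UNIV i]) auto
    then have "pderiv g = smult s ((\<Prod>j\<in>UNIV - {i}. [:- l j, 1:]) + [:- l i, 1:] * pderiv (\<Prod>j\<in>UNIV - {i}. [:- l j, 1:]))"
      by (simp only: pderiv_smult pderiv_mult) (simp add: pderiv_pCons add.commute)
    then have "poly (pderiv g) (l i) = s * (\<Prod>j\<in>UNIV - {i}. l i - l j)"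
      by (simp add: poly_prod)
    then show ?thesis using s l by (auto simp: inj_eq pg)
  qed
  have "x = 0" if x: "deriv_at s c M *v x = 0" for x
  proof -
    obtain u where u: "x = colsum w u" using colsum_surj(2)[OF ind] by blast
    have "deriv_at s c M *v x = colsum w (\<chi> i. u $ i * poly (pderiv p) (l i))"
      unfolding u colsum_def by (simp add: matrix_vector_mult_sum vector_scalar_commute deriv_at_eigen[OF eig] p_def vector_smult_assoc)
    then have "colsum w (\<chi> i. u $ i * poly (pderiv p) (l i)) = 0" unfolding x by (rule sym)
    then have "(\<chi> i. u $ i * poly (pderiv p) (l i)) = 0" by (rule ind)
    then have "u = 0" using dp by (simp add: vec_eq_iff)
    then show ?thesis by (simp add: u colsum_def)
  qed
  then show "det (deriv_at s c M) \<noteq> 0" unfolding det_nonzero_iff by blast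
qed

subsection \<open>The five points as common eigenvectors\<close>

lemma quad_lambda_add: "quad A (\<chi> a b. f a b + g a b) i j k l = quad A (\<chi> a b. f a b) i j k l + quad A (\<chi> a b. g a b) i j k l"
  by (simp add: quad_def algebra_simps sum.distrib)

lemma quad_lambda_scale: "quad A (\<chi> a b. c * f a b) i j k l = c * quad A (\<chi> a b. f a b) i j k l"
  by (simp add: quad_def sum_distrib_left mult_ac)

lemma quad_lambda_sum: "quad A (\<chi> a b. \<Sum>m\<in>S. f m a b) i j k l = (\<Sum>m\<in>S. quad A (\<chi> a b. f m a b) i j k l)"
proof (induction S rule: infinite_finite_induct)
  case (insert m S) then show ?case by (simp add: quad_lambda_add)
qed (simp_all add: quad_def)

lemma vec_nth_eta2: "(\<chi> a b. Q $ a $ b) = Q"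
  by (simp add: vec_eq_iff)

text \<open>Weights of the combination \<open>M\<close> of the \<open>T A r\<close>. That they are
  distinct and nonzero separates the five eigenvalues at \<open>base\<close>.\<close>

definition rho :: "4 \<Rightarrow> complex" where
  "rho r = (if r = 1 then 1 else if r = 2 then 2 else if r = 3 then 3 else 4)"

lemma inj_rho: "inj rho" and rho_nonzero: "rho r \<noteq> 0"
proof -
  have "\<forall>r s. rho r = rho s \<longrightarrow> r = s" unfolding forall_4 by (simp add: rho_def)
  then show "inj rho" by (simp add: inj_def)
qed (simp add: rho_def)

definition affine_part :: "complex ^ 4 option \<Rightarrow> complex ^ 4" where
  "affine_part v = (\<chi> m. v $ Some m)"

definition embed :: "complex ^ 4 \<Rightarrow> complex ^ 4 option" where
  "embed x = (\<chi> i. case i of None \<Rightarrow> 0 | Some m \<Rightarrow> x $ m)"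

lemma affine_part_embed: "affine_part (embed x) = x" and embed_None: "embed x $ None = 0"
  by (simp_all add: affine_part_def embed_def vec_eq_iff)

lemma embed_affine_part: "v $ None = 0 \<Longrightarrow> embed (affine_part v) = v"
  by (simp add: affine_part_def embed_def vec_eq_iff split_option_all)

context solution
begin

text \<open>Coordinates on W5: the \<open>None\<close> coordinate belongs to \<beta>, and the
  hyperplane where it vanishes parametrizes the image of the tensor.\<close>

definition L :: "tensor \<Rightarrow> complex ^ 4 option \<Rightarrow> complex ^ 6 ^ 6" where
  "L A v = mscale (v $ None) (\<beta> A) + lin_map A (affine_part v)"

lemma L_add: "L A (v + w) = L A v + L A w"
proof -
  have "affine_part (v + w) = affine_part v + affine_part w" by (simp add: affine_part_def vec_eq_iff)
  then show ?thesis by (simp add: L_def lin_map_add mat.scale_left_distrib)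
qed

lemma L_scale: "L A (c *s v) = mscale c (L A v)"
proof -
  have "affine_part (c *s v) = c *s affine_part v" by (simp add: affine_part_def vec_eq_iff)
  then show ?thesis by (simp add: L_def lin_map_scale mat.scale_right_distrib)
qed

lemma L_sum: "L A (\<Sum>i\<in>S. f i) = (\<Sum>i\<in>S. L A (f i))"
proof (induction S rule: infinite_finite_induct)
  have "L A (0 *s 0) = mscale 0 (L A 0)" by (rule L_scale)
  then have z: "L A 0 = 0" by simp
  { case (infinite S) then show ?case by (simp add: z) }
  { case empty then show ?case by (simp add: z) }
next
  case (insert i S) then show ?case by (simp add: L_add)
qed

lemma L_embed: "L A (embed x) = lin_map A x"
  by (simp add: L_def affine_part_embed embed_None)

text \<open>Since \<open>quad_inj A\<close> holds, the vanishing of \<open>star (L A v) (L A v)\<close> for \<open>v $ None = 1\<close> means that the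
  products of the other coordinates of \<open>v\<close> are certain affine linear functions of \<open>v\<close>. The matrix
  \<open>T A r\<close> is multiplication by the coordinate \<open>Some r\<close> according to this rule, times \<open>d A\<close>.\<close>

definition T :: "tensor \<Rightarrow> 4 \<Rightarrow> complex ^ 4 option ^ 4 option" where
  "T A r = (\<chi> i j. case i of
      None \<Rightarrow> (case j of None \<Rightarrow> 0 | Some m \<Rightarrow> if m = r then d A else 0)
    | Some a \<Rightarrow> (case j of None \<Rightarrow> - q0 A $ a $ r | Some m \<Rightarrow> - 2 * d A * q A m $ a $ r))"

lemma T_None: "(T A r *v v) $ None = d A * v $ Some r"
  by (simp add: T_def matrix_vector_mult_def sum_option if_distrib[of "\<lambda>x. x * _"] cong: if_cong)

lemma T_Some: "(T A r *v v) $ Some a = - q0 A $ a $ r * v $ None - 2 * d A * (\<Sum>m\<in>UNIV. v $ Some m * q A m $ a $ r)"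
  by (simp add: T_def matrix_vector_mult_def sum_option sum_distrib_left sum_negf mult_ac)

lemma polynomial_T: "polynomial (\<lambda>A. T A r $ i $ j)"
  unfolding T_def
  by (cases i; cases j) (auto intro!: polynomial_intros polynomial_d polynomial_q polynomial_q0)

text \<open>The square of \<open>L A v\<close> has three parts: \<open>q0\<close> expresses that of
  \<beta>, \<open>q\<close> the mixed one, whence the factor 2 in \<open>T\<close>, and the last one
  is a product in W4 already.\<close>

lemma star_L:
  assumes skew: "\<And>k. A $ k \<in> wedge2" and dA: "d A \<noteq> 0"
  shows "d A * star (L A v) (L A v) i j k l =
    quad A (\<chi> a r. d A * v $ Some a * v $ Some r - v $ None * (T A r *v v) $ Some a) i j k l"
proof -
  let ?w = "affine_part v"
  have sol: "\<And>m i j k l. star (\<beta> A) (A $ m) i j k l = quad A (q A m) i j k l"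
    "\<And>i j k l. d A * star (\<beta> A) (\<beta> A) i j k l = quad A (q0 A) i j k l"
    using solved[OF skew dA] by auto
  have bl: "star (\<beta> A) (lin_map A ?w) i j k l = quad A (\<chi> a r. \<Sum>m\<in>UNIV. v $ Some m * q A m $ a $ r) i j k l"
    unfolding quad_lambda_sum quad_lambda_scale vec_nth_eta2 sol(1)[symmetric]
    by (simp add: lin_map_def star_sum_right star_scale_right affine_part_def)
  have ll: "star (lin_map A ?w) (lin_map A ?w) i j k l = quad A (\<chi> a r. v $ Some a * v $ Some r) i j k l"
    unfolding star_lin_map by (simp add: affine_part_def)
  have "quad A (\<chi> a r. d A * v $ Some a * v $ Some r - v $ None * (T A r *v v) $ Some a) i j k l =
    quad A (\<chi> a r. d A * (v $ Some a * v $ Some r) + ((v $ None)\<^sup>2 * q0 A $ a $ r +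
      (2 * d A * v $ None) * (\<Sum>m\<in>UNIV. v $ Some m * q A m $ a $ r))) i j k l"
    unfolding T_Some by (simp add: algebra_simps power2_eq_square)
  also have "\<dots> = d A * star (lin_map A ?w) (lin_map A ?w) i j k l + ((v $ None)\<^sup>2 * (d A * star (\<beta> A) (\<beta> A) i j k l)
      + (2 * d A * v $ None) * star (\<beta> A) (lin_map A ?w) i j k l)"
    unfolding quad_lambda_add quad_lambda_scale bl ll sol(2) vec_nth_eta2 ..
  also have "\<dots> = d A * star (L A v) (L A v) i j k l"
    unfolding L_def
    by (simp add: star_add_left star_add_right star_scale_left star_scale_right
        star_commute[of "lin_map A ?w" "\<beta> A"] algebra_simps power2_eq_square)
  finally show ?thesis by simp
qed

text \<open>By \<open>quad_inj\<close> the square vanishes only if its matrix does. The entries of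
  this matrix are the \<open>Some\<close> components of the eigenvector equation; the
  \<open>None\<close> component holds identically by \<open>T_None\<close>.\<close>

lemma decomposable_iff:
  assumes skew: "\<And>k. A $ k \<in> wedge2" and dA: "d A \<noteq> 0"
  shows "(\<forall>i j k l. star (L A v) (L A v) i j k l = 0) \<longleftrightarrow>
    (\<forall>r. v $ None *s (T A r *v v) = (d A * v $ Some r) *s v)" (is "?l \<longleftrightarrow> ?r")
proof -
  define Q where "Q = (\<chi> a r. d A * v $ Some a * v $ Some r - v $ None * (T A r *v v) $ Some a)"
  have qsym: "q A m $ a $ b = q A m $ b $ a" "q0 A $ a $ b = q0 A $ b $ a" for m a b
    using solved[OF skew dA] by blast+
  have "Q $ a $ b = Q $ b $ a" for a b
    unfolding Q_def T_Some by (simp add: qsym(1)[of _ b a] qsym(2)[of b a] mult_ac)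
  moreover have "quad_inj A" using solved[OF skew dA] by blast
  moreover have "star (L A v) (L A v) i j k l = 0 \<longleftrightarrow> quad A Q i j k l = 0" for i j k l
    unfolding Q_def star_L[OF skew dA, symmetric] using dA by simp
  ultimately have "?l \<longleftrightarrow> Q = 0"
    unfolding quad_inj_def by (auto simp: quad_def)
  also have "\<dots> \<longleftrightarrow> (\<forall>a r. v $ None * (T A r *v v) $ Some a = d A * v $ Some r * v $ Some a)"
  proof -
    have "Q $ a $ r = 0 \<longleftrightarrow> v $ None * (T A r *v v) $ Some a = d A * v $ Some r * v $ Some a" for a r
      by (auto simp: Q_def mult_ac)
    then show ?thesis by (simp add: vec_eq_iff)
  qed
  also have "\<dots> \<longleftrightarrow> ?r"
    by (auto simp: vec_eq_iff split_option_all T_None)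
  finally show ?thesis .
qed

definition ell_matrix :: "tensor \<Rightarrow> complex ^ 4 option ^ 4 option" where
  "ell_matrix A = matrix (\<lambda>v. ell (L A v))"

text \<open>Nonvanishing says that \<open>ell\<close> maps the span of \<beta> and the image
  isomorphically to quintuples.\<close>

definition \<delta>0 :: "tensor \<Rightarrow> complex" where
  "\<delta>0 A = det (ell_matrix A)"

lemma ell_matrix_mult: "ell_matrix A *v v = ell (L A v)"
  unfolding ell_matrix_def
  by (rule matrix_works) (simp add: Vector_Spaces.linear_iff L_add L_scale ell_add ell_scale vec.vector_space_axioms)

lemma polynomial_\<delta>0: "polynomial \<delta>0"
  unfolding \<delta>0_def ell_matrix_def matrix_def
  by (intro polynomial_det) (simp add: L_def lin_map_def mscale_def, intro polynomial_ell,
      simp, intro polynomial_intros polynomial_\<beta>)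

lemma L_inj:
  assumes "\<delta>0 A \<noteq> 0" "L A v = 0" shows "v = 0"
proof -
  have "ell_matrix A *v v = 0" unfolding ell_matrix_mult assms(2) by (simp add: ell_def vec_eq_iff split: option.split)
  then show ?thesis using assms(1) unfolding \<delta>0_def det_nonzero_iff by blast
qed

text \<open>At \<open>v $ None = 0\<close> the equations say that every coordinate of
  \<open>v\<close> times \<open>v\<close> is zero.\<close>

lemma None_nonzero:
  assumes "d A \<noteq> 0" "\<And>r. v $ None *s (T A r *v v) = (d A * v $ Some r) *s v" "v \<noteq> 0"
  shows "v $ None \<noteq> 0"
proof
  assume "v $ None = 0"
  then have "v $ Some r = 0" for r using assms(2)[of r] assms(1,3) by simp
  then show False using assms(3) \<open>v $ None = 0\<close> by (simp add: vec_eq_iff split_option_all)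
qed

text \<open>The preimages of the five lines under \<open>L A\<close> form a basis of common
  eigenvectors. The map \<open>R\<close> sends \<open>v\<close> to the coordinates of
  \<open>L A v\<close> with respect to the lines; it is an isomorphism, which provides these
  preimages.\<close>

lemma T_commute_five_lines:
  fixes a b G
  defines "A \<equiv> five_lines a b G"
  assumes d: "d A \<noteq> 0" and \<delta>0: "\<delta>0 A \<noteq> 0"
  shows "T A r ** T A s = T A s ** T A r"
proof -
  have skew: "\<And>k. A $ k \<in> wedge2" by (simp add: A_def five_lines_wedge2)
  note sol = solved[OF skew d]
  interpret P: pentad A "\<lambda>i. wedge (a $ i) (b $ i)" G
    using sol unfolding A_def by (intro pentad_five_lines) blast
  let ?y = "\<lambda>i. wedge (a $ i) (b $ i)"
  have "\<forall>v. \<exists>t. L A v = span5 ?y t"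
  proof
    fix v
    have "in_quad A (star (\<beta> A) (A $ m))" for m
      unfolding in_quad_def by (rule exI[of _ "q A m"]) (use sol in blast)
    then obtain t1 where t1: "\<beta> A = span5 ?y t1"
      using P.solution_in_span5 sol by blast
    obtain t2 where "lin_map A (affine_part v) = span5 ?y t2" by (rule P.lin_map_span5)
    then have "L A v = span5 ?y (v $ None *s t1 + t2)"
      unfolding L_def t1 by (simp add: span5_add span5_scale)
    then show "\<exists>t. L A v = span5 ?y t" ..
  qed
  then obtain R where R: "\<And>v. L A v = span5 ?y (R v)" by metis
  have y_inj: "s = t" if "span5 ?y s = span5 ?y t" for s t
    using P.independent_y[of "s - t"] that by (simp add: span5_diff)
  have lin: "Vector_Spaces.linear (*s) (*s) R"
    unfolding Vector_Spaces.linear_iff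
  proof (intro conjI allI vec.vector_space_axioms)
    show "R (v + w) = R v + R w" for v w by (rule y_inj) (simp add: span5_add R[symmetric] L_add)
    show "R (c *s v) = c *s R v" for c v by (rule y_inj) (simp add: span5_scale R[symmetric] L_scale)
  qed
  have "inj R"
  proof (rule linear_inj_kernel[OF lin])
    fix v assume "R v = 0"
    then have "L A v = 0" by (simp add: R span5_def)
    then show "v = 0" by (rule L_inj[OF \<delta>0])
  qed
  then have "surj R" using vec.linear_injective_imp_surjective[OF lin] by blast
  then have "\<forall>i. \<exists>v. R v = axis i 1" by (metis surjD)
  then obtain v where v: "\<And>i. R (v i) = axis i 1" by metis
  then have Lv: "L A (v i) = ?y i" for i by (simp add: R span5_axis)
  have eig: "v i $ None *s (T A r *v v i) = (d A * v i $ Some r) *s v i" for i r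
    using decomposable_iff[OF skew d, of "v i"] unfolding Lv by (simp add: star_wedge)
  have v0: "v i \<noteq> 0" for i
  proof
    assume "v i = 0"
    then have "axis i 1 = R (0 *s 0)" using v[of i] by simp
    then show False using linear_scale_vec[OF lin, of 0 0] by (simp add: axis_eq_0_iff)
  qed
  then have "v i $ None \<noteq> 0" for i using None_nonzero[OF d eig] by blast
  then have eig': "T A r *v v i = (d A * v i $ Some r / v i $ None) *s v i" for i r
    using eig[of i r] by (simp add: vec_eq_iff field_simps)
  have comm: "(T A r ** T A s) *v v i = (T A s ** T A r) *v v i" for i
    by (simp add: matrix_vector_mul_assoc[symmetric] eig' vector_scalar_commute vector_smult_assoc mult.commute)
  have span: "colsum v (R x) = x" for x
  proof -
    have "R (\<Sum>i\<in>S. f i) = (\<Sum>i\<in>S. R (f i))" for f and S :: "4 option set"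
      by (rule vec.linear_sum[OF lin])
    then have "R (colsum v (R x)) = (\<Sum>i\<in>UNIV. R x $ i *s axis i 1)"
      unfolding colsum_def by (simp add: linear_scale_vec[OF lin] v)
    then have "R (colsum v (R x)) = R x" by (simp add: axis_expand)
    then show ?thesis using \<open>inj R\<close> by (metis injD)
  qed
  have expand: "N *v colsum v t = (\<Sum>i\<in>UNIV. t $ i *s (N *v v i))" for N :: "complex ^ 4 option ^ 4 option" and t
    by (simp add: colsum_def matrix_vector_mult_sum vector_scalar_commute)
  have "(T A r ** T A s) *v colsum v (R x) = (T A s ** T A r) *v colsum v (R x)" for x
    unfolding expand comm ..
  then have "(T A r ** T A s) *v x = (T A s ** T A r) *v x" for x
    unfolding span .
  then show ?thesis by (simp add: matrix_eq)
qed

lemma T_commute: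
  assumes skew: "\<And>k. A $ k \<in> wedge2" and d: "d A \<noteq> 0" and \<delta>0: "\<delta>0 A \<noteq> 0"
  shows "T A r ** T A s = T A s ** T A r"
proof -
  have "(T A r ** T A s) $ i $ j - (T A s ** T A r) $ i $ j = 0" for i j
  proof (rule five_lines_identity[where f = "\<lambda>A. d A * \<delta>0 A" and
        g = "\<lambda>A. (T A r ** T A s) $ i $ j - (T A s ** T A r) $ i $ j"])
    show "d A * \<delta>0 A \<noteq> 0" using d \<delta>0 by simp
  qed (use T_commute_five_lines in \<open>auto intro!: polynomial_intros polynomial_d polynomial_\<delta>0
      polynomial_matrix_mult polynomial_T skew\<close>)
  then show ?thesis by (simp add: vec_eq_iff)
qed

definition M :: "tensor \<Rightarrow> complex ^ 4 option ^ 4 option" where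
  "M A = (\<chi> i j. \<Sum>r\<in>UNIV. rho r * T A r $ i $ j)"

lemma M_mult: "M A *v v = (\<Sum>r\<in>UNIV. rho r *s (T A r *v v))"
  by (simp add: M_def vec_eq_iff matrix_vector_mult_def sum_distrib_left sum_distrib_right mult.assoc)
    (intro allI sum.swap)

lemma polynomial_M: "polynomial (\<lambda>A. M A $ i $ j)"
  unfolding M_def by (simp, intro polynomial_intros polynomial_T)

lemma M_commute:
  assumes "\<And>k. A $ k \<in> wedge2" "d A \<noteq> 0" "\<delta>0 A \<noteq> 0"
  shows "M A *v (T A s *v v) = T A s *v (M A *v v)"
  unfolding M_mult
  unfolding matrix_vector_mult_sum vector_scalar_commute
  unfolding matrix_vector_mul_assoc T_commute[OF assms, of _ s] ..

lemma polynomial_mpow: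
  assumes "\<And>i. polynomial (\<lambda>A. x A $ i)"
  shows "polynomial (\<lambda>A. mpow (M A) k (x A) $ i)"
proof (induction k arbitrary: i)
  case (Suc k)
  show ?case unfolding mpow_Suc by (intro polynomial_matrix_vector_mult polynomial_M Suc)
qed (simp add: assms)

text \<open>The coordinate vector of \<beta>. At \<open>base\<close>, \<beta> is a nonzero multiple
  of the sum of the five lines, so no eigenvector coordinate vanishes and the vector is
  cyclic.\<close>

definition x0 :: "complex ^ 4 option" where
  "x0 = axis None 1"

definition \<delta>1 :: "tensor \<Rightarrow> complex" where
  "\<delta>1 A = det (krylov (M A) x0)"

definition cramer :: "tensor \<Rightarrow> complex ^ 4 option" where
  "cramer A = (\<chi> k. det (\<chi> i j. if j = k then mpow (M A) 5 x0 $ i else krylov (M A) x0 $ i $ j))"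

definition \<delta>2 :: "tensor \<Rightarrow> complex" where
  "\<delta>2 A = det (deriv_at (\<delta>1 A) (cramer A) (M A))"

lemma polynomial_krylov: "polynomial (\<lambda>A. krylov (M A) x0 $ i $ j)"
  unfolding krylov_def by (simp, intro polynomial_mpow polynomial.const)

lemma polynomial_\<delta>1: "polynomial \<delta>1"
  unfolding \<delta>1_def by (intro polynomial_det polynomial_krylov)

lemma polynomial_cramer: "polynomial (\<lambda>A. cramer A $ k)"
  unfolding cramer_def
  by (simp, intro polynomial_det, simp, intro polynomial_if polynomial_mpow polynomial_krylov polynomial.const)

lemma polynomial_\<delta>2: "polynomial \<delta>2"
  unfolding \<delta>2_def deriv_at_def
  by (intro polynomial_det, simp, intro polynomial_intros polynomial_mpow polynomial_cramer polynomial_\<delta>1)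

lemma cramer_eq:
  assumes "\<delta>1 A \<noteq> 0"
  shows "\<delta>1 A *s mpow (M A) 5 x0 = krylov (M A) x0 *v cramer A"
proof -
  have "invertible (krylov (M A) x0)" using assms by (simp add: \<delta>1_def invertible_det_nz)
  then obtain N where "krylov (M A) x0 ** N = mat 1" by (auto simp: invertible_def)
  then obtain c where c: "mpow (M A) 5 x0 = krylov (M A) x0 *v c"
    by (metis matrix_vector_mul_assoc matrix_vector_mul_lid)
  have "cramer A $ k = c $ k * \<delta>1 A" for k
    unfolding cramer_def c \<delta>1_def by (simp only: vec_lambda_beta cramer_lemma)
  then have "cramer A = \<delta>1 A *s c" by (simp add: vec_eq_iff mult.commute)
  then show ?thesis by (simp add: c vector_scalar_commute)
qed

definition F :: "tensor \<Rightarrow> complex" where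
  "F A = d A * \<delta>0 A * \<delta>1 A * \<delta>2 A"

lemma polynomial_F: "polynomial F"
  unfolding F_def by (intro polynomial_intros polynomial_d polynomial_\<delta>0 polynomial_\<delta>1 polynomial_\<delta>2)

lemma base_wedge2: "base $ k \<in> wedge2"
  by (simp add: base_def five_lines_wedge2)

lemma F_base: "F base \<noteq> 0"
proof -
  note sol = solved[OF base_wedge2 d_base]
  interpret P: pentad base line_y "mat 1"
  proof
    show "quad_inj base" by (rule quad_inj_base)
  qed (simp_all add: line_y_def wedge_in_wedge2 star_wedge base_def five_lines_def)
  define u where "u = e base"
  have u: "u \<noteq> 0" using sol by (simp add: u_def)
  have ell_span5: "ell (span5 line_y t) = t" for t
  proof -
    have z: "ell 0 = 0" by (simp add: ell_def vec_eq_iff split: option.split)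
    have "ell (\<Sum>i\<in>S. mscale (t $ i) (line_y i)) = (\<Sum>i\<in>S. t $ i *s axis i 1)" for S :: "4 option set"
      by (induction S rule: infinite_finite_induct) (simp_all add: z ell_add ell_scale ell_line_y)
    then show ?thesis by (simp add: span5_def axis_expand)
  qed
  have "in_quad base (star (\<beta> base) (base $ m))" for m
    unfolding in_quad_def by (rule exI[of _ "q base m"]) (use sol in blast)
  then obtain t where "\<beta> base = span5 line_y t"
    using P.solution_in_span5 sol by blast
  moreover from this have "t = (\<chi> i. u)" using sol ell_span5[of t] by (simp add: u_def)
  ultimately have \<beta>: "\<beta> base = (\<Sum>i\<in>UNIV. mscale u (line_y i))" by (simp add: span5_def)
  \<comment> \<open>Preimages of the lines: \<open>line_y i\<close> is 1/5 of the sum of all lines,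
    which is \<beta> divided by \<open>u\<close>, plus 1/5 of the sum of its differences to the
    other lines, which lies in the image.\<close>
  define w where "w i = (\<chi> j. case j of None \<Rightarrow> 1 / (5 * u) | Some m \<Rightarrow> (if i = Some m then 1 else 0) - 1 / 5)"
    for i :: "4 option"
  have L_eq: "L base v = mscale (v $ None * u - (\<Sum>m\<in>UNIV. v $ Some m)) (line_y None)
      + (\<Sum>m\<in>UNIV. mscale (v $ None * u + v $ Some m) (line_y (Some m)))" for v
    by (simp add: L_def \<beta> lin_map_def affine_part_def base_nth sum_option vec_eq_iff mscale_def
        sum.distrib sum_subtractf sum_distrib_left sum_distrib_right algebra_simps)
  have Lw: "L base (w i) = line_y i" for i
  proof (cases i)
    case None
    have "L base (w i) = mscale 1 (line_y None) + (\<Sum>m\<in>UNIV. mscale 0 (line_y (Some m)))"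
      unfolding L_eq using u by (simp add: w_def None field_simps)
    then show ?thesis by (simp add: None)
  next
    case (Some k)
    have s: "(\<Sum>m\<in>UNIV. (if k = m then 1 else 0) - 1 / 5 :: complex) = 1 / 5"
      by (simp add: sum_subtractf)
    have "L base (w i) = mscale 0 (line_y None) + (\<Sum>m\<in>UNIV. if m = k then line_y (Some m) else 0)"
      unfolding L_eq using u s by (intro arg_cong2[of _ _ _ _ "(+)"] sum.cong arg_cong2[of _ _ _ _ mscale])
        (auto simp: w_def Some)
    then show ?thesis by (simp add: Some)
  qed
  have wN: "w i $ None = 1 / (5 * u)" for i by (simp add: w_def)
  have w0: "w i \<noteq> 0" for i using wN[of i] u by auto
  have "w i $ None *s (T base r *v w i) = (d base * w i $ Some r) *s w i" for i r
    using decomposable_iff[OF base_wedge2 d_base, of "w i"] unfolding Lw by (simp add: line_y_def star_wedge)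
  then have Tw: "T base r *v w i = (5 * u * d base * w i $ Some r) *s w i" for i r
    using u unfolding wN by (simp add: vec_eq_iff field_simps)
  define l where "l i = 5 * u * d base * (\<Sum>r\<in>UNIV. rho r * w i $ Some r)" for i
  have eig: "M base *v w i = l i *s w i" for i
    unfolding M_mult Tw l_def
    by (simp add: vec_eq_iff sum_distrib_left sum_distrib_right mult_ac)
  \<comment> \<open>All eigenvalues share this value as a common shift; the remaining parts are 0
    and \<open>5 * u * d base * rho k\<close>, hence distinct.\<close>
  have l_None: "l None = - u * d base * (\<Sum>r\<in>UNIV. rho r)"
    by (simp add: l_def w_def sum_negf sum_divide_distrib[symmetric])
  have l_Some: "l (Some k) = 5 * u * d base * rho k - u * d base * (\<Sum>r\<in>UNIV. rho r)" for k
  proof -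
    have s: "(\<Sum>r\<in>UNIV. rho r * w (Some k) $ Some r) = rho k - (\<Sum>r\<in>UNIV. rho r) / 5"
      by (simp add: w_def right_diff_distrib sum_subtractf sum_divide_distrib if_distrib[of "\<lambda>x. _ * x"] cong: if_cong)
    show ?thesis unfolding l_def s by (simp add: algebra_simps)
  qed
  have inj_l: "inj l"
  proof (rule injI)
    fix i j assume "l i = l j"
    then show "i = j"
      using u d_base rho_nonzero injD[OF inj_rho]
      by (cases i; cases j) (auto simp: l_None l_Some)
  qed
  have x0: "x0 = colsum w (\<chi> i. u)"
  proof -
    have "(\<Sum>i\<in>UNIV. (if i = Some m then 1 else 0) - 1 / 5) = (0 :: complex)" for m :: 4
      by (simp add: sum_subtractf)
    then have "(\<Sum>i\<in>UNIV. u * ((if i = Some m then 1 else 0) - 1 / 5)) = 0" for m :: 4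
      unfolding sum_distrib_left[symmetric] by simp
    then show ?thesis using u
      by (simp add: x0_def colsum_def vec_eq_iff split_option_all w_def axis_def)
  qed
  have \<delta>1: "\<delta>1 base \<noteq> 0"
    unfolding \<delta>1_def by (rule eigenvectors_cyclic(1)[OF inj_l eig w0 x0]) (simp add: u)
  have \<delta>2: "\<delta>2 base \<noteq> 0"
    unfolding \<delta>2_def by (rule eigenvectors_cyclic(2)[OF inj_l eig w0 x0 _ \<delta>1 cramer_eq[OF \<delta>1]]) (simp add: u)
  have "v = 0" if "ell_matrix base *v v = 0" for v
  proof -
    have z: "colsum w s = 0 \<Longrightarrow> s = 0" for s
      by (rule distinct_eigenvectors_independent[OF eig inj_l w0])
    obtain s where s: "v = colsum w s" using colsum_surj(2)[OF z] by blast
    have "L base v = span5 line_y s"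
      unfolding s colsum_def L_sum L_scale Lw span5_def ..
    then have "s = 0" using that unfolding ell_matrix_mult by (simp add: ell_span5)
    then show ?thesis by (simp add: s colsum_def)
  qed
  then have "\<delta>0 base \<noteq> 0"
    unfolding \<delta>0_def det_nonzero_iff by blast
  then show ?thesis using \<delta>1 \<delta>2 d_base by (simp add: F_def)
qed

text \<open>In terms of coordinates with respect to eigenvectors of \<open>M A\<close>, the Krylov determinant is the
  product of the five coordinates, up to a Vandermonde determinant.\<close>

definition quintic :: "tensor \<Rightarrow> complex ^ 4 \<Rightarrow> complex" where
  "quintic A x = det (krylov (M A) (embed x))"

lemma form_family_quintic: "form_family 5 quintic"
proof -
  have lin: "form_family 1 (\<lambda>A x. mpow (M A) k (embed x) $ i)" for k i
  proof (induction k arbitrary: i)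
    case 0
    show ?case by (cases i) (simp_all add: embed_def form_family_zero form_family_coord[simplified])
  next
    case (Suc k)
    show ?case unfolding mpow_Suc matrix_vector_mult_def
      by (simp only: vec_lambda_beta) (intro form_family_sum form_family_smult polynomial_M Suc)
  qed
  have "form_family CARD(4 option) (\<lambda>A x. det (krylov (M A) (embed x)))"
    by (intro form_family_det) (simp only: krylov_def vec_lambda_beta lin)
  then show ?thesis by (simp add: quintic_def[abs_def])
qed

text \<open>\<open>M A\<close> has simple spectrum and commutes with every \<open>T A r\<close>, so
  its eigenvectors are common eigenvectors, and these are decomposable. Conversely a decomposable
  vector is an eigenvector of every \<open>T A r\<close>, hence of \<open>M A\<close>.\<close>

lemma five_points:
  assumes skew: "\<And>k. A $ k \<in> wedge2" and F: "F A \<noteq> 0"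
  obtains v :: "4 option \<Rightarrow> complex ^ 4 option" and c
  where "\<And>i. v i $ None = 1" "\<And>x. \<exists>t. x = colsum v t" "\<And>t. colsum v t = 0 \<Longrightarrow> t = 0"
    "\<And>i a b c d. star (L A (v i)) (L A (v i)) a b c d = 0"
    "\<And>x. \<forall>a b c d. star (L A x) (L A x) a b c d = 0 \<Longrightarrow> \<exists>i s. x = s *s v i"
    "c \<noteq> 0" "\<And>x t. embed x = colsum v t \<Longrightarrow> quintic A x = c * (\<Prod>i\<in>UNIV. t $ i)"
proof -
  have nz: "d A \<noteq> 0" "\<delta>0 A \<noteq> 0" "\<delta>1 A \<noteq> 0" "\<delta>2 A \<noteq> 0" using F by (auto simp: F_def)
  have K: "det (krylov (M A) x0) \<noteq> 0" and R: "det (deriv_at (\<delta>1 A) (cramer A) (M A)) \<noteq> 0"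
    using nz(3,4) by (simp_all add: \<delta>1_def \<delta>2_def)
  obtain l :: "4 option \<Rightarrow> complex" and w where l: "inj l" and eig: "\<And>i. M A *v w i = l i *s w i" and w: "\<And>i. w i \<noteq> 0"
  proof (rule cyclic_eigenvectors[OF K nz(3) cramer_eq[OF nz(3)] R])
    fix l :: "4 option \<Rightarrow> complex" and w
    assume "inj l" "\<And>i. M A *v w i = l i *s w i" "\<And>i. w i \<noteq> 0"
    then show thesis by (rule that)
  qed
  have ind: "colsum w s = 0 \<Longrightarrow> s = 0" for s
    by (rule distinct_eigenvectors_independent[OF eig l w])
  have T_eig: "\<exists>s. T A r *v w i = s *s w i" for r i
  proof (cases "T A r *v w i = 0")
    case True
    then show ?thesis by (intro exI[of _ 0]) simp
  next
    case False
    have "M A *v (T A r *v w i) = l i *s (T A r *v w i)"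
      by (simp add: M_commute[OF skew nz(1,2)] eig vector_scalar_commute)
    then obtain j s where "l j = l i" "T A r *v w i = s *s w j"
      by (rule eigenvector_multiple[OF eig l w _ False])
    then show ?thesis using l by (auto simp: inj_eq)
  qed
  have wT: "w i $ None *s (T A r *v w i) = (d A * w i $ Some r) *s w i" for i r
  proof -
    obtain s where s: "T A r *v w i = s *s w i" using T_eig by blast
    \<comment> \<open>The \<open>None\<close> component of the eigenvector equation determines the
      eigenvalue, which turns it into the decomposability equation.\<close>
    have "d A * w i $ Some r = s * w i $ None"
      using T_None[of A r "w i"] unfolding s by simp
    then show ?thesis unfolding s by (simp add: vector_smult_assoc mult.commute)
  qed
  then have wN: "w i $ None \<noteq> 0" for i using None_nonzero[OF nz(1) _ w] by blast
  define v where "v i = (1 / w i $ None) *s w i" for i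
  have v_eig: "M A *v v i = l i *s v i" for i
    by (simp add: v_def vector_scalar_commute eig vector_smult_assoc mult.commute)
  have v0: "v i \<noteq> 0" for i using w wN by (simp add: v_def)
  have indv: "colsum v s = 0 \<Longrightarrow> s = 0" for s
    by (rule distinct_eigenvectors_independent[OF v_eig l v0])
  have dec_w: "\<forall>a b c d. star (L A (w i)) (L A (w i)) a b c d = 0" for i
    using decomposable_iff[OF skew nz(1), of "w i"] wT by blast
  \<comment> \<open>\<open>V\<close> has the eigenvectors as columns, \<open>W\<close> is the
    Vandermonde matrix of the eigenvalues.\<close>
  define V where "V = (\<chi> i j. v j $ i)"
  define W where "W = (\<chi> i j. l i ^ idx j)"
  have quint: "det (krylov (M A) (colsum v t)) = (det V * det W) * (\<Prod>i\<in>UNIV. t $ i)" for t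
  proof -
    have "krylov (M A) (colsum v t) = V ** (\<chi> i. t $ i *s W $ i)"
      unfolding krylov_def mpow_colsum[OF v_eig]
      by (simp add: V_def W_def colsum_def matrix_matrix_mult_def vec_eq_iff mult_ac)
    moreover have "det (\<chi> i. t $ i *s W $ i) = (\<Prod>i\<in>UNIV. t $ i) * det W"
      using det_rows_mul[of "\<lambda>i. t $ i" "\<lambda>i. W $ i"] by (simp add: vec_nth_eta2)
    ultimately show ?thesis by (simp add: det_mul)
  qed
  show ?thesis
  proof (rule that[of v "det V * det W"])
    show "v i $ None = 1" for i using wN by (simp add: v_def)
    show "\<exists>t. x = colsum v t" for x by (rule colsum_surj(2)[OF indv])
    show "\<And>t. colsum v t = 0 \<Longrightarrow> t = 0" by (rule indv)
    show "star (L A (v i)) (L A (v i)) a b c d = 0" for i a b c d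
      unfolding v_def L_scale star_scale_left star_scale_right using dec_w by simp
    \<comment> \<open>\<open>\<delta>1 A\<close> is the same determinant at \<open>x0\<close>, so
      its nonvanishing excludes that the constant factor is zero.\<close>
    obtain t where t: "x0 = colsum v t" using colsum_surj(2)[OF indv] by blast
    show "det V * det W \<noteq> 0" using nz(3) unfolding \<delta>1_def t quint by auto
    show "quintic A x = det V * det W * (\<Prod>i\<in>UNIV. t $ i)" if "embed x = colsum v t" for x t
      unfolding quintic_def that quint ..
    show "\<exists>i s. x = s *s v i" if dec: "\<forall>a b c d. star (L A x) (L A x) a b c d = 0" for x
    proof (cases "x = 0")
      case True
      then have "x = 0 *s v None" by simp
      then show ?thesis by blast
    next
      case False
      have xT: "x $ None *s (T A r *v x) = (d A * x $ Some r) *s x" for r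
        using decomposable_iff[OF skew nz(1), of x] dec by blast
      have xN: "x $ None \<noteq> 0" by (rule None_nonzero[OF nz(1) xT False])
      then have "T A r *v x = (d A * x $ Some r / x $ None) *s x" for r
        using xT[of r] by (simp add: vec_eq_iff field_simps)
      then have "M A *v x = (\<Sum>r\<in>UNIV. rho r * (d A * x $ Some r / x $ None)) *s x"
        unfolding M_mult by (simp add: vec_eq_iff sum_distrib_right mult.assoc)
      then show ?thesis by (metis eigenvector_multiple[OF v_eig l v0 _ False])
    qed
  qed
qed

end

subsection \<open>Linear forms and planes\<close>

lemma linear_form_scale: "linear_form (c *s l) x = c * linear_form l x"
  by (simp add: linear_form_def sum_distrib_left mult.assoc)

lemma linear_form_axis: "linear_form l (axis k 1) = l $ k"
  by (simp add: linear_form_def axis_def if_distrib[of "\<lambda>x. _ * x"] cong: if_cong)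

lemma linear_form_right: "linear_form l (x + y) = linear_form l x + linear_form l y"
  "linear_form l (c *s x) = c * linear_form l x"
  "linear_form l (x - y) = linear_form l x - linear_form l y"
  by (simp_all add: linear_form_def algebra_simps sum.distrib sum_distrib_left sum_subtractf)

lemma linear_form_left_sum: "linear_form (\<Sum>i\<in>S. s i *s l i) x = (\<Sum>i\<in>S. s i * linear_form (l i) x)"
proof (induction S rule: infinite_finite_induct)
  case (insert i S)
  have "linear_form (a + b) x = linear_form a x + linear_form b x" for a b
    by (simp add: linear_form_def algebra_simps sum.distrib)
  then show ?case using insert by (simp add: linear_form_scale)
qed (simp_all add: linear_form_def)

lemma subspace_kernel: "vec.subspace {x. linear_form l x = 0}"
  unfolding vec.subspace_def by (simp add: linear_form_right) (simp add: linear_form_def)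

lemma kernel_projection:
  assumes "l $ k \<noteq> 0"
  shows "linear_form l (x - (linear_form l x / l $ k) *s axis k 1) = 0"
  using assms by (simp add: linear_form_right linear_form_axis)

lemma is_plane_kernel:
  assumes "l \<noteq> 0"
  shows "is_plane {x. linear_form l x = 0}"
proof -
  let ?H = "{x. linear_form l x = 0}"
  obtain k where k: "l $ k \<noteq> 0" using assms by (auto simp: vec_eq_iff)
  have span: "vec.span ?H = ?H" using subspace_kernel by (simp add: vec.span_eq_iff)
  have "x \<in> vec.span (insert (axis k 1) ?H)" for x
  proof -
    let ?c = "linear_form l x / l $ k"
    have "x - ?c *s axis k 1 \<in> vec.span (insert (axis k 1) ?H)"
      using kernel_projection[OF k, of x] by (intro vec.span_base) simp
    moreover have "?c *s axis k 1 \<in> vec.span (insert (axis k 1) ?H)"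
      by (intro vec.span_scale vec.span_base) simp
    ultimately show ?thesis using vec.span_add by fastforce
  qed
  then have "vec.span (insert (axis k 1) ?H) = UNIV" by blast
  then have "vec.dim (insert (axis k 1) ?H) = CARD(4)"
    by (metis vec.dim_span vec_dim_card)
  moreover have "axis k 1 \<notin> vec.span ?H" unfolding span using k by (simp add: linear_form_axis)
  ultimately have "vec.dim ?H = 3" by (simp add: vec.dim_insert)
  then show ?thesis unfolding is_plane_def using subspace_kernel by simp
qed

lemma dual_point_kernel:
  assumes "l \<noteq> 0"
  shows "dual_point {x. linear_form l x = 0} = vec.span {l}"
proof -
  obtain k where k: "l $ k \<noteq> 0" using assms by (auto simp: vec_eq_iff)
  have "\<exists>s. m = s *s l" if m: "\<And>x. linear_form l x = 0 \<Longrightarrow> linear_form m x = 0" for m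
  proof -
    have "m $ j = (m $ k / l $ k) * l $ j" for j
      using m[OF kernel_projection[OF k, of "axis j 1"]] k
      by (simp add: linear_form_right linear_form_axis field_simps)
    then have "m = (m $ k / l $ k) *s l" unfolding vec_eq_iff vector_smult_component by blast
    then show ?thesis by blast
  qed
  then show ?thesis
    unfolding dual_point_def vec.span_singleton by (auto simp: linear_form_scale image_iff)
qed

subsection \<open>The pentahedron of a tensor\<close>

lemma inj_axis: "axis i (1 :: complex) = axis j 1 \<longleftrightarrow> i = j"
  by (simp add: axis_eq_axis)

text \<open>Comparing dimensions of nested subspaces requires a finite basis; the matrix units serve
  as one.\<close>

interpretation matf: finite_dimensional_vector_space mscale
  "range (\<lambda>(i, j). outer (axis i 1) (axis j 1))"
proof
  let ?E = "\<lambda>(i, j). outer (axis i 1) (axis j 1)"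
  have inj: "inj ?E"
    by (auto simp: inj_def outer_def vec_eq_iff axis_def)
  have expand: "(\<Sum>u\<in>UNIV. mscale (f u) (?E u)) $ i $ j = f (i, j)" for f :: "6 \<times> 6 \<Rightarrow> complex" and i j
  proof -
    have "(\<Sum>u\<in>UNIV. mscale (f u) (?E u)) $ i $ j = (\<Sum>u\<in>UNIV. if u = (i, j) then f u else 0)"
      unfolding sum_component by (intro sum.cong refl) (auto simp: mscale_def outer_def axis_def split: if_splits)
    then show ?thesis by simp
  qed
  show "finite (range ?E)" by simp
  show "mat.independent (range ?E)"
  proof (rule mat.independent_if_scalars_zero)
    fix f x assume "(\<Sum>x\<in>range ?E. mscale (f x) x) = 0" and x: "x \<in> range ?E"
    then have "(\<Sum>u\<in>UNIV. mscale (f (?E u)) (?E u)) = 0" by (simp add: sum.reindex[OF inj])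
    then have "f (?E (i, j)) = 0" for i j using expand[of "\<lambda>u. f (?E u)" i j] by simp
    then show "f x = 0" using x by auto
  qed simp
  show "mat.span (range ?E) = UNIV"
  proof -
    have "X \<in> mat.span (range ?E)" for X
    proof -
      have "(\<Sum>u\<in>UNIV. mscale (X $ fst u $ snd u) (?E u)) = X"
        using expand[of "\<lambda>u. X $ fst u $ snd u"] by (simp add: vec_eq_iff)
      moreover have "(\<Sum>u\<in>UNIV. mscale (X $ fst u $ snd u) (?E u)) \<in> mat.span (range ?E)"
        by (intro mat.span_sum mat.span_scale mat.span_base) simp
      ultimately show ?thesis by (simp only:)
    qed
    then show ?thesis by blast
  qed
qed

lemma span_range_span5: "mat.span (range y) = range (span5 y)"
proof
  have "mat.subspace (range (span5 y))"
    unfolding mat.subspace_def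
  proof (intro conjI ballI allI)
    have "0 = span5 y 0" by (simp add: span5_def)
    then show "0 \<in> range (span5 y)" by blast
    show "X + Y \<in> range (span5 y)" if "X \<in> range (span5 y)" "Y \<in> range (span5 y)" for X Y
      using that by (auto simp: span5_add[symmetric])
    show "mscale c X \<in> range (span5 y)" if "X \<in> range (span5 y)" for c X
      using that by (auto simp: span5_scale[symmetric])
  qed
  then show "mat.span (range y) \<subseteq> range (span5 y)"
    by (intro mat.span_minimal) (metis image_subsetI rangeI span5_axis)
  show "range (span5 y) \<subseteq> mat.span (range y)"
  proof clarify
    show "span5 y t \<in> mat.span (range y)" for t
      unfolding span5_def by (intro mat.span_sum mat.span_scale mat.span_base) simp
  qed
qed

lemma span_singleton_mat: "mat.span {X} = range (\<lambda>c. mscale c X)"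
  by (rule mat.span_singleton)

text \<open>\<open>\<tau> x\<close> are the coordinates of \<open>x\<close> with respect to the five points, normalized such that the
  image of the tensor is the hyperplane where they add up to zero.\<close>

locale pentahedral =
  fixes A :: tensor and y :: "4 option \<Rightarrow> complex ^ 6 ^ 6" and \<tau> :: "complex ^ 4 \<Rightarrow> complex ^ 4 option"
  assumes y_decomposable: "\<And>i. \<exists>a b. y i = wedge a b"
    and independent: "\<And>t. span5 y t = 0 \<Longrightarrow> t = 0"
    and only: "\<And>t a b. span5 y t = wedge a b \<Longrightarrow> \<exists>i s. t = s *s axis i 1"
    and lin_map_eq: "\<And>x. lin_map A x = span5 y (\<tau> x)"
    and sum_zero: "\<And>x. (\<Sum>i\<in>UNIV. \<tau> x $ i) = 0"
    and surj_\<tau>: "\<And>t. (\<Sum>i\<in>UNIV. t $ i) = 0 \<Longrightarrow> \<exists>x. \<tau> x = t"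
    and inj_lin_map: "inj (lin_map A)"
    and maximal: "\<And>u. (\<And>i. \<exists>a b. u i = wedge a b) \<Longrightarrow> (\<And>i. u i \<noteq> 0) \<Longrightarrow>
      range (lin_map A) \<subseteq> range (span5 u) \<Longrightarrow> range (span5 u) \<subseteq> range (span5 y)"
begin

lemma span5_inj: "span5 y s = span5 y t \<longleftrightarrow> s = t"
  using independent[of "s - t"] by (auto simp: span5_diff)

lemma y_nonzero: "y i \<noteq> 0"
proof
  assume "y i = 0"
  then have "axis i (1 :: complex) = 0" using independent[of "axis i 1"] by (simp add: span5_axis)
  then show False by (simp add: axis_eq_0_iff)
qed

lemma y_wedge2: "y i \<in> wedge2"
  using y_decomposable[of i] wedge_in_wedge2 by auto

definition W :: "(complex ^ 6 ^ 6) set" where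
  "W = range (span5 y)"

definition pt :: "4 option \<Rightarrow> (complex ^ 6 ^ 6) set" where
  "pt i = mat.span {y i}"

lemma inj_y: "inj y"
proof (rule injI)
  fix i j assume "y i = y j"
  then have "axis i (1 :: complex) = axis j 1" by (simp add: span5_inj[symmetric] span5_axis)
  then show "i = j" by (simp add: inj_axis)
qed

lemma independent_range_y: "mat.independent (range y)"
proof (rule mat.independent_if_scalars_zero)
  fix f x assume *: "(\<Sum>x\<in>range y. mscale (f x) x) = 0" and x: "x \<in> range y"
  have "span5 y (\<chi> i. f (y i)) = (\<Sum>x\<in>range y. mscale (f x) x)"
    by (simp add: span5_def sum.reindex[OF inj_y])
  then have "(\<chi> i. f (y i)) = 0" using * by (intro independent) simp
  then show "f x = 0" using x by (auto simp: vec_eq_iff)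
qed simp

lemma W_span: "W = mat.span (range y)"
  by (simp add: W_def span_range_span5)

lemma subspace_W: "mat.subspace W"
  unfolding W_span by (rule mat.subspace_span)

lemma dim_W: "mat.dim W = 5"
  using mat.dim_eq_card_independent[OF independent_range_y] card_image[OF inj_y]
  by (simp add: W_span)

lemma inj_pt: "inj pt"
proof (rule injI)
  fix i j assume "pt i = pt j"
  then have "y i \<in> mat.span {y j}" unfolding pt_def using mat.span_base by fastforce
  then obtain c where "y i = mscale c (y j)" by (auto simp: span_singleton_mat)
  then have "span5 y (axis i 1) = span5 y (c *s axis j 1)" by (simp add: span5_axis span5_scale)
  then have "axis i 1 = c *s axis j 1" unfolding span5_inj .
  then have "axis i (1::complex) $ i = (c *s axis j 1) $ i" by simp
  then show "i = j" by (auto simp: axis_def split: if_splits)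
qed

lemma grassmann_points_W: "grassmann_points W = range pt"
proof
  show "range pt \<subseteq> grassmann_points W"
  proof safe
    fix i
    have "y i \<in> W" unfolding W_def by (metis rangeI span5_axis)
    then have "pt i \<in> proj_mat W" unfolding proj_mat_def pt_def using y_nonzero by blast
    moreover obtain a b where ab: "y i = wedge a b" using y_decomposable by blast
    then have "pt i = mat.span {wedge a b} \<and> wedge a b \<noteq> 0" using y_nonzero[of i] by (simp add: pt_def)
    then have "pt i \<in> grassmannian" unfolding grassmannian_def by blast
    ultimately show "pt i \<in> grassmann_points W" by (simp add: grassmann_points_def)
  qed
  show "grassmann_points W \<subseteq> range pt"
  proof
    fix p assume "p \<in> grassmann_points W"
    then obtain w a b where w: "w \<in> W" "w \<noteq> 0" "p = mat.span {w}" and ab: "wedge a b \<noteq> 0" "p = mat.span {wedge a b}"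
      unfolding grassmann_points_def proj_mat_def grassmannian_def by blast
    have "wedge a b \<in> p" unfolding ab(2) by (simp add: mat.span_base)
    moreover have "p \<subseteq> W" unfolding w(3) using w(1) subspace_W by (intro mat.span_minimal) auto
    ultimately obtain t where t: "wedge a b = span5 y t" unfolding W_def by blast
    then obtain i s where s: "t = s *s axis i 1" using only by metis
    have ws: "wedge a b = mscale s (y i)" unfolding t s by (simp add: span5_scale span5_axis)
    have "s \<noteq> 0" using ab(1) ws by auto
    have "p = pt i"
      unfolding ab(2) ws pt_def span_singleton_mat
    proof safe
      fix c show "mscale c (mscale s (y i)) \<in> range (\<lambda>c. mscale c (y i))" by auto
      have "mscale c (y i) = mscale (c / s) (mscale s (y i))" using \<open>s \<noteq> 0\<close> by simp
      then show "mscale c (y i) \<in> range (\<lambda>c. mscale c (mscale s (y i)))" by blast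
    qed
    then show "p \<in> range pt" by blast
  qed
qed

lemma five_point_space_W: "five_point_space A W"
proof -
  have "mat.dim (\<Union>(grassmann_points W)) = 5"
  proof -
    have "mat.span (\<Union>(grassmann_points W)) = W"
      unfolding grassmann_points_W
    proof
      have "y i \<in> pt i" for i unfolding pt_def by (simp add: mat.span_base)
      then show "W \<subseteq> mat.span (\<Union> (range pt))"
        unfolding W_span by (intro mat.span_mono) blast
      have "pt i \<subseteq> W" for i unfolding pt_def W_span by (intro mat.span_mono) simp
      then show "mat.span (\<Union> (range pt)) \<subseteq> W" by (intro mat.span_minimal subspace_W) blast
    qed
    then show ?thesis using dim_W by (metis mat.dim_span)
  qed
  moreover have "W \<subseteq> wedge2" unfolding W_def using span5_wedge2 y_wedge2 by blast
  moreover have "range (lin_map A) \<subseteq> W" unfolding W_def using lin_map_eq by auto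
  moreover have "card (grassmann_points W) = 5" unfolding grassmann_points_W using card_image[OF inj_pt] by simp
  ultimately show ?thesis unfolding five_point_space_def using subspace_W dim_W by simp
qed

text \<open>The Grassmann points of a candidate have decomposable representatives, which span it by
  the dimension condition. So \<open>maximal\<close> places it inside \<open>W\<close>, and the
  dimensions agree.\<close>

lemma five_point_space_unique:
  assumes V: "five_point_space A V"
  shows "V = W"
proof -
  have sub: "mat.subspace V" and dim: "mat.dim V = 5" and im: "range (lin_map A) \<subseteq> V"
    and card: "card (grassmann_points V) = 5" and pts: "mat.dim (\<Union>(grassmann_points V)) = 5"
    using V unfolding five_point_space_def by auto
  have fin: "finite (grassmann_points V)" using card by (intro card_ge_0_finite) simp
  obtain g where g: "bij_betw g (UNIV :: 4 option set) (grassmann_points V)"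
    using finite_same_card_bij[OF finite[of "UNIV :: 4 option set"] fin] card by auto
  have "\<forall>i. \<exists>u. (\<exists>a b. u = wedge a b) \<and> u \<noteq> 0 \<and> g i = mat.span {u} \<and> u \<in> V"
  proof
    fix i
    have "g i \<in> grassmann_points V" using g by (auto simp: bij_betw_def)
    then obtain w a b where w: "w \<in> V" "g i = mat.span {w}" and ab: "wedge a b \<noteq> 0" "g i = mat.span {wedge a b}"
      unfolding grassmann_points_def proj_mat_def grassmannian_def by blast
    have "wedge a b \<in> g i" unfolding ab(2) by (simp add: mat.span_base)
    moreover have "g i \<subseteq> V" unfolding w(2) using w(1) sub by (intro mat.span_minimal) auto
    ultimately show "\<exists>u. (\<exists>a b. u = wedge a b) \<and> u \<noteq> 0 \<and> g i = mat.span {u} \<and> u \<in> V"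
      using ab by blast
  qed
  then obtain u where u: "\<And>i. \<exists>a b. u i = wedge a b" "\<And>i. u i \<noteq> 0" "\<And>i. g i = mat.span {u i}" "\<And>i. u i \<in> V"
    by metis
  have "mat.span (\<Union>(grassmann_points V)) \<subseteq> mat.span (range u)"
  proof (intro mat.span_minimal mat.subspace_span Union_least)
    fix p assume "p \<in> grassmann_points V"
    then obtain i where "p = g i" using g by (auto simp: bij_betw_def)
    then show "p \<subseteq> mat.span (range u)" unfolding u(3) by (simp add: mat.span_mono)
  qed
  then have "5 \<le> mat.dim (mat.span (range u))"
    using matf.dim_subset pts by (metis mat.dim_span)
  moreover have uV: "mat.span (range u) \<subseteq> V" using u(4) by (intro mat.span_minimal sub) auto
  ultimately have "mat.span (range u) = V"
    using dim by (intro matf.subspace_dim_equal mat.subspace_span sub) auto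
  then have V_eq: "V = range (span5 u)" by (simp add: span_range_span5)
  then have "V \<subseteq> W" unfolding W_def using maximal[of u] u im by blast
  then show ?thesis using dim dim_W by (intro matf.subspace_dim_equal sub subspace_W) auto
qed

lemma five_point_space_iff: "five_point_space A V \<longleftrightarrow> V = W"
  using five_point_space_unique five_point_space_W by blast

definition H :: "4 option \<Rightarrow> (complex ^ 4) set" where
  "H i = {x. \<tau> x $ i = 0}"

lemma face_W: "face A W (pt i) = H i"
proof -
  have pts: "grassmann_points W - {pt i} = pt ` (UNIV - {i})"
    unfolding grassmann_points_W using inj_pt by (auto simp: inj_eq)
  have "span5 y t \<in> mat.span (\<Union>(pt ` (UNIV - {i}))) \<longleftrightarrow> t $ i = 0" for t
  proof
    assume t: "t $ i = 0"
    have "mscale (t $ j) (y j) \<in> mat.span (\<Union>(pt ` (UNIV - {i})))" for j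
    proof (cases "j = i")
      case False
      then have "y j \<in> \<Union>(pt ` (UNIV - {i}))" unfolding pt_def using mat.span_base[of "y j" "{y j}"] by blast
      then show ?thesis by (intro mat.span_scale mat.span_base)
    qed (simp add: t mat.span_zero)
    then show "span5 y t \<in> mat.span (\<Union>(pt ` (UNIV - {i})))"
      unfolding span5_def by (intro mat.span_sum)
  next
    define K where "K = span5 y ` {t. t $ i = 0}"
    have "mat.subspace K"
      unfolding mat.subspace_def
    proof (intro conjI ballI allI)
      have "0 = span5 y 0" by (simp add: span5_def)
      then show "0 \<in> K" unfolding K_def by force
      show "X + Y \<in> K" if "X \<in> K" "Y \<in> K" for X Y
        using that unfolding K_def by (force simp: span5_add[symmetric])
      show "mscale c X \<in> K" if "X \<in> K" for c X
        using that unfolding K_def by (force simp: span5_scale[symmetric])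
    qed
    moreover have "pt j \<subseteq> K" if "j \<noteq> i" for j
      unfolding pt_def
    proof (rule mat.span_minimal[OF _ \<open>mat.subspace K\<close>])
      have "axis j (1::complex) $ i = 0" using that by (simp add: axis_def)
      then show "{y j} \<subseteq> K" unfolding K_def by (auto simp: span5_axis[symmetric])
    qed
    ultimately have "mat.span (\<Union>(pt ` (UNIV - {i}))) \<subseteq> K" by (intro mat.span_minimal) auto
    moreover assume "span5 y t \<in> mat.span (\<Union>(pt ` (UNIV - {i})))"
    ultimately have "span5 y t \<in> K" by blast
    then show "t $ i = 0" unfolding K_def by (auto simp: span5_inj)
  qed
  then show ?thesis unfolding face_def pts H_def lin_map_eq by simp
qed

lemma faces_W: "faces A W = range H"
  unfolding faces_def grassmann_points_W by (simp add: image_image face_W)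

definition lf :: "4 option \<Rightarrow> complex ^ 4" where
  "lf i = (\<chi> k. \<tau> (axis k 1) $ i)"

lemma \<tau>_linear: "\<tau> (x + x') = \<tau> x + \<tau> x'" "\<tau> (c *s x) = c *s \<tau> x"
  unfolding span5_inj[symmetric] by (simp_all add: lin_map_eq[symmetric] lin_map_add lin_map_scale span5_add span5_scale)

lemma \<tau>_lf: "\<tau> x $ i = linear_form (lf i) x"
proof -
  have "\<tau> (\<Sum>k\<in>S. x $ k *s axis k 1) = (\<Sum>k\<in>S. x $ k *s \<tau> (axis k 1))" for S :: "4 set"
  proof (induction S rule: infinite_finite_induct)
    have "\<tau> (0 *s 0) = 0 *s \<tau> 0" by (rule \<tau>_linear)
    then have z: "\<tau> 0 = 0" by simp
    { case (infinite S) then show ?case by (simp add: z) }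
    { case empty then show ?case by (simp add: z) }
  next
    case (insert k S) then show ?case by (simp add: \<tau>_linear)
  qed
  then have "\<tau> x = (\<Sum>k\<in>UNIV. x $ k *s \<tau> (axis k 1))" by (metis axis_expand)
  then show ?thesis by (simp add: linear_form_def lf_def mult.commute)
qed

lemma H_kernel: "H i = {x. linear_form (lf i) x = 0}"
  by (simp add: H_def \<tau>_lf)

text \<open>The differences of two unit vectors lie in the hyperplane of sum zero. They are the test
  points for the five linear forms.\<close>

lemma separate:
  assumes "j \<noteq> k"
  obtains x where "\<And>i. \<tau> x $ i = (if i = j then 1 else 0) - (if i = k then 1 else 0)"
proof -
  have "(\<Sum>i\<in>UNIV. (\<chi> i. (if i = j then 1 else 0) - (if i = k then 1 else 0)) $ i) = (0 :: complex)"
    using assms by (simp add: sum_subtractf)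
  then obtain x where "\<tau> x = (\<chi> i. (if i = j then 1 else 0) - (if i = k then 1 else 0))"
    using surj_\<tau> by blast
  then show ?thesis using that[of x] by simp
qed

lemma third_index: "\<exists>k. k \<noteq> i \<and> k \<noteq> j" for i j :: "4 option"
proof (rule ccontr)
  assume "\<not> ?thesis"
  then have "(UNIV :: 4 option set) \<subseteq> {i, j}" by auto
  then have "card (UNIV :: 4 option set) \<le> card {i, j}" by (intro card_mono) auto
  also have "\<dots> \<le> 2" by (simp add: card_insert_if)
  finally show False by simp
qed

lemma inj_H: "inj H"
proof (rule injI, rule ccontr)
  fix i j assume eq: "H i = H j" and "i \<noteq> j"
  obtain k where k: "k \<noteq> i" "k \<noteq> j" using third_index by blast
  obtain x where x: "\<And>m. \<tau> x $ m = (if m = j then 1 else 0) - (if m = k then 1 else 0)"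
    using separate[of j k] k by metis
  have "x \<in> H i" using x[of i] k \<open>i \<noteq> j\<close> by (simp add: H_def)
  moreover have "x \<notin> H j" using x[of j] k by (simp add: H_def)
  ultimately show False using eq by blast
qed

lemma lf_nonzero: "lf i \<noteq> 0"
proof
  assume z: "lf i = 0"
  obtain k where k: "k \<noteq> i" using third_index by blast
  obtain x where "\<And>m. \<tau> x $ m = (if m = i then 1 else 0) - (if m = k then 1 else 0)"
    using separate[of i k] k by metis
  from this[of i] show False using k z by (simp add: \<tau>_lf linear_form_def)
qed

lemma dual_point_H: "dual_point (H i) = vec.span {lf i}"
  unfolding H_kernel by (rule dual_point_kernel[OF lf_nonzero])

lemma inj_dual_point: "inj_on dual_point (range H)"
proof (rule inj_onI)
  fix X Y assume "X \<in> range H" "Y \<in> range H" and eq: "dual_point X = dual_point Y"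
  have *: "Z = {x. \<forall>l\<in>dual_point Z. linear_form l x = 0}" if Z: "Z \<in> range H" for Z
  proof -
    obtain i where i: "Z = H i" using Z by blast
    have "lf i \<in> dual_point Z" unfolding i dual_point_H by (simp add: vec.span_base)
    then have "{x. \<forall>l\<in>dual_point Z. linear_form l x = 0} \<subseteq> Z"
      using H_kernel[of i] unfolding i by blast
    then show ?thesis by (auto simp: dual_point_def)
  qed
  have "X = {x. \<forall>l\<in>dual_point Y. linear_form l x = 0}"
    using *[OF \<open>X \<in> range H\<close>] unfolding eq .
  also have "\<dots> = Y" by (rule *[OF \<open>Y \<in> range H\<close>, symmetric])
  finally show "X = Y" .
qed

lemma complete_pentahedron_faces: "complete_pentahedron (range H)"
proof -
  have card: "card (range H) = 5" using card_image[OF inj_H] by simp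
  have "projective_basis (dual_point ` range H)"
    unfolding projective_basis_def
  proof (intro conjI ballI allI impI)
    fix p assume "p \<in> dual_point ` range H"
    then obtain i where p: "p = vec.span {lf i}" using dual_point_H by auto
    then show "vec.subspace p" by simp
    have "vec.independent {lf i}" using lf_nonzero by (simp add: vec.independent_insert)
    then have "vec.dim {lf i} = 1" by (simp add: vec.dim_eq_card_independent)
    then show "vec.dim p = 1" unfolding p by simp
  next
    show "card (dual_point ` range H) = CARD(4) + 1"
      using card_image[OF inj_dual_point] card by simp
  next
    fix T assume T: "T \<subseteq> dual_point ` range H" "card T = CARD(4)"
    define g where "g i = dual_point (H i)" for i
    have inj_g: "inj g" unfolding g_def using inj_dual_point inj_H by (auto simp: inj_def inj_on_def)
    define I where "I = {i. g i \<in> T}"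
    have TI: "T = g ` I" unfolding I_def using T(1) by (auto simp: g_def)
    have cardI: "card I = 4" using T(2) card_image[of g I] inj_g unfolding TI by (simp add: inj_on_subset)
    have "I \<noteq> UNIV" using cardI by auto
    then obtain j where j: "j \<notin> I" by blast
    \<comment> \<open>A relation between four of the forms is evaluated at the point with coordinate
      1 at \<open>i\<close> and -1 at the omitted index \<open>j\<close>.\<close>
    have zero: "s i = 0" if s: "(\<Sum>i\<in>I. s i *s lf i) = 0" and i: "i \<in> I" for s i
    proof -
      have "i \<noteq> j" using i j by auto
      then obtain x where x: "\<And>m. \<tau> x $ m = (if m = i then 1 else 0) - (if m = j then 1 else 0)"
        using separate by metis
      have "0 = (\<Sum>m\<in>I. s m * linear_form (lf m) x)"
        unfolding linear_form_left_sum[symmetric] s by (simp add: linear_form_def)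
      also have "\<dots> = (\<Sum>m\<in>I. if m = i then s m else 0)"
        using x j by (intro sum.cong) (auto simp: \<tau>_lf[symmetric])
      finally show ?thesis using i by simp
    qed
    have inj_lf: "inj_on lf I"
    proof (rule inj_onI)
      fix i k assume ik: "i \<in> I" "k \<in> I" "lf i = lf k"
      then have "H i = H k" by (simp add: H_kernel)
      then show "i = k" using inj_H by (simp add: inj_eq)
    qed
    have "vec.independent (lf ` I)"
    proof (rule vec.independent_if_scalars_zero)
      fix f x assume "(\<Sum>x\<in>lf ` I. f x *s x) = 0" "x \<in> lf ` I"
      then show "f x = 0" using zero[of "\<lambda>i. f (lf i)"] by (auto simp: sum.reindex[OF inj_lf])
    qed simp
    then have "vec.dim (lf ` I) = 4"
      using cardI card_image[OF inj_lf] by (simp add: vec.dim_eq_card_independent)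
    moreover have "vec.span (\<Union>T) = vec.span (lf ` I)"
    proof
      have "g i \<subseteq> vec.span (lf ` I)" if "i \<in> I" for i
        unfolding g_def dual_point_H using that by (intro vec.span_mono) simp
      then show "vec.span (\<Union>T) \<subseteq> vec.span (lf ` I)"
        unfolding TI by (intro vec.span_minimal) auto
      have "lf i \<in> g i" for i unfolding g_def dual_point_H by (simp add: vec.span_base)
      then show "vec.span (lf ` I) \<subseteq> vec.span (\<Union>T)"
        unfolding TI by (intro vec.span_mono) blast
    qed
    ultimately have "vec.dim (\<Union>T) = 4" by (metis vec.dim_span)
    then show "vec.dim (\<Union>T) = CARD(4)" by simp
  qed
  moreover have "is_plane (H i)" for i unfolding H_kernel by (rule is_plane_kernel[OF lf_nonzero])
  ultimately show ?thesis unfolding complete_pentahedron_def using card by blast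
qed

lemma inscribed_faces: "inscribed (range H) (pf_cubic A)"
  unfolding inscribed_def
proof (intro allI impI ballI)
  fix T x assume T: "T \<subseteq> range H" "card T = 3" and x: "x \<in> \<Inter>T"
  define J where "J = {i. H i \<in> T}"
  have TJ: "T = H ` J" unfolding J_def using T(1) by auto
  have "card J = 3" using T(2) card_image[of H J] inj_H unfolding TJ by (simp add: inj_on_subset)
  then have "card (- J) = 2" by (simp add: Compl_eq_Diff_UNIV card_Diff_subset)
  then obtain p q where pq: "- J = {p, q}" "p \<noteq> q" by (auto simp: card_2_iff)
  have z: "\<tau> x $ i = 0" if "i \<noteq> p" "i \<noteq> q" for i
  proof -
    have "i \<in> J" using pq that by blast
    then show ?thesis using x unfolding TJ H_def by auto
  qed
  have "lin_map A x = (\<Sum>i\<in>{p, q}. mscale (\<tau> x $ i) (y i))"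
    unfolding lin_map_eq span5_def using z by (intro sum.mono_neutral_right) auto
  also have "\<dots> = mscale (\<tau> x $ p) (y p) + mscale (\<tau> x $ q) (y q)" using pq(2) by simp
  finally show "pf_cubic A x = 0"
    unfolding pf_cubic_def using y_decomposable[of p] y_decomposable[of q] pfaffian_rank4 by auto
qed

lemma planes_divisor_faces: "planes_divisor (range H) = divisor_of (\<lambda>x. \<Prod>i\<in>UNIV. \<tau> x $ i)"
proof
  show "planes_divisor (range H) \<subseteq> divisor_of (\<lambda>x. \<Prod>i\<in>UNIV. \<tau> x $ i)"
  proof
    fix G assume "G \<in> planes_divisor (range H)"
    then obtain l where G: "G = (\<lambda>x. \<Prod>X\<in>range H. linear_form (l X) x)"
      and l: "\<And>i. H i = {x. linear_form (l (H i)) x = 0}"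
      unfolding planes_divisor_def by blast
    have "\<exists>s. s \<noteq> 0 \<and> l (H i) = s *s lf i" for i
    proof -
      have "l (H i) \<in> dual_point (H i)" using l[of i] by (auto simp: dual_point_def)
      then obtain s where s: "l (H i) = s *s lf i" unfolding dual_point_H by (auto simp: vec.span_singleton)
      have "s \<noteq> 0"
      proof
        assume "s = 0"
        then have "H i = UNIV" using l[of i] s by (simp add: linear_form_def)
        then have "linear_form (lf i) (axis k 1) = 0" for k unfolding H_kernel by blast
        then show False using lf_nonzero[of i] by (simp add: linear_form_axis vec_eq_iff)
      qed
      then show ?thesis using s by blast
    qed
    then obtain s where s: "\<And>i. s i \<noteq> 0" "\<And>i. l (H i) = s i *s lf i" by metis
    have "G = (\<lambda>x. (\<Prod>i\<in>UNIV. s i) * (\<Prod>i\<in>UNIV. \<tau> x $ i))"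
      unfolding G by (simp add: prod.reindex[OF inj_H] s(2) linear_form_scale \<tau>_lf prod.distrib)
    moreover have "(\<Prod>i\<in>UNIV. s i) \<noteq> 0" using s(1) by simp
    ultimately show "G \<in> divisor_of (\<lambda>x. \<Prod>i\<in>UNIV. \<tau> x $ i)" unfolding divisor_of_def by blast
  qed
  show "divisor_of (\<lambda>x. \<Prod>i\<in>UNIV. \<tau> x $ i) \<subseteq> planes_divisor (range H)"
  proof
    fix G assume "G \<in> divisor_of (\<lambda>x. \<Prod>i\<in>UNIV. \<tau> x $ i)"
    then obtain c where c: "c \<noteq> 0" "G = (\<lambda>x. c * (\<Prod>i\<in>UNIV. \<tau> x $ i))" unfolding divisor_of_def by blast
    \<comment> \<open>The scalar of the class is absorbed into the equation of a single
      plane.\<close>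
    define s where "s i = (if i = None then c else 1)" for i :: "4 option"
    define l where "l X = s (inv H X) *s lf (inv H X)" for X
    have lH: "l (H i) = s i *s lf i" for i by (simp add: l_def inv_f_f[OF inj_H])
    have "(\<Prod>i\<in>UNIV. s i) = c" by (simp add: s_def)
    then have "G = (\<lambda>x. \<Prod>X\<in>range H. linear_form (l X) x)"
      unfolding c(2) by (simp add: prod.reindex[OF inj_H] lH linear_form_scale \<tau>_lf prod.distrib)
    moreover have "H i = {x. linear_form (l (H i)) x = 0}" for i
      unfolding lH using c(1) by (simp add: linear_form_scale s_def H_kernel)
    ultimately show "G \<in> planes_divisor (range H)" unfolding planes_divisor_def by blast
  qed
qed

lemma product_nonzero: "(\<lambda>x. \<Prod>i\<in>UNIV. \<tau> x $ i) \<noteq> (\<lambda>x. 0)"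
proof
  assume z: "(\<lambda>x. \<Prod>i\<in>UNIV. \<tau> x $ i) = (\<lambda>x. 0)"
  \<comment> \<open>A point of the hyperplane of sum zero with all coordinates nonzero.\<close>
  obtain x where "\<tau> x = (\<chi> i. if i = None then - 4 else 1)"
    using surj_\<tau>[of "\<chi> i. if i = None then - 4 else 1"] by (auto simp: sum_option)
  then have "(\<Prod>i\<in>UNIV. \<tau> x $ i) \<noteq> 0" by simp
  then show False using z by metis
qed

end

subsection \<open>Existence and uniqueness of the five points\<close>

text \<open>Five decomposable bivectors whose span contains the image of the tensor can be rescaled such
  that this image becomes the hyperplane where the coordinates add up to zero: if the linear form
  cutting out the image vanished at one of them, that bivector would lie in the image,
  contradicting injectivity on quadrics.\<close>

lemma decomposable_span_solutions:
  fixes u :: "4 option \<Rightarrow> complex ^ 6 ^ 6"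
  assumes inj: "quad_inj A" and dec: "\<And>i. \<exists>a b. u i = wedge a b" and nz: "\<And>i. u i \<noteq> 0"
    and im: "range (lin_map A) \<subseteq> range (span5 u)"
  shows "in_quad A (star (span5 u s) (A $ m))"
proof -
  have star_u: "star (u i) (u i) a b c d = 0" for i a b c d
    using dec[of i] by (auto simp: star_wedge)
  have u_wedge2: "u i \<in> wedge2" for i using dec[of i] wedge_in_wedge2 by auto
  have "\<forall>m. \<exists>t. A $ m = span5 u t"
  proof
    fix m
    have "lin_map A (axis m 1) \<in> range (span5 u)" using im by blast
    then show "\<exists>t. A $ m = span5 u t" by (auto simp: lin_map_axis)
  qed
  then obtain t where t: "\<And>m. A $ m = span5 u (t m)" by metis
  define \<theta> where "\<theta> x = colsum t x" for x
  have sum: "span5 u (\<Sum>m\<in>S. f m) = (\<Sum>m\<in>S. span5 u (f m))" for f and S :: "4 set"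
  proof (induction S rule: infinite_finite_induct)
    case (insert m S) then show ?case by (simp add: span5_add)
  qed (simp_all add: span5_def)
  have lin_\<theta>: "lin_map A x = span5 u (\<theta> x)" for x
    unfolding \<theta>_def colsum_def sum span5_scale lin_map_def t ..
  have \<theta>_lin: "\<theta> (x + x') = \<theta> x + \<theta> x'" "\<theta> (c *s x) = c *s \<theta> x" for x x' c
    unfolding \<theta>_def colsum_matrix by (simp_all add: matrix_vector_right_distrib vector_scalar_commute)
  have not_axis: "\<theta> x \<noteq> axis i 1" for x i
  proof
    assume "\<theta> x = axis i 1"
    then have "lin_map A x = u i" by (simp add: lin_\<theta> span5_axis)
    moreover from this have "x = 0" using star_u[of i] by (intro quad_inj_star_self[OF inj]) simp
    ultimately show False using nz[of i] by (simp add: lin_map_zero)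
  qed
  \<comment> \<open>Since \<open>u None\<close> is not in the image, it completes the image to the
    full span. The \<open>None\<close> coordinate of the inverse of \<open>\<Phi>\<close> is then
    the linear form cutting out the image, with value \<open>\<alpha> i\<close> at
    \<open>u i\<close>.\<close>
  define \<Phi> where "\<Phi> v = v $ None *s axis None 1 + \<theta> (affine_part v)" for v
  have aff: "affine_part (v + w) = affine_part v + affine_part w" "affine_part (c *s v) = c *s affine_part v" for v w c
    by (simp_all add: affine_part_def vec_eq_iff)
  have lin: "Vector_Spaces.linear (*s) (*s) \<Phi>"
    unfolding Vector_Spaces.linear_iff
    by (simp add: vec.vector_space_axioms \<Phi>_def aff \<theta>_lin)
  have "inj \<Phi>"
  proof (rule linear_inj_kernel[OF lin])
    fix v assume v: "\<Phi> v = 0"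
    have N: "v $ None = 0"
    proof (rule ccontr)
      assume n: "v $ None \<noteq> 0"
      have "\<theta> ((- 1 / v $ None) *s affine_part v) = axis None 1"
      proof -
        have "\<theta> (affine_part v) = (- v $ None) *s axis None 1"
          using v by (simp add: \<Phi>_def add_eq_0_iff) 
        then show ?thesis unfolding \<theta>_lin using n by (simp add: vector_smult_assoc)
      qed
      then show False using not_axis by blast
    qed
    then have "lin_map A (affine_part v) = 0" using v by (simp add: \<Phi>_def lin_\<theta> span5_def)
    then have "affine_part v = 0" by (rule quad_inj_lin_map[OF inj])
    then show "v = 0" using N by (simp add: affine_part_def vec_eq_iff split_option_all)
  qed
  moreover have "surj \<Phi>" using vec.linear_injective_imp_surjective[OF lin] \<open>inj \<Phi>\<close> by blast
  ultimately have "\<forall>v. \<exists>w. \<Phi> w = v" by (metis surjD)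
  then obtain \<Psi> where \<Psi>: "\<And>v. \<Phi> (\<Psi> v) = v" by metis
  have \<Psi>': "\<Psi> (\<Phi> v) = v" for v using \<Psi> \<open>inj \<Phi>\<close> by (metis injD)
  define \<alpha> where "\<alpha> i = \<Psi> (axis i 1) $ None" for i
  have \<alpha>: "\<alpha> i \<noteq> 0" for i
  proof
    assume "\<alpha> i = 0"
    then have "\<theta> (affine_part (\<Psi> (axis i 1))) = axis i 1"
      using \<Psi>[of "axis i 1"] by (simp add: \<Phi>_def \<alpha>_def)
    then show False using not_axis by blast
  qed
  have \<Psi>_None: "\<Psi> v $ None = (\<Sum>i\<in>UNIV. v $ i * \<alpha> i)" for v
  proof -
    have "\<Phi> (colsum (\<lambda>i. \<Psi> (axis i 1)) v) = (\<Sum>i\<in>UNIV. v $ i *s \<Phi> (\<Psi> (axis i 1)))"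
      unfolding colsum_def vec.linear_sum[OF lin] linear_scale_vec[OF lin] ..
    also have "\<dots> = v" unfolding \<Psi> by (rule axis_expand)
    finally have "\<Psi> v = colsum (\<lambda>i. \<Psi> (axis i 1)) v" using \<Psi>' by metis
    then show ?thesis by (simp add: colsum_def \<alpha>_def)
  qed
  have t_sum: "(\<Sum>i\<in>UNIV. t m $ i * \<alpha> i) = 0" for m
  proof -
    have "\<theta> (axis m 1) = t m"
      by (simp add: \<theta>_def colsum_def vec_eq_iff axis_def if_distrib[of "\<lambda>x. x * _"] cong: if_cong)
    then have "\<Phi> (embed (axis m 1)) = t m" by (simp add: \<Phi>_def affine_part_embed embed_None)
    then have "\<Psi> (t m) = embed (axis m 1)" using \<Psi>' by metis
    then show ?thesis using \<Psi>_None[of "t m"] by (simp add: embed_None)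
  qed
  \<comment> \<open>Dividing by \<open>\<alpha> i\<close> turns this linear form into the coordinate
    sum.\<close>
  define y where "y i = mscale (1 / \<alpha> i) (u i)" for i
  define G where "G = (\<chi> m i. t m $ Some i * \<alpha> (Some i))"
  interpret P: pentad A y G
  proof
    show "quad_inj A" by (rule inj)
    show "y i \<in> wedge2" for i unfolding y_def by (rule mat.subspace_scale[OF subspace_wedge2 u_wedge2])
    show "star (y i) (y i) a b c d = 0" for i a b c d
      by (simp add: y_def star_scale_left star_scale_right star_u)
    fix m
    have y: "mscale (c * \<alpha> i) (y i) = mscale c (u i)" for c i using \<alpha>[of i] by (simp add: y_def)
    have "t m $ None * \<alpha> None = - (\<Sum>i\<in>UNIV. G $ m $ i)"
      using t_sum[of m] by (simp add: sum_option G_def eq_neg_iff_add_eq_0)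
    then have "mscale (t m $ None) (u None) = - (\<Sum>i\<in>UNIV. mscale (G $ m $ i) (y None))"
      unfolding y[symmetric] by (simp add: mat.scale_sum_left)
    then have "span5 u (t m) = (\<Sum>i\<in>UNIV. mscale (G $ m $ i) (y (Some i))) - (\<Sum>i\<in>UNIV. mscale (G $ m $ i) (y None))"
      unfolding span5_def sum_option by (simp add: G_def y)
    then show "A $ m = (\<Sum>i\<in>UNIV. mscale (G $ m $ i) (y (Some i) - y None))"
      unfolding t by (simp add: mat.scale_right_diff_distrib sum_subtractf)
  qed
  have "span5 u s = span5 y (\<chi> i. s $ i * \<alpha> i)"
    unfolding span5_def y_def using \<alpha> by simp
  then show ?thesis using P.in_quad_star_A by simp
qed

context solution
begin

lemma pentahedral_exists:
  assumes skew: "\<And>k. A $ k \<in> wedge2" and F: "F A \<noteq> 0"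
  obtains y \<tau> c where "pentahedral A y \<tau>" "c \<noteq> 0" "\<And>x. quintic A x = c * (\<Prod>i\<in>UNIV. \<tau> x $ i)"
proof -
  have nz: "d A \<noteq> 0" "\<delta>0 A \<noteq> 0" using F by (auto simp: F_def)
  note sol = solved[OF skew nz(1)]
  obtain v :: "4 option \<Rightarrow> complex ^ 4 option" and c where vN: "\<And>i. v i $ None = 1" and span: "\<And>x. \<exists>t. x = colsum v t"
    and ind: "\<And>t. colsum v t = 0 \<Longrightarrow> t = 0"
    and dec: "\<And>i a b c d. star (L A (v i)) (L A (v i)) a b c d = 0"
    and only: "\<And>x. \<forall>a b c d. star (L A x) (L A x) a b c d = 0 \<Longrightarrow> \<exists>i s. x = s *s v i"
    and c: "c \<noteq> 0" "\<And>x t. embed x = colsum v t \<Longrightarrow> quintic A x = c * (\<Prod>i\<in>UNIV. t $ i)"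
    by (rule five_points[OF skew F]) (rule that, assumption+)
  define y where "y i = L A (v i)" for i
  obtain coord where coord: "\<And>x. x = colsum v (coord x)" using span by metis
  define \<tau> where "\<tau> x = coord (embed x)" for x
  have L_colsum: "L A (colsum v t) = span5 y t" for t
    unfolding colsum_def L_sum L_scale span5_def y_def ..
  \<comment> \<open>The normalization of the \<open>v i\<close> makes the hyperplane
    \<open>None\<close> = 0, that is the image of the tensor, the one of coordinate sum
    zero.\<close>
  have colsum_None: "colsum v t $ None = (\<Sum>i\<in>UNIV. t $ i)" for t
    by (simp add: colsum_def vN)
  have colsum_inj: "s = t" if "colsum v s = colsum v t" for s t
  proof -
    have "colsum v (s - t) = 0" using that by (simp add: colsum_matrix matrix_vector_mult_diff_distrib)
    then show ?thesis using ind by fastforce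
  qed
  have L_wedge2: "L A x \<in> wedge2" for x
    unfolding L_def lin_map_def using sol skew
    by (intro mat.subspace_add[OF subspace_wedge2] mat.subspace_sum[OF subspace_wedge2]
        mat.subspace_scale[OF subspace_wedge2]) auto
  have range_L: "range (L A) = range (span5 y)"
  proof safe
    fix x show "L A x \<in> range (span5 y)" using coord[of x] L_colsum by (metis rangeI)
  next
    fix t show "span5 y t \<in> range (L A)" unfolding L_colsum[symmetric] by blast
  qed
  have "pentahedral A y \<tau>"
  proof
    show "\<exists>a b. y i = wedge a b" for i
      using decomposable[OF L_wedge2 dec] unfolding y_def by metis
    show "t = 0" if "span5 y t = 0" for t
    proof -
      have "colsum v t = 0" using that unfolding L_colsum[symmetric] by (rule L_inj[OF nz(2)])
      then show ?thesis by (rule ind)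
    qed
    show "\<exists>i s. t = s *s axis i 1" if "span5 y t = wedge a b" for t a b
    proof -
      have "star (L A (colsum v t)) (L A (colsum v t)) i j k l = 0" for i j k l
        unfolding L_colsum that by (rule star_wedge)
      then obtain i s where "colsum v t = s *s v i" using only by blast
      moreover have "s *s v i = colsum v (s *s axis i 1)"
        by (simp add: colsum_def axis_def vec_eq_iff if_distrib[of "\<lambda>x. _ * x * _"] cong: if_cong)
      ultimately show ?thesis using colsum_inj by metis
    qed
    show "lin_map A x = span5 y (\<tau> x)" for x
      unfolding \<tau>_def L_colsum[symmetric] coord[symmetric] by (rule L_embed[symmetric])
    show "(\<Sum>i\<in>UNIV. \<tau> x $ i) = 0" for x
      unfolding \<tau>_def colsum_None[symmetric] coord[symmetric] by (rule embed_None)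
    show "\<exists>x. \<tau> x = t" if "(\<Sum>i\<in>UNIV. t $ i) = 0" for t
    proof -
      have "embed (affine_part (colsum v t)) = colsum v t"
        using that by (intro embed_affine_part) (simp add: colsum_None)
      then have "\<tau> (affine_part (colsum v t)) = t"
        unfolding \<tau>_def by (intro colsum_inj[OF trans[OF coord[symmetric]]])
      then show ?thesis by blast
    qed
    show "inj (lin_map A)" using sol by (intro quad_inj_inj) blast
    fix u :: "4 option \<Rightarrow> complex ^ 6 ^ 6"
    assume u: "\<And>i. \<exists>a b. u i = wedge a b" "\<And>i. u i \<noteq> 0" "range (lin_map A) \<subseteq> range (span5 u)"
    show "range (span5 u) \<subseteq> range (span5 y)"
    \<comment> \<open>Elements of the span of \<open>u\<close> solve the linear condition, as do the
      values of \<open>L A\<close>. Two solutions with the same \<open>ell\<close> agree.\<close>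
    proof clarify
      fix s
      have "invertible (ell_matrix A)" using nz(2) by (simp add: \<delta>0_def invertible_det_nz)
      then obtain N where "ell_matrix A ** N = mat 1" by (auto simp: invertible_def)
      then have "ell (span5 u s) = ell_matrix A *v (N *v ell (span5 u s))"
        by (simp add: matrix_vector_mul_assoc)
      then obtain x where x: "ell (span5 u s) = ell (L A x)" by (metis ell_matrix_mult)
      have u_wedge2: "u i \<in> wedge2" for i using u(1)[of i] wedge_in_wedge2 by auto
      have "in_quad A (star (L A x) (A $ m))" for m
      proof -
        have b: "in_quad A (star (\<beta> A) (A $ m))"
          unfolding in_quad_def by (rule exI[of _ "q A m"]) (use sol in blast)
        have l: "in_quad A (star (lin_map A (affine_part x)) (A $ m))"
          using in_quad_star_lin_map[of A "affine_part x" "axis m 1"] by (simp add: lin_map_axis)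
        have "star (L A x) (A $ m) = (\<lambda>i j k l. x $ None * star (\<beta> A) (A $ m) i j k l
            + star (lin_map A (affine_part x)) (A $ m) i j k l)"
          by (simp add: fun_eq_iff L_def star_add_left star_scale_left)
        then show ?thesis using in_quad_add[OF in_quad_scale[OF b] l] by (simp only:)
      qed
      note Lx = this
      have su: "in_quad A (star (span5 u s) (A $ m))" for m
        using sol by (intro decomposable_span_solutions u) auto
      have "in_quad A (star (span5 u s - L A x) (A $ m))" for m
        by (intro in_quad_star_diff su Lx)
      moreover have "span5 u s - L A x \<in> wedge2"
        by (intro mat.subspace_diff[OF subspace_wedge2] span5_wedge2 u_wedge2 L_wedge2)
      moreover have "ell (span5 u s - L A x) = 0" using x by (simp add: ell_diff)
      ultimately have "span5 u s - L A x = 0" using sol unfolding sol_inj_def by blast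
      then show "span5 u s \<in> range (span5 y)" unfolding range_L[symmetric] by simp
    qed
  qed
  moreover have "quintic A x = c * (\<Prod>i\<in>UNIV. \<tau> x $ i)" for x
    by (rule c(2)) (simp add: \<tau>_def coord[symmetric])
  ultimately show ?thesis using that c(1) by blast
qed

end

subsection \<open>The group action\<close>

definition cg :: "complex ^ 6 ^ 6 \<Rightarrow> complex ^ 6 ^ 6 \<Rightarrow> complex ^ 6 ^ 6" where
  "cg P X = transpose P ** X ** P"

lemma cg_add: "cg P (X + Y) = cg P X + cg P Y"
  by (simp add: cg_def matrix_matrix_mult_def vec_eq_iff algebra_simps sum.distrib)

lemma cg_scale: "cg P (mscale c X) = mscale c (cg P X)"
  by (simp add: cg_def matrix_matrix_mult_def vec_eq_iff mscale_def sum_distrib_left sum_distrib_right mult_ac)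

lemma cg_comp: "cg P (cg Q X) = cg (Q ** P) X"
  by (simp add: cg_def matrix_transpose_mul matrix_mul_assoc)

lemma cg_one: "cg (mat 1) X = X"
  by (simp add: cg_def transpose_mat)

lemma cg_outer: "cg P (outer a b) = outer (a v* P) (b v* P)"
proof -
  have "cg P (outer a b) $ i $ j = outer (a v* P) (b v* P) $ i $ j" for i j
  proof -
    have "cg P (outer a b) $ i $ j = (\<Sum>k\<in>UNIV. \<Sum>n\<in>UNIV. (a $ n * P $ n $ i) * (b $ k * P $ k $ j))"
      by (simp add: cg_def outer_def matrix_matrix_mult_def transpose_def sum_distrib_left sum_distrib_right mult_ac)
    also have "\<dots> = outer (a v* P) (b v* P) $ i $ j"
      by (subst sum.swap) (simp add: outer_def vector_matrix_mult_def sum_product mult_ac)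
    finally show ?thesis .
  qed
  then show ?thesis by (simp add: vec_eq_iff)
qed

lemma cg_wedge: "cg P (wedge a b) = wedge (a v* P) (b v* P)"
proof -
  have "cg P (X - Y) = cg P X - cg P Y" for X Y using cg_add[of P "X - Y" Y] by simp
  then show ?thesis by (simp add: wedge_outer cg_outer)
qed

lemma cg_span5: "cg P (span5 y t) = span5 (\<lambda>i. cg P (y i)) t"
proof -
  have "cg P (\<Sum>i\<in>S. mscale (t $ i) (y i)) = (\<Sum>i\<in>S. mscale (t $ i) (cg P (y i)))" for S :: "4 option set"
  proof (induction S rule: infinite_finite_induct)
    case (insert i S) then show ?case by (simp add: cg_add cg_scale)
  qed (simp_all add: cg_def matrix_matrix_mult_def vec_eq_iff)
  then show ?thesis by (simp add: span5_def)
qed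

lemma cg_inverse:
  assumes "P ** Q = mat 1"
  shows "cg Q (cg P X) = X"
  using assms by (simp add: cg_comp cg_one)

lemma lin_map_gl_action: "lin_map (gl_action P A) x = cg P (lin_map A x)"
  by (simp add: lin_map_congruence cg_def)

lemma gl_action_comp: "gl_action P (gl_action Q A) = gl_action (Q ** P) A"
  by (simp add: gl_action_def vec_eq_iff matrix_transpose_mul matrix_mul_assoc)

lemma invertible_one: "invertible (mat 1 :: complex ^ 6 ^ 6)"
  by (auto simp: invertible_def intro: exI[of _ "mat 1"])

lemma gl_action_one: "gl_action (mat 1) A = A"
  by (simp add: gl_action_def transpose_mat vec_eq_iff)

lemma cg_wedge2:
  assumes "X \<in> wedge2" shows "cg P X \<in> wedge2"
proof -
  have "transpose (cg P X) = cg P (transpose X)"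
    by (simp add: cg_def matrix_transpose_mul matrix_mul_assoc)
  also have "transpose X = mscale (-1) X"
    using assms by (simp add: wedge2_def mscale_def vec_eq_iff)
  also have "cg P (mscale (-1) X) = - cg P X" unfolding cg_scale by (simp add: mscale_def vec_eq_iff)
  finally show ?thesis by (simp add: wedge2_def)
qed

lemma gl_action_tensors_sm:
  assumes A: "A \<in> tensors_sm" and P: "invertible P"
  shows "gl_action P A \<in> tensors_sm"
proof -
  have "smooth_cubic (pf_cubic (gl_action P A))"
    unfolding smooth_pf_cubic_iff
  proof (intro allI impI)
    fix x :: "complex ^ 4" assume "x \<noteq> 0"
    then obtain i where "pol3 (A $ i) (lin_map A x) (lin_map A x) \<noteq> 0"
      using A unfolding tensors_sm_def smooth_pf_cubic_iff by blast
    moreover have "det P \<noteq> 0" using P by (simp add: invertible_det_nz)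
    moreover have "gl_action P A $ i = transpose P ** A $ i ** P" by (simp add: gl_action_def)
    ultimately show "\<exists>i. pol3 (gl_action P A $ i) (lin_map (gl_action P A) x) (lin_map (gl_action P A) x) \<noteq> 0"
      by (intro exI[of _ i]) (simp add: lin_map_congruence pol3_congruence)
  qed
  moreover have "gl_action P A $ k \<in> wedge2" for k
    using A cg_wedge2[of "A $ k" P] by (simp add: tensors_sm_def gl_action_def cg_def)
  ultimately show ?thesis by (simp add: tensors_sm_def)
qed

text \<open>The coordinates \<tau> do not change, so the planes depend only on the orbit.\<close>

lemma pentahedral_gl_action:
  assumes "pentahedral A y \<tau>" and P: "invertible P"
  shows "pentahedral (gl_action P A) (\<lambda>i. cg P (y i)) \<tau>"
proof -
  interpret pentahedral A y \<tau> by fact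
  obtain Q where Q: "P ** Q = mat 1" "Q ** P = mat 1" using P unfolding invertible_def by blast
  have inj: "X = Y" if "cg P X = cg P Y" for X Y using cg_inverse[OF Q(1)] that by metis
  have zero: "cg R 0 = 0" for R by (simp add: cg_def matrix_matrix_mult_def vec_eq_iff)
  show ?thesis
  proof
    show "\<exists>a b. cg P (y i) = wedge a b" for i using y_decomposable[of i] cg_wedge by metis
    show "t = 0" if "span5 (\<lambda>i. cg P (y i)) t = 0" for t
    proof -
      have "cg P (span5 y t) = cg P 0" using that by (simp add: cg_span5 zero)
      then have "span5 y t = 0" by (rule inj)
      then show ?thesis by (rule independent)
    qed
    show "\<exists>i s. t = s *s axis i 1" if "span5 (\<lambda>i. cg P (y i)) t = wedge a b" for t a b
    proof -
      have "span5 y t = cg Q (wedge a b)" using that cg_inverse[OF Q(1), of "span5 y t"] by (simp add: cg_span5)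
      then show ?thesis unfolding cg_wedge by (rule only)
    qed
    show "lin_map (gl_action P A) x = span5 (\<lambda>i. cg P (y i)) (\<tau> x)" for x
      by (simp add: lin_map_gl_action lin_map_eq cg_span5)
    show "(\<Sum>i\<in>UNIV. \<tau> x $ i) = 0" for x by (rule sum_zero)
    show "\<exists>x. \<tau> x = t" if "(\<Sum>i\<in>UNIV. t $ i) = 0" for t using that by (rule surj_\<tau>)
    show "inj (lin_map (gl_action P A))"
      using inj_lin_map unfolding lin_map_gl_action inj_def by (metis inj)
    fix u :: "4 option \<Rightarrow> complex ^ 6 ^ 6"
    assume u: "\<And>i. \<exists>a b. u i = wedge a b" "\<And>i. u i \<noteq> 0"
      "range (lin_map (gl_action P A)) \<subseteq> range (span5 u)"
    have "range (span5 (\<lambda>i. cg Q (u i))) \<subseteq> range (span5 y)"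
    proof (rule maximal)
      show "\<exists>a b. cg Q (u i) = wedge a b" for i using u(1)[of i] cg_wedge by metis
      show "cg Q (u i) \<noteq> 0" for i using u(2)[of i] cg_inverse[OF Q(2), of "u i"] zero by metis
      show "range (lin_map A) \<subseteq> range (span5 (\<lambda>i. cg Q (u i)))"
      proof clarify
        fix x
        obtain t where "lin_map (gl_action P A) x = span5 u t" using u(3) by blast
        then have "lin_map A x = cg Q (span5 u t)"
          using cg_inverse[OF Q(1), of "lin_map A x"] by (simp add: lin_map_gl_action)
        then show "lin_map A x \<in> range (span5 (\<lambda>i. cg Q (u i)))" by (simp add: cg_span5)
      qed
    qed
    note sub = this
    show "range (span5 u) \<subseteq> range (span5 (\<lambda>i. cg P (y i)))"
    proof clarify
      fix t
      obtain s where "span5 (\<lambda>i. cg Q (u i)) t = span5 y s" using sub by blast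
      moreover have "span5 u t = cg P (span5 (\<lambda>i. cg Q (u i)) t)"
        unfolding cg_span5 cg_inverse[OF Q(2)] by simp
      ultimately show "span5 u t \<in> range (span5 (\<lambda>i. cg P (y i)))" by (simp add: cg_span5)
    qed
  qed
qed

lemma polynomial_gl_action:
  assumes "polynomial f" shows "polynomial (\<lambda>A. f (gl_action P A))"
  using assms
proof induction
  case (coord k i j)
  show ?case unfolding gl_action_def matrix_matrix_mult_def
    by (simp, intro polynomial_intros)
qed (auto intro: polynomial.intros)

lemma divisor_of_scale:
  assumes "c \<noteq> 0" shows "divisor_of (\<lambda>x. c * f x) = divisor_of f"
proof -
  have "\<exists>b. b \<noteq> 0 \<and> (\<lambda>x. a * (c * f x)) = (\<lambda>x. b * f x)" if "a \<noteq> 0" for a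
    using that assms by (intro exI[of _ "a * c"]) (simp add: mult.assoc)
  moreover have "\<exists>b. b \<noteq> 0 \<and> (\<lambda>x. a * f x) = (\<lambda>x. b * (c * f x))" if "a \<noteq> 0" for a
    using that assms by (intro exI[of _ "a / c"]) simp
  ultimately show ?thesis unfolding divisor_of_def by blast
qed

lemma equiv_gl_rel: "equiv tensors_sm gl_rel"
proof (rule equivI)
  show "gl_rel \<subseteq> tensors_sm \<times> tensors_sm" unfolding gl_rel_def by blast
  show "refl_on tensors_sm gl_rel"
    unfolding refl_on_def gl_rel_def
  proof (safe)
    fix A :: tensor
    show "\<exists>P. invertible P \<and> A = gl_action P A" by (metis gl_action_one invertible_one)
  qed
  show "sym gl_rel"
    unfolding sym_def gl_rel_def
  proof safe
    fix A P assume "invertible (P :: complex ^ 6 ^ 6)"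
    then obtain Q where Q: "P ** Q = mat 1" "Q ** P = mat 1" unfolding invertible_def by blast
    then have "invertible Q" unfolding invertible_def by blast
    moreover have "A = gl_action Q (gl_action P A)" by (simp add: gl_action_comp Q gl_action_one)
    ultimately show "\<exists>Q. invertible Q \<and> A = gl_action Q (gl_action P A)" by blast
  qed
  show "trans gl_rel"
    unfolding trans_def gl_rel_def
  proof safe
    fix A P Q assume "invertible (P :: complex ^ 6 ^ 6)" "invertible (Q :: complex ^ 6 ^ 6)"
    then show "\<exists>R. invertible R \<and> gl_action Q (gl_action P A) = gl_action R A"
      unfolding gl_action_comp by (metis invertible_mult)
  qed
qed

theorem corollary4p3:
  shows "\<exists>D \<Phi>. rational_map_to_\<H> D \<Phi> \<and>
    (\<forall>A\<in>\<Union>D. inj (lin_map A) \<and>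
      (\<exists>!W. five_point_space A W) \<and>
      (\<forall>W. five_point_space A W \<longrightarrow>
         complete_pentahedron (faces A W) \<and> inscribed (faces A W) (pf_cubic A) \<and>
         \<Phi> (gl_rel `` {A}) = (divisor_of (pf_cubic A), planes_divisor (faces A W))))"
proof -
  obtain d e \<beta> q q0 where "solution d e \<beta> q q0" using solution_exists by blast
  then interpret S: solution d e \<beta> q q0 .
  \<comment> \<open>\<open>F\<close> uses the fixed coordinates \<open>ell\<close> and is not a
    function of orbits, so its nonvanishing locus is saturated by the group.\<close>
  define U where "U = {A \<in> tensors_sm. \<exists>P. invertible P \<and> S.F (gl_action P A) \<noteq> 0}"
  define D where "D = (\<lambda>A. gl_rel `` {A}) ` U"
  \<comment> \<open>Defined through an arbitrary representative; the fact \<open>\<Phi>\<close>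
    below shows that the choice does not matter.\<close>
  define \<Phi> where "\<Phi> Z = (let A = SOME A. A \<in> Z in
    (divisor_of (pf_cubic A), planes_divisor (faces A (THE W. five_point_space A W))))" for Z
  have U_sm: "A \<in> tensors_sm" if "A \<in> U" for A using that unfolding U_def by blast
  have skew: "A $ k \<in> wedge2" if "A \<in> tensors_sm" for A k using that by (simp add: tensors_sm_def)
  have U_gl: "gl_action P A \<in> U" if A: "A \<in> U" and P: "invertible P" for A P
  proof -
    obtain R where R: "invertible R" "S.F (gl_action R A) \<noteq> 0" using A unfolding U_def by blast
    obtain Q where Q: "P ** Q = mat 1" "Q ** P = mat 1" using P unfolding invertible_def by blast
    then have "invertible Q" unfolding invertible_def by blast
    then have "invertible (Q ** R)" using R(1) by (rule invertible_mult)
    moreover have "gl_action (Q ** R) (gl_action P A) = gl_action R A"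
      by (simp add: gl_action_comp matrix_mul_assoc Q)
    ultimately show ?thesis unfolding U_def using gl_action_tensors_sm[OF U_sm[OF A] P] R(2) by auto
  qed
  have in_class: "A \<in> gl_rel `` {A}" if "A \<in> U" for A
    using equiv_class_self[OF equiv_gl_rel U_sm[OF that]] .
  have union: "\<Union>D = U"
  proof
    show "\<Union>D \<subseteq> U" unfolding D_def gl_rel_def using U_gl by auto
    show "U \<subseteq> \<Union>D" unfolding D_def using in_class by blast
  qed
  have F_U: "A \<in> U" if "A \<in> tensors_sm" "S.F A \<noteq> 0" for A
    unfolding U_def using that invertible_one by (auto simp: gl_action_one intro!: exI[of _ "mat 1"])
  have pent: "\<exists>y \<tau> c. pentahedral A y \<tau> \<and> c \<noteq> 0 \<and> (\<forall>x. S.quintic (gl_action P A) x = c * (\<Prod>i\<in>UNIV. \<tau> x $ i))"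
    if A: "A \<in> tensors_sm" and P: "invertible P" "S.F (gl_action P A) \<noteq> 0" for A P
  proof -
    have sm: "gl_action P A \<in> tensors_sm" by (rule gl_action_tensors_sm[OF A P(1)])
    obtain y \<tau> c where p: "pentahedral (gl_action P A) y \<tau>" and c: "c \<noteq> 0"
      "\<And>x. S.quintic (gl_action P A) x = c * (\<Prod>i\<in>UNIV. \<tau> x $ i)"
      using S.pentahedral_exists[OF skew[OF sm] P(2)] by metis
    obtain Q where Q: "P ** Q = mat 1" "Q ** P = mat 1" using P(1) unfolding invertible_def by blast
    then have "invertible Q" unfolding invertible_def by blast
    then have "pentahedral (gl_action Q (gl_action P A)) (\<lambda>i. cg Q (y i)) \<tau>"
      by (rule pentahedral_gl_action[OF p])
    moreover have "gl_action Q (gl_action P A) = A" by (simp add: gl_action_comp Q gl_action_one)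
    ultimately show ?thesis using c by auto
  qed
  have pent_U: "\<exists>y \<tau>. pentahedral A y \<tau>" if "A \<in> U" for A
    using that pent unfolding U_def by blast
  have \<Phi>: "\<Phi> (gl_rel `` {A}) = (divisor_of (pf_cubic A), divisor_of (\<lambda>x. \<Prod>i\<in>UNIV. \<tau> x $ i))"
    if A: "A \<in> U" and p: "pentahedral A y \<tau>" for A y \<tau>
  proof -
    define B where "B = (SOME B. B \<in> gl_rel `` {A})"
    have "B \<in> gl_rel `` {A}" unfolding B_def using in_class[OF A] by (rule someI)
    then obtain P where P: "invertible P" "B = gl_action P A" unfolding gl_rel_def by blast
    interpret B: pentahedral B "\<lambda>i. cg P (y i)" \<tau>
      unfolding P(2) by (rule pentahedral_gl_action[OF p P(1)])
    have "(THE W. five_point_space B W) = B.W" unfolding B.five_point_space_iff by simp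
    then have "planes_divisor (faces B (THE W. five_point_space B W)) = divisor_of (\<lambda>x. \<Prod>i\<in>UNIV. \<tau> x $ i)"
      by (simp add: B.faces_W B.planes_divisor_faces)
    moreover have "divisor_of (pf_cubic B) = divisor_of (pf_cubic A)"
    proof -
      have "pf_cubic B = (\<lambda>x. det P * pf_cubic A x)" unfolding P(2) by (rule ext, rule pf_cubic_gl_action)
      moreover have "det P \<noteq> 0" using P(1) by (simp add: invertible_det_nz)
      ultimately show ?thesis by (simp add: divisor_of_scale)
    qed
    ultimately show ?thesis unfolding \<Phi>_def B_def[symmetric] Let_def by simp
  qed
  have main: "inj (lin_map A) \<and> (\<exists>!W. five_point_space A W) \<and>
      (\<forall>W. five_point_space A W \<longrightarrow>
         complete_pentahedron (faces A W) \<and> inscribed (faces A W) (pf_cubic A) \<and>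
         \<Phi> (gl_rel `` {A}) = (divisor_of (pf_cubic A), planes_divisor (faces A W)))"
    if A: "A \<in> U" for A
  proof -
    obtain y \<tau> where p: "pentahedral A y \<tau>" using pent_U[OF A] by blast
    then interpret A: pentahedral A y \<tau> .
    show ?thesis
      unfolding A.five_point_space_iff \<Phi>[OF A p]
      using A.inj_lin_map A.complete_pentahedron_faces A.inscribed_faces
      by (simp add: A.faces_W A.planes_divisor_faces)
  qed
  have dense: "zariski_dense U"
    unfolding zariski_dense_def
  proof (intro allI impI)
    fix N assume N: "zariski_open N \<and> N \<noteq> {}"
    then obtain E where E: "\<forall>f\<in>E. polynomial f" "N = {A \<in> tensors_sm. \<exists>f\<in>E. f A \<noteq> 0}"
      unfolding zariski_open_def by blast
    then obtain A f where "A \<in> tensors_sm" "f \<in> E" "f A \<noteq> 0" using N by blast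
    then obtain C where "C \<in> tensors_sm" "f C \<noteq> 0" "S.F C \<noteq> 0"
      using tensors_sm_irreducible[OF _ _ _ S.base_wedge2 S.polynomial_F S.F_base] E(1) by metis
    then have "C \<in> N \<inter> U" using F_U E(2) \<open>f \<in> E\<close> by blast
    then show "N \<inter> U \<noteq> {}" by blast
  qed
  have "zariski_open tensors_sm"
    unfolding zariski_open_def by (intro exI[of _ "{\<lambda>A. 1}"]) (auto intro: polynomial.const)
  then have "U \<noteq> {}" using dense tensors_sm_nonempty unfolding zariski_dense_def by blast
  have open_P: "zariski_open {A \<in> tensors_sm. S.F (gl_action P A) \<noteq> 0}" for P
    unfolding zariski_open_def
    by (intro exI[of _ "{\<lambda>A. S.F (gl_action P A)}"]) (auto intro: polynomial_gl_action S.polynomial_F)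
  have open_U: "zariski_open U"
    unfolding zariski_open_def
    by (intro exI[of _ "{\<lambda>A. S.F (gl_action P A) | P. invertible P}"])
      (auto simp: U_def intro: polynomial_gl_action S.polynomial_F)
  have reg3: "regular_map 3 U (\<lambda>A. fst (\<Phi> (gl_rel `` {A})))"
    unfolding regular_map_def
  proof
    fix A assume "A \<in> U"
    obtain c where c: "\<forall>m. polynomial (c m)" "\<forall>A. pf_cubic A = form 3 (\<lambda>m. c m A)"
      using form_family_pf_cubic unfolding form_family_def by blast
    have "form 3 (\<lambda>m. c m B) \<noteq> (\<lambda>x. 0) \<and> fst (\<Phi> (gl_rel `` {B})) = divisor_of (form 3 (\<lambda>m. c m B))"
      if B: "B \<in> U" for B
    proof -
      have eq: "pf_cubic B = form 3 (\<lambda>m. c m B)" using c(2) by blast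
      have "smooth_cubic (pf_cubic B)" using U_sm[OF B] by (simp add: tensors_sm_def)
      then have "pf_cubic B \<noteq> (\<lambda>x. 0)" by (simp add: smooth_cubic_def)
      moreover obtain y \<tau> where "pentahedral B y \<tau>" using pent_U[OF B] by blast
      ultimately show ?thesis unfolding eq[symmetric] using \<Phi>[OF B] by simp
    qed
    then show "\<exists>N c. zariski_open N \<and> A \<in> N \<and> N \<subseteq> U \<and> (\<forall>m. polynomial (c m)) \<and>
        (\<forall>B\<in>N. form 3 (\<lambda>m. c m B) \<noteq> (\<lambda>x. 0) \<and> fst (\<Phi> (gl_rel `` {B})) = divisor_of (form 3 (\<lambda>m. c m B)))"
      using open_U \<open>A \<in> U\<close> c(1) by blast
  qed
  have reg5: "regular_map 5 U (\<lambda>A. snd (\<Phi> (gl_rel `` {A})))"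
    unfolding regular_map_def
  proof
    fix A assume A: "A \<in> U"
    then obtain P where P: "invertible P" "S.F (gl_action P A) \<noteq> 0" unfolding U_def by blast
    \<comment> \<open>The quintic is known to be the product of the five forms only where
      \<open>F\<close> is nonzero. Near \<open>A\<close> the quintic of the translate by the fixed
      \<open>P\<close> is therefore used, which has the same planes.\<close>
    define N where "N = {B \<in> tensors_sm. S.F (gl_action P B) \<noteq> 0}"
    obtain c0 where c0: "\<forall>m. polynomial (c0 m)" "\<forall>A. S.quintic A = form 5 (\<lambda>m. c0 m A)"
      using S.form_family_quintic unfolding form_family_def by blast
    define c where "c m B = c0 m (gl_action P B)" for m B
    have NU: "N \<subseteq> U" unfolding N_def U_def using P(1) by blast
    have "form 5 (\<lambda>m. c m B) \<noteq> (\<lambda>x. 0) \<and> snd (\<Phi> (gl_rel `` {B})) = divisor_of (form 5 (\<lambda>m. c m B))"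
      if B: "B \<in> N" for B
    proof -
      have eq: "form 5 (\<lambda>m. c m B) = S.quintic (gl_action P B)" using c0(2) by (simp add: c_def)
      obtain y \<tau> s where p: "pentahedral B y \<tau>" and s: "s \<noteq> 0"
        "\<And>x. S.quintic (gl_action P B) x = s * (\<Prod>i\<in>UNIV. \<tau> x $ i)"
        using pent[of B P] B P(1) unfolding N_def by blast
      have q: "S.quintic (gl_action P B) = (\<lambda>x. s * (\<Prod>i\<in>UNIV. \<tau> x $ i))" using s(2) by (rule ext)
      have "S.quintic (gl_action P B) \<noteq> (\<lambda>x. 0)"
      proof
        assume "S.quintic (gl_action P B) = (\<lambda>x. 0)"
        then have "(\<lambda>x. \<Prod>i\<in>UNIV. \<tau> x $ i) = (\<lambda>x. 0)" using s by (auto simp: fun_eq_iff)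
        then show False using pentahedral.product_nonzero[OF p] by blast
      qed
      moreover have "snd (\<Phi> (gl_rel `` {B})) = divisor_of (S.quintic (gl_action P B))"
        using \<Phi>[OF _ p] B NU unfolding q divisor_of_scale[OF s(1)] by auto
      ultimately show ?thesis unfolding eq by simp
    qed
    moreover have "zariski_open N" unfolding N_def by (rule open_P)
    moreover have "A \<in> N" unfolding N_def using P U_sm[OF A] by blast
    moreover have "\<forall>m. polynomial (c m)" unfolding c_def using c0(1) polynomial_gl_action by blast
    ultimately show "\<exists>N c. zariski_open N \<and> A \<in> N \<and> N \<subseteq> U \<and> (\<forall>m. polynomial (c m)) \<and>
        (\<forall>B\<in>N. form 5 (\<lambda>m. c m B) \<noteq> (\<lambda>x. 0) \<and> snd (\<Phi> (gl_rel `` {B})) = divisor_of (form 5 (\<lambda>m. c m B)))"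
      using NU by blast
  qed
  have "\<Phi> (gl_rel `` {A}) \<in> \<H>" if A: "A \<in> U" for A
  proof -
    obtain W where "five_point_space A W" using main[OF A] by blast
    then show ?thesis
      using main[OF A] U_sm[OF A] unfolding \<H>_def tensors_sm_def by blast
  qed
  then have "\<Phi> ` D \<subseteq> \<H>" unfolding D_def by blast
  moreover have "D \<subseteq> tensors_sm // gl_rel" unfolding D_def quotient_def using U_sm by blast
  ultimately have "rational_map_to_\<H> D \<Phi>"
    unfolding rational_map_to_\<H>_def union using \<open>U \<noteq> {}\<close> open_U dense reg3 reg5
    by (auto simp: D_def)
  then show ?thesis
    by (intro exI[of _ D] exI[of _ \<Phi>], intro conjI[OF _ ballI[OF main]]) (simp_all only: union)
qed

end
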